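(* Let $N\ge 2$, let $\Omega\subset\mathbb{R}^N$ be a bounded domain, let $2<p<2^*$, and assume $\lambda_2\ge\lambda_1>\lambda_1(\Omega)$. Then there exists a constant $\delta_0>0$ such that for every $\beta\in(-\delta_0,1)$ the level $m_\beta=\inf_{\mathcal{N}_\beta}J_\beta$ is attained by a non-negative vectorial solution $(u_\beta,v_\beta)$ of the system $(LS)$. Moreover, $m_\beta\to-\infty$ as $\beta\to1^-$.
   Context: Here $2^*=2N/(N-2)$ if $N\ge3$, $2^*=\infty$ if $N=2$, and $\lambda_1(\Omega)$ is the first eigenvalue of $-\Delta$ on $\Omega$ with Dirichlet boundary condition. For $\beta\in\mathbb{R}$, the system $(LS)$ is $$\begin{cases}-\Delta u=\lambda_1u-|u|^{p-2}u+\beta|u|^{\frac p2-2}u\,|v|^{\frac p2}&\text{in }\Omega,\\ -\Delta v=\lambda_2v-|v|^{p-2}v+\beta|u|^{\frac p2}|v|^{\frac p2-2}v&\text{in }\Omega,\\ u,v\in H_0^1(\Omega),\end{cases}$$ understood in the weak sense, where $|s|^{\frac p2-2}s:=0$ at $s=0$. Set $\mathcal{H}=H_0^1(\Omega)\times H_0^1(\Omega)$ and $$J_\beta(u,v)=\frac12\int_\Omega\big(|\nabla u|^2-\lambda_1u^2+|\nabla v|^2-\lambda_2v^2\big)+\frac1p\int_\Omega\big(|u|^p+|v|^p\big)-\frac{2\beta}{p}\int_\Omega|u|^{\frac p2}|v|^{\frac p2}.$$ The Nehari set $\mathcal{N}_\beta$ is the set of $(u,v)\in\mathcal{H}\setminus\{(0,0)\}$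 with $$\int_\Omega\big(|\nabla u|^2-\lambda_1u^2+|\nabla v|^2-\lambda_2v^2\big)+\int_\Omega\big(|u|^p+|v|^p\big)-2\beta\int_\Omega|u|^{\frac p2}|v|^{\frac p2}=0,$$ and $m_\beta:=\inf_{(u,v)\in\mathcal{N}_\beta}J_\beta(u,v)$. A solution $(u,v)$ is vectorial if $u\ne0$ and $v\ne0$; it is non-negative if $u\ge0$ and $v\ge0$ in $\Omega$. That $m_\beta$ is attained by $(u_\beta,v_\beta)$ means $(u_\beta,v_\beta)\in\mathcal{N}_\beta$ and $J_\beta(u_\beta,v_\beta)=m_\beta$. *)

theory Defs
  imports "HOL-Analysis.Analysis"
begin

text \<open>
  Elements of Lebesgue and Sobolev spaces over \<open>\<Omega>\<close> are represented by functions on the whole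
  space of which only the values on \<open>\<Omega>\<close> matter, and those up to Lebesgue null sets.
  Accordingly, \<open>u = 0\<close> and \<open>u \<ge> 0\<close> are read almost everywhere in \<open>\<Omega>\<close>.
\<close>

definition domain :: "'a::euclidean_space set \<Rightarrow> bool" where
  "domain \<Omega> \<longleftrightarrow> open \<Omega> \<and> connected \<Omega> \<and> \<Omega> \<noteq> {}"

definition critical_exponent :: "nat \<Rightarrow> ereal" where
  "critical_exponent N = (if N \<ge> 3 then ereal (2 * real N / (real N - 2)) else \<infinity>)"

definition ae_zero :: "'a::euclidean_space set \<Rightarrow> ('a \<Rightarrow> real) \<Rightarrow> bool" where
  "ae_zero \<Omega> u \<longleftrightarrow> (AE x in lebesgue_on \<Omega>. u x = 0)"

definition ae_nonneg :: "'a::euclidean_space set \<Rightarrow> ('a \<Rightarrow> real) \<Rightarrow> bool" where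
  "ae_nonneg \<Omega> u \<longleftrightarrow> (AE x in lebesgue_on \<Omega>. 0 \<le> u x)"


subsection \<open>The space \<open>H\<^sub>0\<^sup>1\<close>\<close>

primrec iter_pderiv :: "'a list \<Rightarrow> ('a::euclidean_space \<Rightarrow> real) \<Rightarrow> 'a \<Rightarrow> real" where
  "iter_pderiv [] f = f"
| "iter_pderiv (e # es) f = (\<lambda>x. frechet_derivative (iter_pderiv es f) (at x) e)"

text \<open>Differentiability of every iterated partial derivative already forces their continuity.\<close>

definition smooth_fun :: "('a::euclidean_space \<Rightarrow> real) \<Rightarrow> bool" where
  "smooth_fun f \<longleftrightarrow> (\<forall>es. set es \<subseteq> Basis \<longrightarrow> (\<forall>x. iter_pderiv es f differentiable (at x)))"

definition test_funs :: "'a::euclidean_space set \<Rightarrow> ('a \<Rightarrow> real) set" where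
  "test_funs \<Omega> =
    {\<phi>. smooth_fun \<phi> \<and> compact (closure {x. \<phi> x \<noteq> 0}) \<and> closure {x. \<phi> x \<noteq> 0} \<subseteq> \<Omega>}"

definition square_integrable ::
  "'a::euclidean_space set \<Rightarrow> ('a \<Rightarrow> 'b::euclidean_space) \<Rightarrow> bool" where
  "square_integrable \<Omega> f \<longleftrightarrow>
    f \<in> borel_measurable (lebesgue_on \<Omega>) \<and> integrable (lebesgue_on \<Omega>) (\<lambda>x. (norm (f x))\<^sup>2)"

definition locally_integrable ::
  "'a::euclidean_space set \<Rightarrow> ('a \<Rightarrow> 'b::euclidean_space) \<Rightarrow> bool" where
  "locally_integrable \<Omega> f \<longleftrightarrow> (\<forall>K. compact K \<and> K \<subseteq> \<Omega> \<longrightarrow> integrable (lebesgue_on K) f)"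

definition has_weak_gradient ::
  "'a::euclidean_space set \<Rightarrow> ('a \<Rightarrow> real) \<Rightarrow> ('a \<Rightarrow> 'a) \<Rightarrow> bool" where
  "has_weak_gradient \<Omega> u g \<longleftrightarrow>
    locally_integrable \<Omega> u \<and> locally_integrable \<Omega> g \<and>
    (\<forall>\<phi>\<in>test_funs \<Omega>. \<forall>i\<in>Basis.
      (LINT x|lebesgue_on \<Omega>. u x * frechet_derivative \<phi> (at x) i) =
      - (LINT x|lebesgue_on \<Omega>. (g x \<bullet> i) * \<phi> x))"

text \<open>The weak gradient is unique up to null sets, so any choice of representative will do.\<close>

definition weak_grad :: "'a::euclidean_space set \<Rightarrow> ('a \<Rightarrow> real) \<Rightarrow> 'a \<Rightarrow> 'a" where
  "weak_grad \<Omega> u = (SOME g. has_weak_gradient \<Omega> u g)"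

definition H1 :: "'a::euclidean_space set \<Rightarrow> ('a \<Rightarrow> real) set" where
  "H1 \<Omega> =
    {u. square_integrable \<Omega> u \<and> (\<exists>g. has_weak_gradient \<Omega> u g \<and> square_integrable \<Omega> g)}"

definition H1_norm :: "'a::euclidean_space set \<Rightarrow> ('a \<Rightarrow> real) \<Rightarrow> real" where
  "H1_norm \<Omega> u = sqrt (LINT x|lebesgue_on \<Omega>. (norm (weak_grad \<Omega> u x))\<^sup>2 + (u x)\<^sup>2)"

definition H10 :: "'a::euclidean_space set \<Rightarrow> ('a \<Rightarrow> real) set" where
  "H10 \<Omega> =
    {u \<in> H1 \<Omega>. \<exists>\<phi>. (\<forall>n::nat. \<phi> n \<in> test_funs \<Omega>) \<and>
       (\<lambda>n. H1_norm \<Omega> (\<lambda>x. \<phi> n x - u x)) \<longlonglongrightarrow> 0}"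


subsection \<open>The Dirichlet Laplacian\<close>

definition dirichlet_eigenvalue :: "'a::euclidean_space set \<Rightarrow> real \<Rightarrow> bool" where
  "dirichlet_eigenvalue \<Omega> \<mu> \<longleftrightarrow>
    (\<exists>w\<in>H10 \<Omega>. \<not> ae_zero \<Omega> w \<and>
      (\<forall>\<phi>\<in>H10 \<Omega>. (LINT x|lebesgue_on \<Omega>. weak_grad \<Omega> w x \<bullet> weak_grad \<Omega> \<phi> x) =
                   (LINT x|lebesgue_on \<Omega>. \<mu> * w x * \<phi> x)))"

definition first_eigenvalue :: "'a::euclidean_space set \<Rightarrow> real" where
  "first_eigenvalue \<Omega> = (LEAST \<mu>. dirichlet_eigenvalue \<Omega> \<mu>)"


subsection \<open>The system and its variational structure\<close>

text \<open>
  Since \<open>0 powr a = 0\<close>, the convention that \<open>|s|\<^bsup>p/2-2\<^esup>s\<close> vanishes at \<open>s = 0\<close> is built into the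
  formulas below.
\<close>

definition LS_solution ::
  "'a::euclidean_space set \<Rightarrow> real \<Rightarrow> real \<Rightarrow> real \<Rightarrow> real \<Rightarrow> ('a \<Rightarrow> real) \<Rightarrow> ('a \<Rightarrow> real) \<Rightarrow> bool"
  where
  "LS_solution \<Omega> p lam1 lam2 \<beta> u v \<longleftrightarrow>
    u \<in> H10 \<Omega> \<and> v \<in> H10 \<Omega> \<and>
    (\<forall>\<phi>\<in>H10 \<Omega>.
      (LINT x|lebesgue_on \<Omega>. weak_grad \<Omega> u x \<bullet> weak_grad \<Omega> \<phi> x) =
      (LINT x|lebesgue_on \<Omega>.
        (lam1 * u x - \<bar>u x\<bar> powr (p - 2) * u x
          + \<beta> * \<bar>u x\<bar> powr (p / 2 - 2) * u x * \<bar>v x\<bar> powr (p / 2)) * \<phi> x)) \<and>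
    (\<forall>\<phi>\<in>H10 \<Omega>.
      (LINT x|lebesgue_on \<Omega>. weak_grad \<Omega> v x \<bullet> weak_grad \<Omega> \<phi> x) =
      (LINT x|lebesgue_on \<Omega>.
        (lam2 * v x - \<bar>v x\<bar> powr (p - 2) * v x
          + \<beta> * \<bar>u x\<bar> powr (p / 2) * \<bar>v x\<bar> powr (p / 2 - 2) * v x) * \<phi> x))"

definition quad_part ::
  "'a::euclidean_space set \<Rightarrow> real \<Rightarrow> real \<Rightarrow> ('a \<Rightarrow> real) \<Rightarrow> ('a \<Rightarrow> real) \<Rightarrow> real" where
  "quad_part \<Omega> lam1 lam2 u v =
    (LINT x|lebesgue_on \<Omega>.
      (norm (weak_grad \<Omega> u x))\<^sup>2 - lam1 * (u x)\<^sup>2 + (norm (weak_grad \<Omega> v x))\<^sup>2 - lam2 * (v x)\<^sup>2)"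

definition power_part ::
  "'a::euclidean_space set \<Rightarrow> real \<Rightarrow> ('a \<Rightarrow> real) \<Rightarrow> ('a \<Rightarrow> real) \<Rightarrow> real" where
  "power_part \<Omega> p u v = (LINT x|lebesgue_on \<Omega>. \<bar>u x\<bar> powr p + \<bar>v x\<bar> powr p)"

definition coupling_part ::
  "'a::euclidean_space set \<Rightarrow> real \<Rightarrow> ('a \<Rightarrow> real) \<Rightarrow> ('a \<Rightarrow> real) \<Rightarrow> real" where
  "coupling_part \<Omega> p u v = (LINT x|lebesgue_on \<Omega>. \<bar>u x\<bar> powr (p / 2) * \<bar>v x\<bar> powr (p / 2))"

definition J_energy ::
  "'a::euclidean_space set \<Rightarrow> real \<Rightarrow> real \<Rightarrow> real \<Rightarrow> real \<Rightarrow> ('a \<Rightarrow> real) \<Rightarrow> ('a \<Rightarrow> real) \<Rightarrow> real"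
  where
  "J_energy \<Omega> p lam1 lam2 \<beta> u v =
    1 / 2 * quad_part \<Omega> lam1 lam2 u v + 1 / p * power_part \<Omega> p u v
      - 2 * \<beta> / p * coupling_part \<Omega> p u v"

definition nehari_set ::
  "'a::euclidean_space set \<Rightarrow> real \<Rightarrow> real \<Rightarrow> real \<Rightarrow> real \<Rightarrow> (('a \<Rightarrow> real) \<times> ('a \<Rightarrow> real)) set"
  where
  "nehari_set \<Omega> p lam1 lam2 \<beta> =
    {(u, v). u \<in> H10 \<Omega> \<and> v \<in> H10 \<Omega> \<and> \<not> (ae_zero \<Omega> u \<and> ae_zero \<Omega> v) \<and>
       quad_part \<Omega> lam1 lam2 u v + power_part \<Omega> p u v - 2 * \<beta> * coupling_part \<Omega> p u v = 0}"

text \<open>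
  The infimum is taken in the extended reals, where it always exists; on \<open>real\<close> the value of
  \<open>Inf\<close> would be unspecified for sets that are empty or not bounded below.
\<close>

definition nehari_level ::
  "'a::euclidean_space set \<Rightarrow> real \<Rightarrow> real \<Rightarrow> real \<Rightarrow> real \<Rightarrow> ereal" where
  "nehari_level \<Omega> p lam1 lam2 \<beta> =
    (INF (u, v)\<in>nehari_set \<Omega> p lam1 lam2 \<beta>. ereal (J_energy \<Omega> p lam1 lam2 \<beta> u v))"

end

theory Submission
  imports Defs "HOL-Library.Diagonal_Subsequence"
begin

text \<open>
  For \<open>\<beta> < 1\<close> the restriction of \<open>J\<^sub>\<beta>\<close> to the ray through
  \<open>(u, v)\<close> is \<open>t\<^sup>2 Q / 2 + t\<^sup>p R / p\<close>, where \<open>Q\<close> is the quadratic part and \<open>R\<close> the power part minus the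
  coupling, and its derivative at \<open>t = 1\<close> is the Nehari functional \<open>Q + R\<close>. A global minimiser of \<open>J\<^sub>\<beta>\<close>
  other than \<open>(0, 0)\<close> therefore lies on the Nehari set, so that \<open>m\<^sub>\<beta>\<close> is the minimum of \<open>J\<^sub>\<beta>\<close> over all
  of \<open>H\<^sub>0\<^sup>1 \<times> H\<^sub>0\<^sup>1\<close> (\<open>minimiser_on_nehari\<close>). This turns the theorem into four statements about global
  minimisers.

  They exist (\<open>minimiser_exists\<close>): since \<open>p > 2\<close> and \<open>\<beta> < 1\<close>, the gradient-free part of the integrand
  dominates \<open>u\<^sup>2 + v\<^sup>2\<close> up to a constant, a minimising sequence is bounded in \<open>H\<^sub>0\<^sup>1\<close>, Rellich's theorem gives
  a subsequence that converges almost everywhere, and Fatou's lemma together with the lower semicontinuity of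
  the Dirichlet energy shows that the limit is a minimiser. They solve the system
  (\<open>minimiser_LS_solution\<close>), and they may be taken non-negative, because replacing \<open>(u, v)\<close> by
  \<open>(\<bar>u\<bar>, \<bar>v\<bar>)\<close> does not increase the energy (\<open>J_energy_abs_le\<close>).

  They are vectorial (\<open>ground_states\<close>): on pairs with one vanishing component \<open>J\<^sub>\<beta>\<close> does not depend on
  \<open>\<beta>\<close> and is at least the minimum \<open>e\<^sub>1\<close> or \<open>e\<^sub>2\<close> of the scalar energy with parameter \<open>lam1\<close> or \<open>lam2\<close>.
  Both are negative, since both parameters exceed the first eigenvalue. If \<open>U\<close> and \<open>V\<close> attain them, then
  \<open>J\<^sub>\<beta> U V\<close> is \<open>e\<^sub>1 + e\<^sub>2\<close> minus \<open>2 \<beta> / p\<close> times the coupling of \<open>U\<close> and \<open>V\<close>. For \<open>\<beta> \<ge> 0\<close>, and for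
  small negative \<open>\<beta>\<close>, this is below both \<open>e\<^sub>1\<close> and \<open>e\<^sub>2\<close>.

  Finally, with an eigenfunction \<open>w\<close> for the first eigenvalue, \<open>J\<^sub>\<beta> (t w) (t w)\<close> is \<open>- c t\<^sup>2\<close> with \<open>c > 0\<close>
  plus \<open>(1 - \<beta>)\<close> times a factor that depends on \<open>t\<close> alone. Fixing a large \<open>t\<close> and letting \<open>\<beta>\<close> tend to \<open>1\<close>
  drives the level to \<open>-\<infinity>\<close>.

  Behind this lies a small theory of \<open>H\<^sub>0\<^sup>1\<close>. Its elements are represented by Borel functions on the whole
  space, as the closure of the graph of the gradient over test functions in \<open>L\<^sup>2 \<times> L\<^sup>2\<close>; that this agrees
  with the definition by weak gradients rests on the fundamental lemma of the calculus of variations.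
  Both the compactness theorem and the Sobolev embedding come from one estimate (\<open>cube_avg_L2_estimate\<close>):
  replacing \<open>u\<close> by its averages over cubes of side \<open>s\<close> changes it in \<open>L\<^sup>2\<close> by at most a constant times
  \<open>s\<close> times the norm of its gradient.
\<close>

section \<open>Smooth functions and bump functions\<close>

text \<open>
  Recursion on the first partial derivatives makes the sum, product and chain rules inductions on the order;
  in \<open>iter_pderiv\<close> the head of the list is the derivative that is taken last.
\<close>

primrec Cdiff :: "nat \<Rightarrow> ('a::euclidean_space \<Rightarrow> real) \<Rightarrow> bool" where
  "Cdiff 0 f = (\<forall>x. f differentiable (at x))"
| "Cdiff (Suc n) f = ((\<forall>x. f differentiable (at x)) \<and>
     (\<forall>e\<in>Basis. Cdiff n (\<lambda>x. frechet_derivative f (at x) e)))"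

lemma iter_pderiv_snoc:
  "iter_pderiv (es @ [e]) f = iter_pderiv es (\<lambda>x. frechet_derivative f (at x) e)"
  by (induction es) auto

lemma Cdiff_iff_iter_pderiv:
  "Cdiff n f \<longleftrightarrow> (\<forall>es. set es \<subseteq> Basis \<and> length es \<le> n \<longrightarrow> (\<forall>x. iter_pderiv es f differentiable (at x)))"
proof (induction n arbitrary: f)
  case 0
  then show ?case by auto
next
  case (Suc n)
  have "(\<forall>x. iter_pderiv es f differentiable (at x))"
    if "Cdiff (Suc n) f" "set es \<subseteq> Basis" "length es \<le> Suc n" for es
  proof (cases es rule: rev_cases)
    case Nil then show ?thesis using that by simp
  next
    case (snoc ys y)
    then show ?thesis using that Suc.IH[of "\<lambda>x. frechet_derivative f (at x) y"]
      by (auto simp: iter_pderiv_snoc)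
  qed
  moreover have "Cdiff (Suc n) f"
    if *: "\<forall>es. set es \<subseteq> Basis \<and> length es \<le> Suc n \<longrightarrow> (\<forall>x. iter_pderiv es f differentiable (at x))"
  proof -
    have "\<forall>x. f differentiable (at x)" using *[rule_format, of "[]"] by simp
    moreover have "Cdiff n (\<lambda>x. frechet_derivative f (at x) e)" if "e \<in> Basis" for e
      unfolding Suc.IH
    proof (intro allI impI)
      fix es :: "'a list" and x assume "set es \<subseteq> Basis \<and> length es \<le> n"
      then show "iter_pderiv es (\<lambda>x. frechet_derivative f (at x) e) differentiable at x"
        using *[rule_format, of "es @ [e]" x] that by (simp add: iter_pderiv_snoc)
    qed
    ultimately show ?thesis by simp
  qed
  ultimately show ?case by blast
qed

lemma smooth_fun_iff_Cdiff: "smooth_fun f \<longleftrightarrow> (\<forall>n. Cdiff n f)"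
  unfolding smooth_fun_def Cdiff_iff_iter_pderiv by auto

lemma Cdiff_differentiable: "Cdiff n f \<Longrightarrow> f differentiable (at x)"
  by (cases n) auto

lemma Cdiff_SucD: "Cdiff (Suc n) f \<Longrightarrow> Cdiff n f"
  by (induction n arbitrary: f) auto

lemma Cdiff_SucI:
  assumes "\<And>x. (f has_derivative f' x) (at x)" and "\<And>e. e \<in> Basis \<Longrightarrow> Cdiff n (\<lambda>x. f' x e)"
  shows "Cdiff (Suc n) f"
proof -
  have "frechet_derivative f (at x) = f' x" for x
    using frechet_derivative_at[OF assms(1)] by simp
  then show ?thesis using assms by (auto simp: differentiable_def)
qed

lemma differentiable_has_derivative:
  "f differentiable (at x) \<Longrightarrow> (f has_derivative frechet_derivative f (at x)) (at x)"
  by (simp add: frechet_derivative_works)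

lemma Cdiff_const: "Cdiff n (\<lambda>x. c)"
  by (induction n arbitrary: c) (auto simp: frechet_derivative_const)

lemma Cdiff_inner: "Cdiff n (\<lambda>x. x \<bullet> i)"
proof (cases n)
  case (Suc m)
  have "Cdiff (Suc m) (\<lambda>x. x \<bullet> i)"
    by (rule Cdiff_SucI[where f' = "\<lambda>x h. h \<bullet> i"]) (auto intro!: derivative_eq_intros Cdiff_const)
  then show ?thesis by (simp add: Suc)
qed (auto simp: differentiable_def intro!: derivative_eq_intros)

lemma Cdiff_add: "Cdiff n f \<Longrightarrow> Cdiff n g \<Longrightarrow> Cdiff n (\<lambda>x. f x + g x)"
proof (induction n arbitrary: f g)
  case (Suc n)
  show ?case
  proof (rule Cdiff_SucI)
    show "((\<lambda>x. f x + g x) has_derivative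
        (\<lambda>h. frechet_derivative f (at x) h + frechet_derivative g (at x) h)) (at x)" for x
      using Suc.prems by (auto intro!: has_derivative_add differentiable_has_derivative)
  qed (use Suc in auto)
qed auto

lemma Cdiff_mult: "Cdiff n f \<Longrightarrow> Cdiff n g \<Longrightarrow> Cdiff n (\<lambda>x. f x * g x)"
proof (induction n arbitrary: f g)
  case (Suc n)
  show ?case
  proof (rule Cdiff_SucI)
    show "((\<lambda>x. f x * g x) has_derivative
        (\<lambda>h. f x * frechet_derivative g (at x) h + frechet_derivative f (at x) h * g x)) (at x)" for x
      using Suc.prems by (auto intro!: has_derivative_mult differentiable_has_derivative)
    show "Cdiff n (\<lambda>x. f x * frechet_derivative g (at x) e + frechet_derivative f (at x) e * g x)"
      if "e \<in> Basis" for e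
      using that Suc.prems Cdiff_SucD[OF Suc.prems(1)] Cdiff_SucD[OF Suc.prems(2)]
      by (intro Cdiff_add Suc.IH) auto
  qed
qed (auto intro: differentiable_mult)

lemma Cdiff_prod: "finite A \<Longrightarrow> (\<And>i. i \<in> A \<Longrightarrow> Cdiff n (f i)) \<Longrightarrow> Cdiff n (\<lambda>x. \<Prod>i\<in>A. f i x)"
  by (induction A rule: finite_induct) (auto intro!: Cdiff_const Cdiff_mult)

lemma Cdiff_compose:
  fixes F :: "real \<Rightarrow> real"
  shows "Cdiff n F \<Longrightarrow> Cdiff n f \<Longrightarrow> Cdiff n (\<lambda>x. F (f x))"
proof (induction n arbitrary: F f)
  case 0
  then show ?case using differentiable_chain_at[of f _ F] by (auto simp: o_def)
next
  case (Suc n)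
  have lin: "frechet_derivative F (at y) t = t * frechet_derivative F (at y) 1" for y t
  proof -
    have "linear (frechet_derivative F (at y))"
      using Suc.prems(1) by (intro linear_frechet_derivative) simp
    from linear_scale[OF this, of t 1] show ?thesis by simp
  qed
  show ?case
  proof (rule Cdiff_SucI)
    show "((\<lambda>x. F (f x)) has_derivative
        (\<lambda>h. frechet_derivative f (at x) h * frechet_derivative F (at (f x)) 1)) (at x)" for x
    proof -
      have "(f has_derivative frechet_derivative f (at x)) (at x)"
        "(F has_derivative frechet_derivative F (at (f x))) (at (f x))"
        using Suc.prems by (auto intro!: differentiable_has_derivative)
      from diff_chain_at[OF this] show ?thesis
        by (simp add: o_def lin[of _ "frechet_derivative f (at x) _"])
    qed
    show "Cdiff n (\<lambda>x. frechet_derivative f (at x) e * frechet_derivative F (at (f x)) 1)"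
      if "e \<in> Basis" for e
    proof (rule Cdiff_mult)
      show "Cdiff n (\<lambda>x. frechet_derivative f (at x) e)" using that Suc.prems(2) by simp
      show "Cdiff n (\<lambda>x. frechet_derivative F (at (f x)) 1)"
        by (rule Suc.IH[OF _ Cdiff_SucD[OF Suc.prems(2)]]) (use Suc.prems(1) in simp)
    qed
  qed
qed

lemma Cdiff_realI:
  fixes f :: "real \<Rightarrow> real"
  assumes "\<And>x. (f has_real_derivative f' x) (at x)" and "Cdiff n f'"
  shows "Cdiff (Suc n) f"
  by (rule Cdiff_SucI[where f' = "\<lambda>x h. f' x * h"])
     (use assms in \<open>auto simp: has_field_derivative_def\<close>)

lemma Cdiff_affine: "Cdiff n (\<lambda>x. c * (x \<bullet> i) + d)"
  by (intro Cdiff_add Cdiff_mult Cdiff_const Cdiff_inner)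

definition flat_exp :: "nat \<Rightarrow> real \<Rightarrow> real" where
  "flat_exp k t = (if t \<le> 0 then 0 else (1 / t) ^ k * exp (- (1 / t)))"

lemma flat_exp_tendsto_0: "(flat_exp k \<longlongrightarrow> 0) (at 0)"
proof -
  have "((\<lambda>x::real. x ^ k / exp x) \<longlongrightarrow> 0) at_top" by (rule tendsto_power_div_exp_0)
  then have "((\<lambda>t::real. inverse t ^ k / exp (inverse t)) \<longlongrightarrow> 0) (at_right 0)"
    by (rule filterlim_compose[OF _ filterlim_inverse_at_top_right])
  then have R: "(flat_exp k \<longlongrightarrow> 0) (at_right 0)"
    by (rule Lim_transform_eventually)
       (auto simp: eventually_at_right_field flat_exp_def exp_minus inverse_eq_divide
         intro!: exI[of _ 1])
  have L: "(flat_exp k \<longlongrightarrow> 0) (at_left 0)"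
    by (rule Lim_transform_eventually[OF tendsto_const])
       (auto simp: eventually_at_left_field flat_exp_def intro!: exI[of _ "-1"])
  show ?thesis using L R by (simp add: filterlim_split_at_real)
qed

lemma flat_exp_deriv:
  "(flat_exp k has_real_derivative flat_exp (k + 2) t - real k * flat_exp (k + 1) t) (at t)"
proof (cases t "0::real" rule: linorder_cases)
  case less
  have "(flat_exp k has_real_derivative 0) (at t)"
    by (rule DERIV_cong_ev[THEN iffD1, OF refl _ refl, of "\<lambda>_. 0"])
       (use less in \<open>auto simp: flat_exp_def eventually_nhds_metric dist_real_def intro!: exI[of _ "-t"]\<close>)
  then show ?thesis using less by (simp add: flat_exp_def)
next
  case equal
  have "((\<lambda>h. flat_exp k h / h) \<longlongrightarrow> 0) (at 0)"
    by (rule Lim_transform_eventually[OF flat_exp_tendsto_0[of "k + 1"]])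
       (auto simp: flat_exp_def eventually_at_filter)
  then have "(flat_exp k has_real_derivative 0) (at 0)"
    by (simp add: DERIV_def flat_exp_def)
  then show ?thesis using equal by (simp add: flat_exp_def)
next
  case greater
  have "((\<lambda>t. (1 / t) ^ k * exp (- (1 / t))) has_real_derivative
      flat_exp (k + 2) t - real k * flat_exp (k + 1) t) (at t)"
    using greater
    by (auto intro!: derivative_eq_intros simp: flat_exp_def divide_simps power2_eq_square)
       (cases k; simp add: field_simps)
  then show ?thesis
    by (rule DERIV_cong_ev[THEN iffD1, OF refl _ refl, rotated])
       (use greater in \<open>auto simp: flat_exp_def eventually_nhds_metric dist_real_def intro!: exI[of _ t]\<close>)
qed

text \<open>
  The derivative of \<open>flat_exp k\<close> is a combination of \<open>flat_exp (k + 2)\<close> and \<open>flat_exp (k + 1)\<close>, so the family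
  is closed under differentiation.
\<close>

lemma Cdiff_flat_exp: "Cdiff n (flat_exp k)"
proof (induction n arbitrary: k)
  case 0
  then show ?case using flat_exp_deriv by (auto simp: real_differentiable_def)
next
  case (Suc n)
  have "Cdiff n (\<lambda>t. flat_exp (k + 2) t + (- real k) * flat_exp (k + 1) t)"
    by (intro Cdiff_add Cdiff_mult Cdiff_const Suc.IH)
  then show ?case by (intro Cdiff_realI[OF flat_exp_deriv]) simp
qed

text \<open>
  The factor \<open>m\<close> steepens the flanks: as \<open>m\<close> grows, the bump increases to the indicator of the open box.
\<close>

definition box_bump :: "'a::euclidean_space \<Rightarrow> 'a \<Rightarrow> real \<Rightarrow> 'a \<Rightarrow> real" where
  "box_bump a b m x =
    (\<Prod>i\<in>Basis. flat_exp 0 (m * (x \<bullet> i - a \<bullet> i)) * flat_exp 0 (m * (b \<bullet> i - x \<bullet> i)))"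

lemma smooth_box_bump: "smooth_fun (box_bump a b m)"
proof -
  have "Cdiff n (\<lambda>x. \<Prod>i\<in>Basis. flat_exp 0 (m * (x \<bullet> i) + (- m * (a \<bullet> i))) *
      flat_exp 0 ((- m) * (x \<bullet> i) + m * (b \<bullet> i)))" for n
    by (intro Cdiff_prod Cdiff_mult Cdiff_compose[OF Cdiff_flat_exp] Cdiff_affine finite_Basis)
  then show ?thesis
    by (simp add: smooth_fun_iff_Cdiff box_bump_def[abs_def] algebra_simps)
qed

lemma box_bump_nonneg: "0 \<le> box_bump a b m x"
  by (auto simp: box_bump_def flat_exp_def intro!: prod_nonneg)

lemma box_bump_le_1: "box_bump a b m x \<le> 1"
proof -
  have "flat_exp 0 s \<le> 1" "flat_exp 0 s \<ge> 0" for s by (auto simp: flat_exp_def)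
  then show ?thesis unfolding box_bump_def
    by (intro prod_le_1 conjI mult_nonneg_nonneg mult_le_one) auto
qed

lemma box_bump_eq_0:
  assumes "m > 0" "x \<notin> box a b"
  shows "box_bump a b m x = 0"
proof -
  obtain i where i: "i \<in> Basis" "x \<bullet> i \<le> a \<bullet> i \<or> b \<bullet> i \<le> x \<bullet> i"
    using assms(2) by (auto simp: box_def not_less)
  then have "m * (x \<bullet> i - a \<bullet> i) \<le> 0 \<or> m * (b \<bullet> i - x \<bullet> i) \<le> 0"
    using assms(1) by (auto simp: mult_le_0_iff)
  then have "flat_exp 0 (m * (x \<bullet> i - a \<bullet> i)) * flat_exp 0 (m * (b \<bullet> i - x \<bullet> i)) = 0"
    by (auto simp: flat_exp_def)
  then show ?thesis
    unfolding box_bump_def using i(1) by (intro prod_zero) auto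
qed

lemma box_bump_pos:
  assumes "m > 0" "x \<in> box a b"
  shows "box_bump a b m x > 0"
proof -
  have "flat_exp 0 t > 0" if "t > 0" for t using that by (simp add: flat_exp_def)
  then show ?thesis using assms unfolding box_bump_def
    by (intro prod_pos mult_pos_pos ballI) (auto simp: box_def)
qed

lemma box_bump_tendsto_indicator:
  "(\<lambda>n. box_bump a b (real (Suc n)) x) \<longlonglongrightarrow> indicator (box a b) x"
proof (cases "x \<in> box a b")
  case True
  have *: "(\<lambda>n. flat_exp 0 (real (Suc n) * s)) \<longlonglongrightarrow> 1" if "s > 0" for s
  proof -
    have "(\<lambda>n. exp (- ((1 / s) * inverse (real (Suc n))))) \<longlonglongrightarrow> exp (- ((1 / s) * 0))"
      by (intro tendsto_intros LIMSEQ_inverse_real_of_nat)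
    moreover have "flat_exp 0 (real (Suc n) * s) = exp (- ((1 / s) * inverse (real (Suc n))))" for n
    proof -
      have "real (Suc n) * s > 0" using that by simp
      then show ?thesis by (simp add: flat_exp_def divide_simps del: of_nat_Suc)
    qed
    ultimately show ?thesis by simp
  qed
  have "(\<lambda>n. box_bump a b (real (Suc n)) x) \<longlonglongrightarrow> (\<Prod>i\<in>(Basis::'a set). 1 * 1)"
    unfolding box_bump_def
    by (intro tendsto_prod tendsto_mult *) (use True in \<open>auto simp: box_def\<close>)
  then show ?thesis using True by simp
next
  case False
  then show ?thesis by (simp add: box_bump_eq_0)
qed

lemma box_bump_test_fun:
  assumes "m > 0" "cbox a b \<subseteq> \<Omega>"
  shows "box_bump a b m \<in> test_funs \<Omega>"
proof -
  have "{x. box_bump a b m x \<noteq> 0} \<subseteq> cbox a b"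
    using box_bump_eq_0[OF assms(1)] box_subset_cbox by blast
  then have *: "closure {x. box_bump a b m x \<noteq> 0} \<subseteq> cbox a b"
    by (intro closure_minimal) auto
  then have "compact (closure {x. box_bump a b m x \<noteq> 0})"
    using bounded_subset[OF bounded_cbox] by (auto simp: compact_eq_bounded_closed)
  then show ?thesis using assms(2) * smooth_box_bump by (auto simp: test_funs_def)
qed

section \<open>Square integrable functions\<close>

definition L2 :: "'m measure \<Rightarrow> ('m \<Rightarrow> 'b::euclidean_space) set" where
  "L2 M = {f \<in> borel_measurable M. integrable M (\<lambda>x. (norm (f x))\<^sup>2)}"

text \<open>
  Elements of \<open>L\<^sup>2\<close> are functions, so \<open>norm_L2\<close> is only a seminorm; it vanishes on functions that are zero
  almost everywhere.
\<close>

definition norm_L2 :: "'m measure \<Rightarrow> ('m \<Rightarrow> 'b::euclidean_space) \<Rightarrow> real" where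
  "norm_L2 M f = sqrt (LINT x|M. (norm (f x))\<^sup>2)"

lemma L2D [measurable_dest]: "f \<in> L2 M \<Longrightarrow> f \<in> borel_measurable M"
  by (simp add: L2_def)

lemma L2_integrable: "f \<in> L2 M \<Longrightarrow> integrable M (\<lambda>x. (norm (f x))\<^sup>2)"
  by (simp add: L2_def)

lemma L2I: "f \<in> borel_measurable M \<Longrightarrow> integrable M (\<lambda>x. (norm (f x))\<^sup>2) \<Longrightarrow> f \<in> L2 M"
  by (simp add: L2_def)

lemma norm_add_sq_le: "(norm (a + b))\<^sup>2 \<le> 2 * (norm a)\<^sup>2 + 2 * (norm (b::'b::real_inner))\<^sup>2"
proof -
  have "0 \<le> (norm (a - b))\<^sup>2" by simp
  then show ?thesis by (simp add: power2_norm_eq_inner inner_diff inner_add inner_commute)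
qed

lemma L2_add: assumes "f \<in> L2 M" "g \<in> L2 M" shows "(\<lambda>x. f x + g x) \<in> L2 M"
proof (rule L2I)
  show [measurable]: "(\<lambda>x. f x + g x) \<in> borel_measurable M"
    using assms by (auto intro!: borel_measurable_add L2D)
  show "integrable M (\<lambda>x. (norm (f x + g x))\<^sup>2)"
    by (rule Bochner_Integration.integrable_bound[of _ "\<lambda>x. 2 * (norm (f x))\<^sup>2 + 2 * (norm (g x))\<^sup>2"])
       (use assms norm_add_sq_le in \<open>auto simp: L2_integrable\<close>)
qed

lemma L2_scaleR: "f \<in> L2 M \<Longrightarrow> (\<lambda>x. c *\<^sub>R f x) \<in> L2 M"
  by (rule L2I) (auto simp: power_mult_distrib L2_integrable L2D)

lemma L2_diff: assumes "f \<in> L2 M" "g \<in> L2 M" shows "(\<lambda>x. f x - g x) \<in> L2 M"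
  using L2_add[OF assms(1) L2_scaleR[OF assms(2), of "-1"]] by simp

lemma L2_mult: "f \<in> L2 M \<Longrightarrow> (\<lambda>x. c * f x) \<in> L2 M" for f :: "_ \<Rightarrow> real"
  using L2_scaleR[of f M c] by simp

lemma L2_norm: "f \<in> L2 M \<Longrightarrow> (\<lambda>x. norm (f x)) \<in> L2 M"
  by (auto simp: L2_def)

lemma norm_L2_nonneg: "norm_L2 M f \<ge> 0"
  by (simp add: norm_L2_def)

lemma norm_L2_sq: "(norm_L2 M f)\<^sup>2 = (LINT x|M. (norm (f x))\<^sup>2)"
  by (simp add: norm_L2_def)

lemma norm_L2_cong_AE:
  "(AE x in M. f x = g x) \<Longrightarrow> f \<in> borel_measurable M \<Longrightarrow> g \<in> borel_measurable M \<Longrightarrow> norm_L2 M f = norm_L2 M g"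
  unfolding norm_L2_def by (auto intro!: integral_cong_AE arg_cong[where f = sqrt])

lemma L2_inner:
  assumes "f \<in> L2 M" "g \<in> L2 M"
  shows "integrable M (\<lambda>x. f x \<bullet> g x)"
proof (rule Bochner_Integration.integrable_bound[of _ "\<lambda>x. (norm (f x))\<^sup>2 + (norm (g x))\<^sup>2"])
  show "AE x in M. norm (f x \<bullet> g x) \<le> norm ((norm (f x))\<^sup>2 + (norm (g x))\<^sup>2)"
  proof (intro AE_I2)
    fix x
    have "2 * (norm (f x) * norm (g x)) \<le> (norm (f x))\<^sup>2 + (norm (g x))\<^sup>2"
      using sum_squares_bound[of "norm (f x)" "norm (g x)"] by simp
    then show "norm (f x \<bullet> g x) \<le> norm ((norm (f x))\<^sup>2 + (norm (g x))\<^sup>2)"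
      using Cauchy_Schwarz_ineq2[of "f x" "g x"] mult_nonneg_nonneg[OF norm_ge_zero norm_ge_zero, of "f x"
        "g x"]
      by simp
  qed
qed (use assms in \<open>auto simp: L2_integrable intro!: borel_measurable_inner L2D\<close>)

lemma L2_mult_integrable: "f \<in> L2 M \<Longrightarrow> g \<in> L2 M \<Longrightarrow> integrable M (\<lambda>x. f x * g x)"
  for f g :: "_ \<Rightarrow> real"
  using L2_inner[of f M g] by simp

text \<open>
  For positive \<open>A\<close> and \<open>B\<close> the best choice is \<open>t = B / A\<close>; if one of them is zero, a large or a small
  \<open>t\<close> contradicts \<open>X > 0\<close>.
\<close>

lemma quadratic_mean_bound:
  fixes A B X :: real
  assumes "\<And>t. t > 0 \<Longrightarrow> 2 * X \<le> t * A\<^sup>2 + B\<^sup>2 / t" "A \<ge> 0" "B \<ge> 0"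
  shows "X \<le> A * B"
proof (cases "A = 0 \<or> B = 0")
  case False
  then have "A > 0" "B > 0" using assms by auto
  then show ?thesis using assms(1)[of "B / A"] by (simp add: field_simps power2_eq_square)
next
  case True
  show ?thesis
  proof (rule ccontr)
    assume "\<not> X \<le> A * B"
    then have X: "X > 0" using True by auto
    show False
    proof (cases "A = 0")
      case True
      have "2 * X * ((B\<^sup>2 + 1) / X) \<le> B\<^sup>2"
        using assms(1)[of "(B\<^sup>2 + 1) / X"] X True
        by (simp add: field_simps add_pos_nonneg)
      then show False using X by simp
           (smt (verit) zero_le_power2)
    next
      case False
      then have "B = 0" "A > 0" using \<open>A = 0 \<or> B = 0\<close> assms by auto
      then have "2 * X \<le> X"
        using assms(1)[of "X / A\<^sup>2"] X by simp
      then show False using X by simp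
    qed
  qed
qed

lemma L2_Cauchy_Schwarz_abs:
  assumes "f \<in> L2 M" "g \<in> L2 M"
  shows "(LINT x|M. \<bar>f x \<bullet> g x\<bar>) \<le> norm_L2 M f * norm_L2 M g"
proof (rule quadratic_mean_bound)
  fix t :: real assume t: "t > 0"
  have *: "2 * \<bar>f x \<bullet> g x\<bar> \<le> t * (norm (f x))\<^sup>2 + (norm (g x))\<^sup>2 / t" for x
  proof -
    have "0 \<le> (t * norm (f x) - norm (g x))\<^sup>2" by simp
    then have "(2 * (norm (f x) * norm (g x))) * t \<le> t * (norm (f x))\<^sup>2 * t + (norm (g x))\<^sup>2"
      by (simp add: power2_diff power_mult_distrib power2_eq_square algebra_simps)
    also have "\<dots> = (t * (norm (f x))\<^sup>2 + (norm (g x))\<^sup>2 / t) * t"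
      using t by (simp add: algebra_simps)
    finally have "2 * (norm (f x) * norm (g x)) \<le> t * (norm (f x))\<^sup>2 + (norm (g x))\<^sup>2 / t"
      using t by (simp only: mult_le_cancel_right_pos)
    then show ?thesis using Cauchy_Schwarz_ineq2[of "f x" "g x"] by linarith
  qed
  have "2 * (LINT x|M. \<bar>f x \<bullet> g x\<bar>) = (LINT x|M. 2 * \<bar>f x \<bullet> g x\<bar>)" by simp
  also have "\<dots> \<le> (LINT x|M. t * (norm (f x))\<^sup>2 + (norm (g x))\<^sup>2 / t)"
    by (rule integral_mono) (use assms * in \<open>auto simp: L2_integrable L2_inner\<close>)
  also have "\<dots> = t * (norm_L2 M f)\<^sup>2 + (norm_L2 M g)\<^sup>2 / t"
    using assms by (simp add: norm_L2_sq L2_integrable)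
  finally show "2 * (LINT x|M. \<bar>f x \<bullet> g x\<bar>) \<le> t * (norm_L2 M f)\<^sup>2 + (norm_L2 M g)\<^sup>2 / t" .
qed (auto simp: norm_L2_nonneg)

lemma L2_Cauchy_Schwarz:
  assumes "f \<in> L2 M" "g \<in> L2 M"
  shows "\<bar>LINT x|M. f x \<bullet> g x\<bar> \<le> norm_L2 M f * norm_L2 M g"
  using L2_Cauchy_Schwarz_abs[OF assms] integral_abs_bound[of M "\<lambda>x. f x \<bullet> g x"] by linarith

lemma norm_L2_triangle:
  assumes "f \<in> L2 M" "g \<in> L2 M"
  shows "norm_L2 M (\<lambda>x. f x + g x) \<le> norm_L2 M f + norm_L2 M g"
proof (rule power2_le_imp_le)
  have "(norm_L2 M (\<lambda>x. f x + g x))\<^sup>2 = (LINT x|M. (norm (f x))\<^sup>2 + (norm (g x))\<^sup>2 + 2 * (f x \<bullet> g x))"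
    unfolding norm_L2_sq by (intro Bochner_Integration.integral_cong refl)
      (simp add: power2_norm_eq_inner algebra_simps inner_commute)
  also have "\<dots> = (norm_L2 M f)\<^sup>2 + (norm_L2 M g)\<^sup>2 + 2 * (LINT x|M. f x \<bullet> g x)"
    using assms by (simp add: norm_L2_sq L2_integrable L2_inner)
  also have "\<dots> \<le> (norm_L2 M f + norm_L2 M g)\<^sup>2"
    using L2_Cauchy_Schwarz[OF assms] by (simp add: power2_sum)
  finally show "(norm_L2 M (\<lambda>x. f x + g x))\<^sup>2 \<le> (norm_L2 M f + norm_L2 M g)\<^sup>2" .
qed (simp add: norm_L2_nonneg)

lemma norm_L2_scaleR: "norm_L2 M (\<lambda>x. c *\<^sub>R f x) = \<bar>c\<bar> * norm_L2 M f"
  by (simp add: norm_L2_def power_mult_distrib real_sqrt_mult)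

lemma norm_L2_diff_commute: "norm_L2 M (\<lambda>x. f x - g x) = norm_L2 M (\<lambda>x. g x - f x)"
  by (simp add: norm_L2_def norm_minus_commute)

lemma norm_L2_triangle_diff:
  assumes "f \<in> L2 M" "g \<in> L2 M" "h \<in> L2 M"
  shows "norm_L2 M (\<lambda>x. f x - h x) \<le> norm_L2 M (\<lambda>x. f x - g x) + norm_L2 M (\<lambda>x. g x - h x)"
  using norm_L2_triangle[OF L2_diff[OF assms(1,2)] L2_diff[OF assms(2,3)]] by simp

lemma norm_L2_diff_abs:
  assumes "f \<in> L2 M" "g \<in> L2 M"
  shows "\<bar>norm_L2 M f - norm_L2 M g\<bar> \<le> norm_L2 M (\<lambda>x. f x - g x)"
  using norm_L2_triangle[OF L2_diff[OF assms] assms(2)] norm_L2_triangle[OF L2_diff[OF assms(2,1)] assms(1)]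
  by (simp add: norm_L2_diff_commute[of M f g])

lemma norm_L2_tendsto:
  assumes "\<And>n. f n \<in> L2 M" "g \<in> L2 M" "(\<lambda>n. norm_L2 M (\<lambda>x. f n x - g x)) \<longlonglongrightarrow> 0"
  shows "(\<lambda>n. norm_L2 M (f n)) \<longlonglongrightarrow> norm_L2 M g"
proof -
  have "(\<lambda>n. norm_L2 M (f n) - norm_L2 M g) \<longlonglongrightarrow> 0"
    by (rule Lim_null_comparison[OF _ assms(3)]) (auto intro!: always_eventually norm_L2_diff_abs assms)
  then show ?thesis by (simp add: LIM_zero_iff)
qed

lemma norm_L2_integral_inner_tendsto:
  assumes "\<And>n. f n \<in> L2 M" "g \<in> L2 M" "(\<lambda>n. norm_L2 M (\<lambda>x. f n x - g x)) \<longlonglongrightarrow> 0" "h \<in> L2 M"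
  shows "(\<lambda>n. LINT x|M. f n x \<bullet> h x) \<longlonglongrightarrow> (LINT x|M. g x \<bullet> h x)"
proof -
  have "(\<lambda>n. (LINT x|M. f n x \<bullet> h x) - (LINT x|M. g x \<bullet> h x)) \<longlonglongrightarrow> 0"
  proof (rule Lim_null_comparison)
    show "\<forall>\<^sub>F n in sequentially. norm ((LINT x|M. f n x \<bullet> h x) - (LINT x|M. g x \<bullet> h x))
        \<le> norm_L2 M (\<lambda>x. f n x - g x) * norm_L2 M h"
    proof (intro always_eventually allI)
      fix n
      have "(LINT x|M. f n x \<bullet> h x) - (LINT x|M. g x \<bullet> h x) = (LINT x|M. (f n x - g x) \<bullet> h x)"
        using assms by (simp add: inner_diff_left L2_inner)
      then show "norm ((LINT x|M. f n x \<bullet> h x) - (LINT x|M. g x \<bullet> h x))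
          \<le> norm_L2 M (\<lambda>x. f n x - g x) * norm_L2 M h"
        using L2_Cauchy_Schwarz[OF L2_diff[OF assms(1,2)] assms(4), of n] by simp
    qed
    show "(\<lambda>n. norm_L2 M (\<lambda>x. f n x - g x) * norm_L2 M h) \<longlonglongrightarrow> 0"
      using tendsto_mult_right[OF assms(3), of "norm_L2 M h"] by simp
  qed
  then show ?thesis by (simp add: LIM_zero_iff)
qed

lemma norm_L2_nn_integral:
  assumes "f \<in> L2 M"
  shows "(\<integral>\<^sup>+x. ennreal ((norm (f x))\<^sup>2) \<partial>M) = ennreal ((norm_L2 M f)\<^sup>2)"
  unfolding norm_L2_sq by (rule nn_integral_eq_integral) (use assms in \<open>auto simp: L2_integrable\<close>)

lemma L2_of_nn_integral:
  assumes "f \<in> borel_measurable M" "(\<integral>\<^sup>+x. ennreal ((norm (f x))\<^sup>2) \<partial>M) \<le> ennreal (c\<^sup>2)" "c \<ge> 0"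
  shows "f \<in> L2 M" "norm_L2 M f \<le> c"
proof -
  show L: "f \<in> L2 M"
    using assms by (intro L2I integrableI_bounded) (auto intro: le_less_trans)
  have "(norm_L2 M f)\<^sup>2 \<le> c\<^sup>2"
    using assms(2) unfolding norm_L2_nn_integral[OF L] by (simp add: ennreal_le_iff)
  then show "norm_L2 M f \<le> c" using assms(3) by (rule power2_le_imp_le)
qed

lemma norm_L2_AE_subseq:
  assumes "\<And>n. f n \<in> L2 M" "g \<in> L2 M" "(\<lambda>n. norm_L2 M (\<lambda>x. f n x - g x)) \<longlonglongrightarrow> 0"
  shows "\<exists>r. strict_mono (r::nat\<Rightarrow>nat) \<and> (AE x in M. (\<lambda>n. f (r n) x) \<longlonglongrightarrow> g x)"
proof -
  have "(\<lambda>n. (norm_L2 M (\<lambda>x. f n x - g x))\<^sup>2) \<longlonglongrightarrow> 0"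
    using tendsto_power[OF assms(3), of 2] by simp
  then have "\<exists>r. strict_mono (r::nat\<Rightarrow>nat) \<and> (AE x in M. (\<lambda>n. (norm (f (r n) x - g x))\<^sup>2) \<longlonglongrightarrow> 0)"
    by (intro tendsto_L1_AE_subseq) (auto simp: norm_L2_sq intro!: L2_integrable L2_diff assms)
  then obtain r where r: "strict_mono (r::nat\<Rightarrow>nat)"
    "AE x in M. (\<lambda>n. (norm (f (r n) x - g x))\<^sup>2) \<longlonglongrightarrow> 0" by blast
  from r(2) have "AE x in M. (\<lambda>n. f (r n) x) \<longlonglongrightarrow> g x"
  proof eventually_elim
    case (elim x)
    then have "(\<lambda>n. sqrt ((norm (f (r n) x - g x))\<^sup>2)) \<longlonglongrightarrow> 0"
      using tendsto_real_sqrt[OF elim] by simp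
    then show ?case by (simp add: tendsto_norm_zero_iff LIM_zero_iff)
  qed
  then show ?thesis using r(1) by blast
qed

text \<open>
  The argument of Riesz and Fischer. Along a subsequence whose successive differences \<open>d k\<close> have norm below
  \<open>2\<^sup>-\<^sup>k\<close>, the sum of \<open>2\<^sup>k \<bar>d k\<bar>\<^sup>2\<close> has a finite integral. Hence \<open>d k x\<close> decays geometrically for almost every
  \<open>x\<close>, the subsequence converges almost everywhere, and Fatou's lemma gives convergence in norm of the whole
  sequence.
\<close>

lemma L2_complete:
  fixes f :: "nat \<Rightarrow> 'm \<Rightarrow> 'b::euclidean_space"
  assumes f: "\<And>n. f n \<in> L2 M"
    and Cau: "\<And>e. e > 0 \<Longrightarrow> \<exists>N. \<forall>m\<ge>N. \<forall>n\<ge>N. norm_L2 M (\<lambda>x. f m x - f n x) < e"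
  shows "\<exists>g\<in>L2 M. (\<lambda>n. norm_L2 M (\<lambda>x. f n x - g x)) \<longlonglongrightarrow> 0"
proof -
  have [measurable]: "f n \<in> borel_measurable M" for n using f by (rule L2D)
  have "\<exists>N. \<forall>k. \<forall>m\<ge>N k. \<forall>n\<ge>N k. norm_L2 M (\<lambda>x. f m x - f n x) < (1/2)^k"
    by (intro choice allI Cau) simp
  then obtain N where N: "\<And>k m n. m \<ge> N k \<Longrightarrow> n \<ge> N k \<Longrightarrow> norm_L2 M (\<lambda>x. f m x - f n x) < (1/2)^k"
    by metis
  \<comment> \<open>Summing makes the indices increasing and at least as large as the required thresholds.\<close>
  define r where "r k = (\<Sum>j\<le>k. N j) + k" for k
  have r_ge: "j \<le> k \<Longrightarrow> r k \<ge> N j" for j k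
    using member_le_sum[of j "{..k}" N] by (simp add: r_def)
  define d where "d k x = f (r (Suc k)) x - f (r k) x" for k x
  have [measurable]: "d k \<in> borel_measurable M" for k unfolding d_def by measurable
  have dL2: "d k \<in> L2 M" for k unfolding d_def by (intro L2_diff f)
  have d: "(norm_L2 M (d k))\<^sup>2 \<le> (1/4)^k" for k
  proof -
    have "norm_L2 M (d k) \<le> (1/2)^k"
      unfolding d_def using N[of k "r (Suc k)" "r k"] r_ge by fastforce
    then have "(norm_L2 M (d k))\<^sup>2 \<le> ((1/2)^k)\<^sup>2" by (intro power_mono norm_L2_nonneg)
    then show ?thesis by (simp add: power_mult[symmetric] power_commutes[symmetric] power2_eq_square power_mult_distrib[symmetric])
  qed
  have "(\<integral>\<^sup>+x. (\<Sum>k. ennreal (2^k * (norm (d k x))\<^sup>2)) \<partial>M) = (\<Sum>k. \<integral>\<^sup>+x. ennreal (2^k * (norm (d k x))\<^sup>2) \<partial>M)"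
    by (rule nn_integral_suminf) measurable
  also have "\<dots> = (\<Sum>k. ennreal (2^k * (norm_L2 M (d k))\<^sup>2))"
    using norm_L2_nn_integral[OF dL2] by (simp add: ennreal_mult nn_integral_cmult)
  also have "\<dots> \<le> (\<Sum>k. ennreal ((1/2)^k))"
  proof (intro suminf_le summableI ennreal_leI)
    fix k
    have "2^k * (norm_L2 M (d k))\<^sup>2 \<le> 2^k * (1/4)^k" using d by (intro mult_left_mono) auto
    then show "2^k * (norm_L2 M (d k))\<^sup>2 \<le> (1/2)^k" by (simp add: power_mult_distrib[symmetric])
  qed
  also have "\<dots> < \<infinity>"
    by (subst suminf_ennreal2) (auto intro!: summable_geometric)
  finally have "AE x in M. (\<Sum>k. ennreal (2^k * (norm (d k x))\<^sup>2)) \<noteq> \<infinity>"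
    by (intro nn_integral_PInf_AE) auto
  then have conv: "AE x in M. convergent (\<lambda>k. f (r k) x)"
  proof eventually_elim
    case (elim x)
    define S where "S = (\<Sum>k. ennreal (2^k * (norm (d k x))\<^sup>2))"
    define C where "C = enn2real S"
    have bnd: "(norm (d k x))\<^sup>2 \<le> C * (1/2)^k" for k
    proof -
      have "ennreal (2^k * (norm (d k x))\<^sup>2) \<le> S"
      proof -
        have "(\<Sum>j\<in>{k}. ennreal (2^j * (norm (d j x))\<^sup>2)) \<le> S"
          unfolding S_def by (rule sum_le_suminf[OF summableI]) auto
        then show ?thesis by simp
      qed
      also have "S = ennreal C" using elim by (simp add: C_def S_def less_top)
      finally have "2^k * (norm (d k x))\<^sup>2 \<le> C"
        by (simp add: ennreal_le_iff C_def)
      then show ?thesis by (simp add: field_simps power_one_over)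
    qed
    have C: "C \<ge> 0" by (simp add: C_def)
    have dk: "norm (d k x) \<le> sqrt C * (sqrt (1/2))^k" for k
    proof -
      have "norm (d k x) \<le> sqrt (C * (1/2)^k)" using bnd[of k] by (intro real_le_rsqrt)
      then show ?thesis by (simp add: real_sqrt_mult real_sqrt_power)
    qed
    have "summable (\<lambda>k. sqrt C * (sqrt (1/2))^k)"
    proof (intro summable_mult summable_geometric)
      have "sqrt (1/2) < sqrt 1" by (rule real_sqrt_less_mono) simp
      then show "norm (sqrt (1/2 :: real)) < 1" by (simp only: real_sqrt_one real_norm_def) simp
    qed
    then have "summable (\<lambda>k. d k x)"
      by (rule summable_comparison_test'[where N = 0]) (rule dk)
    then have "convergent (\<lambda>n. f (r 0) x + (\<Sum>k<n. d k x))"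
      by (intro convergent_add convergent_const) (simp add: summable_iff_convergent)
    moreover have "f (r 0) x + (\<Sum>k<n. d k x) = f (r n) x" for n
      unfolding d_def by (subst sum_lessThan_telescope) simp
    ultimately show ?case by simp
  qed
  define g where "g x = lim (\<lambda>k. f (r k) x)" for x
  have g_meas[measurable]: "g \<in> borel_measurable M"
    unfolding g_def by measurable
  have lim: "AE x in M. (\<lambda>k. f (r k) x) \<longlonglongrightarrow> g x"
    using conv by eventually_elim (simp add: g_def convergent_LIMSEQ_iff)
  have est: "(\<integral>\<^sup>+x. ennreal ((norm (f n x - g x))\<^sup>2) \<partial>M) \<le> ennreal (((1/2)^k)\<^sup>2)" if n: "n \<ge> r k" for n k
  proof -
    have "(\<integral>\<^sup>+x. ennreal ((norm (f n x - g x))\<^sup>2) \<partial>M)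
        = (\<integral>\<^sup>+x. liminf (\<lambda>j. ennreal ((norm (f n x - f (r j) x))\<^sup>2)) \<partial>M)"
      using lim
    proof (intro nn_integral_cong_AE, eventually_elim)
      case (elim x)
      then have "(\<lambda>j. ennreal ((norm (f n x - f (r j) x))\<^sup>2)) \<longlonglongrightarrow> ennreal ((norm (f n x - g x))\<^sup>2)"
        by (intro tendsto_intros)
      from lim_imp_Liminf[OF _ this] show ?case by simp
    qed
    also have "\<dots> \<le> liminf (\<lambda>j. \<integral>\<^sup>+x. ennreal ((norm (f n x - f (r j) x))\<^sup>2) \<partial>M)"
      by (rule nn_integral_liminf) measurable
    also have "\<dots> \<le> ennreal (((1/2)^k)\<^sup>2)"
    proof (rule order_trans[OF Liminf_le_Limsup])
      show "limsup (\<lambda>j. \<integral>\<^sup>+x. ennreal ((norm (f n x - f (r j) x))\<^sup>2) \<partial>M) \<le> ennreal (((1/2)^k)\<^sup>2)"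
      proof (rule Limsup_bounded)
        show "\<forall>\<^sub>F j in sequentially. (\<integral>\<^sup>+x. ennreal ((norm (f n x - f (r j) x))\<^sup>2) \<partial>M) \<le> ennreal (((1/2)^k)\<^sup>2)"
          using eventually_ge_at_top[of k]
        proof eventually_elim
          case (elim j)
          have "n \<ge> N k" using n r_ge[of k k] by simp
          then have "norm_L2 M (\<lambda>x. f n x - f (r j) x) < (1/2)^k" using elim by (intro N r_ge)
          then have "(norm_L2 M (\<lambda>x. f n x - f (r j) x))\<^sup>2 \<le> ((1/2)^k)\<^sup>2"
            by (intro power_mono norm_L2_nonneg) auto
          then show ?case unfolding norm_L2_nn_integral[OF L2_diff[OF f f]] by (rule ennreal_leI)
        qed
      qed
    qed simp
    finally show ?thesis .
  qed
  have fg: "(\<lambda>x. f n x - g x) \<in> L2 M" "norm_L2 M (\<lambda>x. f n x - g x) \<le> (1/2)^k" if "n \<ge> r k" for n k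
    using L2_of_nn_integral[OF _ est[OF that]] by auto
  have "g \<in> L2 M"
    using L2_diff[OF f[of "r 0"] fg(1)[of 0 "r 0"]] by simp
  moreover have "(\<lambda>n. norm_L2 M (\<lambda>x. f n x - g x)) \<longlonglongrightarrow> 0"
  proof (rule LIMSEQ_I)
    fix e :: real assume "e > 0"
    then obtain k where k: "(1/2)^k < e" using real_arch_pow_inv[of e "1/2"] by auto
    show "\<exists>no. \<forall>n\<ge>no. norm (norm_L2 M (\<lambda>x. f n x - g x) - 0) < e"
      using fg(2)[of k] k by (intro exI[of _ "r k"]) (auto simp: norm_L2_nonneg intro: le_less_trans)
  qed
  ultimately show ?thesis by blast
qed

section \<open>Test functions and their gradients\<close>

lemma test_fun_smooth: "\<phi> \<in> test_funs \<Omega> \<Longrightarrow> Cdiff n \<phi>"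
  by (simp add: test_funs_def smooth_fun_iff_Cdiff)

lemma test_fun_supportE:
  assumes "\<phi> \<in> test_funs \<Omega>"
  obtains K where "compact K" "K \<subseteq> \<Omega>" "\<And>x. x \<notin> K \<Longrightarrow> \<phi> x = 0"
    "\<And>x. x \<notin> K \<Longrightarrow> frechet_derivative \<phi> (at x) = (\<lambda>h. 0)"
proof -
  define K where "K = closure {x. \<phi> x \<noteq> 0}"
  have K: "compact K" "K \<subseteq> \<Omega>" using assms by (auto simp: test_funs_def K_def)
  have z: "\<phi> x = 0" if "x \<notin> K" for x
    using that closure_subset[of "{x. \<phi> x \<noteq> 0}"] by (auto simp: K_def)
  have "frechet_derivative \<phi> (at x) = (\<lambda>h. 0)" if x: "x \<notin> K" for x
  proof -
    have "((\<lambda>x. 0) has_derivative (\<lambda>h. 0)) (at x)" by simp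
    then have "(\<phi> has_derivative (\<lambda>h. 0)) (at x)"
      by (rule has_derivative_transform_within_open[of _ _ _ _ "- K"])
         (use K x z in \<open>auto intro!: open_Compl compact_imp_closed\<close>)
    then show ?thesis by (rule frechet_derivative_at[symmetric])
  qed
  with K z that show thesis by blast
qed

lemma test_funI:
  assumes "\<And>n. Cdiff n f" "compact K" "K \<subseteq> \<Omega>" "\<And>x. x \<notin> K \<Longrightarrow> f x = 0"
  shows "f \<in> test_funs \<Omega>"
proof -
  have "{x. f x \<noteq> 0} \<subseteq> K" using assms(4) by auto
  then have *: "closure {x. f x \<noteq> 0} \<subseteq> K" using assms(2) by (intro closure_minimal compact_imp_closed)
  then have "compact (closure {x. f x \<noteq> 0})"
    using bounded_subset[OF compact_imp_bounded[OF assms(2)]] by (auto simp: compact_eq_bounded_closed)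
  then show ?thesis using assms(1,3) * by (auto simp: test_funs_def smooth_fun_iff_Cdiff)
qed

lemma test_fun_pderiv:
  assumes "\<phi> \<in> test_funs \<Omega>" "e \<in> Basis"
  shows "(\<lambda>x. frechet_derivative \<phi> (at x) e) \<in> test_funs \<Omega>"
proof -
  show ?thesis
  proof (rule test_fun_supportE[OF assms(1)])
    fix K
    assume K: "compact K" "K \<subseteq> \<Omega>" "\<And>x. x \<notin> K \<Longrightarrow> frechet_derivative \<phi> (at x) = (\<lambda>h. 0)"
    show ?thesis
    proof (rule test_funI[OF _ K(1,2)])
      show "Cdiff n (\<lambda>x. frechet_derivative \<phi> (at x) e)" for n
        using test_fun_smooth[OF assms(1), of "Suc n"] assms(2) by simp
    qed (simp add: K(3))
  qed
qed

lemma test_fun_add: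
  assumes "\<phi> \<in> test_funs \<Omega>" "\<psi> \<in> test_funs \<Omega>"
  shows "(\<lambda>x. \<phi> x + \<psi> x) \<in> test_funs \<Omega>"
proof -
  obtain K L where "compact K" "K \<subseteq> \<Omega>" "\<And>x. x \<notin> K \<Longrightarrow> \<phi> x = 0"
    "compact L" "L \<subseteq> \<Omega>" "\<And>x. x \<notin> L \<Longrightarrow> \<psi> x = 0"
    using test_fun_supportE[OF assms(1)] test_fun_supportE[OF assms(2)] by metis
  then show ?thesis
    by (intro test_funI[of _ "K \<union> L"] Cdiff_add) (auto intro: test_fun_smooth assms)
qed

lemma test_fun_mult:
  assumes "\<phi> \<in> test_funs \<Omega>" "\<And>n. Cdiff n \<psi>"
  shows "(\<lambda>x. \<phi> x * \<psi> x) \<in> test_funs \<Omega>"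
proof -
  obtain K where "compact K" "K \<subseteq> \<Omega>" "\<And>x. x \<notin> K \<Longrightarrow> \<phi> x = 0"
    using test_fun_supportE[OF assms(1)] by metis
  then show ?thesis
    by (intro test_funI[of _ K] Cdiff_mult assms(2)) (auto intro: test_fun_smooth assms)
qed

lemma test_fun_cmult: "\<phi> \<in> test_funs \<Omega> \<Longrightarrow> (\<lambda>x. c * \<phi> x) \<in> test_funs \<Omega>"
  using test_fun_mult[of \<phi> \<Omega> "\<lambda>x. c"] by (simp add: Cdiff_const mult.commute)

lemma test_fun_compose:
  fixes F :: "real \<Rightarrow> real"
  assumes "\<phi> \<in> test_funs \<Omega>" "\<And>n. Cdiff n F" "F 0 = 0"
  shows "(\<lambda>x. F (\<phi> x)) \<in> test_funs \<Omega>"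
proof -
  obtain K where "compact K" "K \<subseteq> \<Omega>" "\<And>x. x \<notin> K \<Longrightarrow> \<phi> x = 0"
    using test_fun_supportE[OF assms(1)] by metis
  then show ?thesis
    by (intro test_funI[of _ K] Cdiff_compose[OF assms(2) test_fun_smooth[OF assms(1)]])
       (auto simp: assms(3))
qed

lemma test_fun_continuous: "\<phi> \<in> test_funs \<Omega> \<Longrightarrow> continuous_on UNIV \<phi>"
  by (intro continuous_at_imp_continuous_on ballI differentiable_imp_continuous_within
      Cdiff_differentiable[of 0] test_fun_smooth)

lemma test_fun_measurable [measurable_dest]: "\<phi> \<in> test_funs \<Omega> \<Longrightarrow> \<phi> \<in> borel_measurable borel"
  by (intro borel_measurable_continuous_onI test_fun_continuous)

lemma test_fun_bounded:
  assumes "\<phi> \<in> test_funs \<Omega>"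
  obtains B where "\<And>x. \<bar>\<phi> x\<bar> \<le> B" "B \<ge> 0"
proof -
  obtain K where K: "compact K" "\<And>x. x \<notin> K \<Longrightarrow> \<phi> x = 0"
    using test_fun_supportE[OF assms] by metis
  have "bounded (\<phi> ` K)"
    by (intro compact_imp_bounded compact_continuous_image K(1)
        continuous_on_subset[OF test_fun_continuous[OF assms]]) auto
  then obtain B where "\<And>x. x \<in> K \<Longrightarrow> \<bar>\<phi> x\<bar> \<le> B" by (auto simp: bounded_iff)
  then have "\<bar>\<phi> x\<bar> \<le> max B 0" for x using K(2)[of x] by (cases "x \<in> K") force+
  then show thesis using that[of "max B 0"] by simp
qed

lemma test_fun_integrable: assumes "\<phi> \<in> test_funs \<Omega>" shows "integrable lborel \<phi>"
proof -
  obtain K where K: "compact K" "\<And>x. x \<notin> K \<Longrightarrow> \<phi> x = 0"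
    using test_fun_supportE[OF assms] by metis
  have "integrable lborel (\<lambda>x. indicator K x *\<^sub>R \<phi> x)"
    by (rule borel_integrable_compact[OF K(1) continuous_on_subset[OF test_fun_continuous[OF assms]]]) simp
  moreover have "(\<lambda>x. indicator K x *\<^sub>R \<phi> x) = \<phi>"
  proof
    show "indicator K x *\<^sub>R \<phi> x = \<phi> x" for x using K(2)[of x] by (cases "x \<in> K") auto
  qed
  ultimately show ?thesis by simp
qed

lemma test_fun_L2: "\<phi> \<in> test_funs \<Omega> \<Longrightarrow> \<phi> \<in> L2 lborel"
  by (intro L2I) (auto simp: power2_eq_square intro!: test_fun_integrable test_fun_mult test_fun_smooth)

definition grad :: "('a::euclidean_space \<Rightarrow> real) \<Rightarrow> 'a \<Rightarrow> 'a" where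
  "grad f x = (\<Sum>i\<in>Basis. frechet_derivative f (at x) i *\<^sub>R i)"

lemma grad_inner_Basis: "i \<in> Basis \<Longrightarrow> grad f x \<bullet> i = frechet_derivative f (at x) i"
  by (simp add: grad_def)

lemma has_derivative_grad:
  assumes "f differentiable (at x)"
  shows "(f has_derivative (\<lambda>h. grad f x \<bullet> h)) (at x)"
proof -
  have l: "linear (frechet_derivative f (at x))" using assms by (rule linear_frechet_derivative)
  have "frechet_derivative f (at x) h = grad f x \<bullet> h" for h
  proof -
    have "frechet_derivative f (at x) h = frechet_derivative f (at x) (\<Sum>i\<in>Basis. (h \<bullet> i) *\<^sub>R i)"
      by (simp add: euclidean_representation)
    also have "\<dots> = (\<Sum>i\<in>Basis. (h \<bullet> i) * frechet_derivative f (at x) i)"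
      by (simp add: linear_sum[OF l] linear_scale[OF l])
    also have "\<dots> = grad f x \<bullet> h"
      by (simp add: grad_def inner_sum_right inner_commute[of _ h] mult.commute)
    finally show ?thesis .
  qed
  then have "frechet_derivative f (at x) = (\<lambda>h. grad f x \<bullet> h)" by auto
  then show ?thesis using differentiable_has_derivative[OF assms] by simp
qed

lemma grad_eqI:
  assumes "(f has_derivative (\<lambda>h. d \<bullet> h)) (at x)"
  shows "grad f x = d"
  using frechet_derivative_at[OF assms, symmetric]
  by (simp add: grad_def euclidean_representation)

lemma test_fun_has_derivative:
  "\<phi> \<in> test_funs \<Omega> \<Longrightarrow> (\<phi> has_derivative (\<lambda>h. grad \<phi> x \<bullet> h)) (at x)"
  by (intro has_derivative_grad Cdiff_differentiable[of 0] test_fun_smooth)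

lemma grad_add:
  "\<phi> \<in> test_funs \<Omega> \<Longrightarrow> \<psi> \<in> test_funs \<Omega> \<Longrightarrow> grad (\<lambda>x. \<phi> x + \<psi> x) x = grad \<phi> x + grad \<psi> x"
  by (rule grad_eqI)
     (use has_derivative_add[OF test_fun_has_derivative test_fun_has_derivative] in \<open>simp add: inner_add_left\<close>)

lemma grad_cmult: "\<phi> \<in> test_funs \<Omega> \<Longrightarrow> grad (\<lambda>x. c * \<phi> x) x = c *\<^sub>R grad \<phi> x"
  by (rule grad_eqI) (auto intro!: derivative_eq_intros test_fun_has_derivative)

lemma grad_L2: assumes "\<phi> \<in> test_funs \<Omega>" shows "grad \<phi> \<in> L2 lborel"
proof -
  have "(\<lambda>x. \<Sum>i\<in>B. frechet_derivative \<phi> (at x) i *\<^sub>R i) \<in> L2 lborel" if "B \<subseteq> Basis" for B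
    using finite_subset[OF that finite_Basis] that
  proof (induction B rule: finite_induct)
    case empty then show ?case by (simp add: L2_def)
  next
    case (insert i B)
    have p: "(\<lambda>x. frechet_derivative \<phi> (at x) i) \<in> test_funs \<Omega>"
      using test_fun_pderiv[OF assms] insert.prems by simp
    have "(\<lambda>x. frechet_derivative \<phi> (at x) i *\<^sub>R i) \<in> L2 lborel"
      by (rule L2I) (use test_fun_measurable[OF p] L2_integrable[OF test_fun_L2[OF p]] insert.prems in
        \<open>auto simp: power_mult_distrib\<close>)
    then show ?case using insert by (simp add: L2_add)
  qed
  then show ?thesis unfolding grad_def[abs_def] by simp
qed

lemma grad_bounded:
  assumes "\<phi> \<in> test_funs \<Omega>"
  obtains B where "\<And>x. norm (grad \<phi> x) \<le> B" "B \<ge> 0"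
proof -
  have "\<forall>i\<in>Basis. \<exists>B. \<forall>x. \<bar>frechet_derivative \<phi> (at x) i\<bar> \<le> B"
    using test_fun_bounded[OF test_fun_pderiv[OF assms]] by metis
  then obtain C where C: "\<And>i x. i \<in> Basis \<Longrightarrow> \<bar>frechet_derivative \<phi> (at x) i\<bar> \<le> C i" by metis
  have "norm (grad \<phi> x) \<le> (\<Sum>i\<in>Basis. C i)" for x
    unfolding grad_def by (rule order_trans[OF norm_sum]) (auto intro!: sum_mono C)
  then show thesis using that order_trans[OF norm_ge_zero] by blast
qed

lemma lborel_integral_translate:
  fixes f :: "'a::euclidean_space \<Rightarrow> 'b::{banach, second_countable_topology}"
  assumes [measurable]: "f \<in> borel_measurable borel"
  shows "(LINT x|lborel. f (x + c)) = (LINT x|lborel. f x)"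
proof -
  have "(LINT x|lborel. f x) = (LINT x|distr lborel borel ((+) c). f x)" by (simp add: lborel_distr_plus)
  also have "\<dots> = (LINT x|lborel. f (c + x))" by (intro integral_distr) auto
  finally show ?thesis by (simp add: add.commute)
qed

lemma lborel_integrable_translate:
  fixes f :: "'a::euclidean_space \<Rightarrow> 'b::{banach, second_countable_topology}"
  assumes [measurable]: "f \<in> borel_measurable borel"
  shows "integrable lborel (\<lambda>x. f (x + c)) \<longleftrightarrow> integrable lborel f"
proof -
  have "integrable lborel f \<longleftrightarrow> integrable (distr lborel borel ((+) c)) f" by (simp add: lborel_distr_plus)
  also have "\<dots> \<longleftrightarrow> integrable lborel (\<lambda>x. f (c + x))" by (intro integrable_distr_eq) auto
  finally show ?thesis by (simp add: add.commute)
qed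

lemma L2_translate: "f \<in> L2 lborel \<Longrightarrow> (\<lambda>x. f (x + c)) \<in> L2 lborel"
  using lborel_integrable_translate[of "\<lambda>x. (norm (f x))\<^sup>2" c]
  by (auto simp: L2_def)

lemma norm_L2_translate: "f \<in> L2 lborel \<Longrightarrow> norm_L2 lborel (\<lambda>x. f (x + c)) = norm_L2 lborel f"
  using lborel_integral_translate[of "\<lambda>x. (norm (f x))\<^sup>2" c]
  by (auto simp: norm_L2_def L2_def)

text \<open>
  A dominating function that does not depend on the step, which lets integrals of difference quotients pass to
  the limit.
\<close>

lemma test_fun_difference_quotient:
  fixes z :: "'a::euclidean_space"
  assumes \<phi>: "\<phi> \<in> test_funs \<Omega>"
  defines "D \<equiv> \<lambda>n x. real (Suc n) * (\<phi> (x + (1 / real (Suc n)) *\<^sub>R z) - \<phi> x)"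
  obtains C B where "compact C" "B \<ge> 0" "\<And>n x. \<bar>D n x\<bar> \<le> B * indicator C x"
    "\<And>x. (\<lambda>n. D n x) \<longlonglongrightarrow> grad \<phi> x \<bullet> z"
proof -
  obtain K where K: "compact K" "\<And>x. x \<notin> K \<Longrightarrow> \<phi> x = 0"
    using test_fun_supportE[OF \<phi>] by metis
  obtain R where R: "K \<subseteq> cball 0 R"
    using compact_imp_bounded[OF K(1)] by (auto simp: bounded_iff subset_iff)
  obtain B where B: "\<And>x. norm (grad \<phi> x) \<le> B" "B \<ge> 0" using grad_bounded[OF \<phi>] by blast
  let ?C = "cball 0 (R + norm z) :: 'a set"
  have bnd: "\<bar>D n x\<bar> \<le> (B * norm z) * indicator ?C x" for n x
  proof (cases "x \<in> ?C")
    case True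
    have "norm (\<phi> (x + (1 / real (Suc n)) *\<^sub>R z) - \<phi> x) \<le> B * norm ((x + (1 / real (Suc n)) *\<^sub>R z) - x)"
    proof (rule differentiable_bound[where S = UNIV and f' = "\<lambda>x h. grad \<phi> x \<bullet> h"])
      show "onorm (\<lambda>h. grad \<phi> x \<bullet> h) \<le> B" for x
      proof (rule onorm_bound[OF B(2)])
        show "norm (grad \<phi> x \<bullet> h) \<le> B * norm h" for h
          using order_trans[OF Cauchy_Schwarz_ineq2 mult_right_mono[OF B(1) norm_ge_zero]] by simp
      qed
    qed (use test_fun_has_derivative[OF \<phi>] in auto)
    then have "real (Suc n) * \<bar>\<phi> (x + (1 / real (Suc n)) *\<^sub>R z) - \<phi> x\<bar>
        \<le> real (Suc n) * (B * (norm z / real (Suc n)))"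
      by (intro mult_left_mono) (auto simp del: of_nat_Suc)
    then show ?thesis using True by (simp add: D_def abs_mult del: of_nat_Suc)
  next
    case False
    then have 1: "x \<notin> K" using R norm_ge_zero[of z] by (smt (verit) mem_cball_0 subsetD)
    have "x + (1 / real (Suc n)) *\<^sub>R z \<notin> K"
    proof
      assume "x + (1 / real (Suc n)) *\<^sub>R z \<in> K"
      then have "norm (x + (1 / real (Suc n)) *\<^sub>R z) \<le> R" using R by auto
      moreover have "norm ((1 / real (Suc n)) *\<^sub>R z) \<le> norm z"
        by (simp add: field_simps mult_le_cancel_left1)
      ultimately have "norm x \<le> R + norm z"
        using norm_triangle_ineq4[of "x + (1 / real (Suc n)) *\<^sub>R z" "(1 / real (Suc n)) *\<^sub>R z"] by simp
      then show False using False by simp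
    qed
    then show ?thesis using False 1 K(2) by (simp add: D_def)
  qed
  have lim: "(\<lambda>n. D n x) \<longlonglongrightarrow> grad \<phi> x \<bullet> z" for x
  proof -
    have "((\<lambda>t. \<phi> (x + t *\<^sub>R z)) has_derivative (\<lambda>t. grad \<phi> (x + 0 *\<^sub>R z) \<bullet> (t *\<^sub>R z))) (at 0)"
      by (rule has_derivative_compose[OF _ test_fun_has_derivative[OF \<phi>]])
         (auto intro!: derivative_eq_intros)
    then have "((\<lambda>t. \<phi> (x + t *\<^sub>R z)) has_real_derivative (grad \<phi> x \<bullet> z)) (at 0)"
      by (simp add: has_field_derivative_def mult_commute_abs)
    then have "((\<lambda>h. (\<phi> (x + h *\<^sub>R z) - \<phi> x) / h) \<longlongrightarrow> grad \<phi> x \<bullet> z) (at 0)"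
      by (simp add: DERIV_def)
    moreover have "filterlim (\<lambda>n. 1 / real (Suc n)) (at 0) sequentially"
      using LIMSEQ_inverse_real_of_nat by (simp add: filterlim_at inverse_eq_divide)
    ultimately have "(\<lambda>n. (\<phi> (x + (1 / real (Suc n)) *\<^sub>R z) - \<phi> x) / (1 / real (Suc n))) \<longlonglongrightarrow> grad \<phi> x \<bullet> z"
      by (rule filterlim_compose)
    then show ?thesis by (simp add: D_def mult.commute del: of_nat_Suc)
  qed
  show thesis by (rule that[OF compact_cball _ bnd lim]) (simp add: B)
qed

text \<open>
  By translation invariance the integral of every difference quotient is zero.
\<close>

lemma integral_pderiv_test_fun:
  assumes \<phi>: "\<phi> \<in> test_funs \<Omega>" and e: "e \<in> Basis"
  shows "(LINT x|lborel. frechet_derivative \<phi> (at x) e) = 0"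
proof -
  define D where "D n x = real (Suc n) * (\<phi> (x + (1 / real (Suc n)) *\<^sub>R e) - \<phi> x)" for n x
  obtain C B where C: "compact C" "B \<ge> 0" "\<And>n x. \<bar>D n x\<bar> \<le> B * indicator C x"
    "\<And>x. (\<lambda>n. D n x) \<longlonglongrightarrow> grad \<phi> x \<bullet> e"
    using test_fun_difference_quotient[OF \<phi>, of e] unfolding D_def by metis
  have [measurable]: "\<phi> \<in> borel_measurable borel" using \<phi> by (rule test_fun_measurable)
  have "(\<lambda>n. LINT x|lborel. D n x) \<longlonglongrightarrow> (LINT x|lborel. grad \<phi> x \<bullet> e)"
  proof (rule integral_dominated_convergence[where w = "\<lambda>x. B * indicator C x"])
    show "integrable lborel (\<lambda>x. B * indicator C x)"
      using C(1) by (auto intro!: integrable_mult_right integrable_real_indicator emeasure_compact_finite borel_compact)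
    show "(\<lambda>x. grad \<phi> x \<bullet> e) \<in> borel_measurable lborel"
      using L2D[OF grad_L2[OF \<phi>]] by measurable
    show "D n \<in> borel_measurable lborel" for n unfolding D_def by measurable
  qed (use C in auto)
  moreover have "(LINT x|lborel. D n x) = 0" for n
    unfolding D_def using test_fun_integrable[OF \<phi>]
      lborel_integrable_translate[of \<phi> "(1 / real (Suc n)) *\<^sub>R e"]
      lborel_integral_translate[of \<phi> "(1 / real (Suc n)) *\<^sub>R e"]
    by (simp del: of_nat_Suc)
  ultimately have "(LINT x|lborel. grad \<phi> x \<bullet> e) = 0" by (simp add: LIMSEQ_const_iff)
  then show ?thesis using e by (simp add: grad_inner_Basis)
qed

text \<open>
  Cut the segment from \<open>x\<close> to \<open>x + z\<close> into \<open>n + 1\<close> pieces. The Cauchy-Schwarz inequality for the sum of the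
  increments and translation invariance bound the left side by the integral of the squared difference quotient
  with step \<open>1 / (n + 1)\<close>, which tends to that of the squared directional derivative.
\<close>

lemma test_fun_translation_estimate:
  assumes \<phi>: "\<phi> \<in> test_funs \<Omega>"
  shows "norm_L2 lborel (\<lambda>x. \<phi> (x + z) - \<phi> x) \<le> norm z * norm_L2 lborel (grad \<phi>)"
proof -
  define D where "D n x = real (Suc n) * (\<phi> (x + (1 / real (Suc n)) *\<^sub>R z) - \<phi> x)" for n x
  obtain C B where C: "compact C" "B \<ge> 0" "\<And>n x. \<bar>D n x\<bar> \<le> B * indicator C x"
    "\<And>x. (\<lambda>n. D n x) \<longlonglongrightarrow> grad \<phi> x \<bullet> z"
    using test_fun_difference_quotient[OF \<phi>, of z] unfolding D_def by metis
  have [measurable]: "\<phi> \<in> borel_measurable borel" using \<phi> by (rule test_fun_measurable)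
  have [measurable]: "grad \<phi> \<in> borel_measurable borel" using L2D[OF grad_L2[OF \<phi>]] by simp
  have L: "(\<lambda>x. \<phi> (x + c) - \<phi> (x + d)) \<in> L2 lborel" for c d
    by (intro L2_diff L2_translate test_fun_L2[OF \<phi>])
  have "(\<lambda>n. LINT x|lborel. (D n x)\<^sup>2) \<longlonglongrightarrow> (LINT x|lborel. (grad \<phi> x \<bullet> z)\<^sup>2)"
  proof (rule integral_dominated_convergence[where w = "\<lambda>x. B\<^sup>2 * indicator C x"])
    show "integrable lborel (\<lambda>x. B\<^sup>2 * indicator C x)"
      using C(1) by (auto intro!: integrable_mult_right integrable_real_indicator emeasure_compact_finite borel_compact)
    show "(\<lambda>x. (D n x)\<^sup>2) \<in> borel_measurable lborel" for n unfolding D_def by measurable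
    show "AE x in lborel. norm ((D n x)\<^sup>2) \<le> B\<^sup>2 * indicator C x" for n
    proof (intro AE_I2)
      fix x
      have "\<bar>D n x\<bar>\<^sup>2 \<le> (B * indicator C x)\<^sup>2" by (intro power_mono C) auto
      then show "norm ((D n x)\<^sup>2) \<le> B\<^sup>2 * indicator C x"
        by (cases "x \<in> C") (simp_all add: power_mult_distrib)
    qed
    show "AE x in lborel. (\<lambda>n. (D n x)\<^sup>2) \<longlonglongrightarrow> (grad \<phi> x \<bullet> z)\<^sup>2"
      using C(4) by (intro AE_I2 tendsto_intros)
  qed measurable
  moreover have "(LINT x|lborel. (\<phi> (x + z) - \<phi> x)\<^sup>2) \<le> (LINT x|lborel. (D n x)\<^sup>2)" for n
  proof -
    define y where "y = (1 / real (Suc n)) *\<^sub>R z"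
    have sq: "(\<phi> (x + z) - \<phi> x)\<^sup>2 \<le> (\<Sum>k<Suc n. (\<phi> (x + real (Suc k) *\<^sub>R y) - \<phi> (x
        + real k *\<^sub>R y))\<^sup>2) * real (Suc n)"
      for x
    proof -
      have "\<phi> (x + z) - \<phi> x = (\<Sum>k<Suc n. \<phi> (x + real (Suc k) *\<^sub>R y) - \<phi> (x + real k *\<^sub>R y))"
        by (subst sum_lessThan_telescope) (simp add: y_def del: of_nat_Suc)
      then show ?thesis
        using sum_squared_le_sum_of_squares[of "\<lambda>k. \<phi> (x + real (Suc k) *\<^sub>R y) - \<phi> (x + real k *\<^sub>R y)"
            "{..<Suc n}"]
        by (simp del: sum.lessThan_Suc of_nat_Suc)
    qed
    have I: "integrable lborel (\<lambda>x. (\<phi> (x + c) - \<phi> (x + d))\<^sup>2)" for c d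
      using L2_integrable[OF L[of c d]] by simp
    have tr: "(LINT x|lborel. (\<phi> (x + real (Suc k) *\<^sub>R y) - \<phi> (x + real k *\<^sub>R y))\<^sup>2)
        = (LINT x|lborel. (\<phi> (x + y) - \<phi> x)\<^sup>2)" for k
      using lborel_integral_translate[of "\<lambda>x. (\<phi> (x + y) - \<phi> x)\<^sup>2" "real k *\<^sub>R y"]
      by (simp add: algebra_simps)
    have "(LINT x|lborel. (\<phi> (x + z) - \<phi> x)\<^sup>2) \<le>
        (LINT x|lborel. (\<Sum>k<Suc n. (\<phi> (x + real (Suc k) *\<^sub>R y) - \<phi> (x + real k *\<^sub>R y))\<^sup>2) * real (Suc n))"
    proof (rule integral_mono)
      show "integrable lborel (\<lambda>x. (\<phi> (x + z) - \<phi> x)\<^sup>2)" using I[of z 0] by simp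
      show "integrable lborel (\<lambda>x. (\<Sum>k<Suc n. (\<phi> (x + real (Suc k) *\<^sub>R y) - \<phi> (x
        + real k *\<^sub>R y))\<^sup>2) * real (Suc n))"
        by (intro integrable_mult_left Bochner_Integration.integrable_sum I)
    qed (rule sq)
    also have "\<dots> = (\<Sum>k<Suc n. (LINT x|lborel. (\<phi> (x + y) - \<phi> x)\<^sup>2)) * real (Suc n)"
      by (simp only: integral_mult_left_zero Bochner_Integration.integral_sum[OF I] tr)
    also have "\<dots> = (LINT x|lborel. (D n x)\<^sup>2)"
    proof -
      have "(LINT x|lborel. (D n x)\<^sup>2) = (LINT x|lborel. (real (Suc n))\<^sup>2 * (\<phi> (x + y) - \<phi> x)\<^sup>2)"
        by (simp only: D_def y_def power_mult_distrib)
      then show ?thesis by (simp add: power2_eq_square[of "real (Suc n)"] del: of_nat_Suc sum.lessThan_Suc)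
    qed
    finally show ?thesis .
  qed
  ultimately have "(LINT x|lborel. (\<phi> (x + z) - \<phi> x)\<^sup>2) \<le> (LINT x|lborel. (grad \<phi> x \<bullet> z)\<^sup>2)"
    by (intro LIMSEQ_le_const) auto
  also have "\<dots> \<le> (LINT x|lborel. (norm z)\<^sup>2 * (norm (grad \<phi> x))\<^sup>2)"
  proof (rule integral_mono)
    have cs: "(grad \<phi> x \<bullet> z)\<^sup>2 \<le> (norm z)\<^sup>2 * (norm (grad \<phi> x))\<^sup>2" for x
      using Cauchy_Schwarz_ineq2[of "grad \<phi> x" z]
      by (metis abs_le_square_iff abs_mult abs_norm_cancel mult.commute power_mult_distrib)
    show "integrable lborel (\<lambda>x. (norm z)\<^sup>2 * (norm (grad \<phi> x))\<^sup>2)"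
      using L2_integrable[OF grad_L2[OF \<phi>]] by simp
    then show "integrable lborel (\<lambda>x. (grad \<phi> x \<bullet> z)\<^sup>2)"
      by (rule Bochner_Integration.integrable_bound) (use cs in auto)
    show "(grad \<phi> x \<bullet> z)\<^sup>2 \<le> (norm z)\<^sup>2 * (norm (grad \<phi> x))\<^sup>2" for x by (rule cs)
  qed
  finally have "(norm_L2 lborel (\<lambda>x. \<phi> (x + z) - \<phi> x))\<^sup>2 \<le> (norm z * norm_L2 lborel (grad \<phi>))\<^sup>2"
    by (simp add: norm_L2_sq power_mult_distrib)
  then show ?thesis by (rule power2_le_imp_le) (simp add: norm_L2_nonneg)
qed

text \<open>
  The sets over which \<open>w\<close> integrates to zero form a Dynkin system, and boxes are a generator of the Borel sets
  that is stable under intersection.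
\<close>

lemma AE_zero_if_integral_box_zero:
  fixes w :: "'a::euclidean_space \<Rightarrow> real"
  assumes w: "integrable lborel w" and box0: "\<And>a b. (LINT x:box a b|lborel. w x) = 0"
  shows "AE x in lborel. w x = 0"
proof (rule sigma_finite_measure.density_zero[OF sigma_finite_lborel w])
  fix A :: "'a set" assume "A \<in> sets lborel"
  have si: "set_integrable lborel B w" if "B \<in> sets borel" for B
    using integrable_mult_indicator[OF _ w, of B] that by (simp add: set_integrable_def)
  have all0: "(LINT x|lborel. w x) = 0"
  proof -
    have ind: "(\<lambda>n. indicator (box (- real n *\<^sub>R One) (real n *\<^sub>R One)) x *\<^sub>R w x) \<longlonglongrightarrow> w x" for x :: 'a
    proof (rule tendsto_eventually)
      obtain N where N: "norm x < real N" using reals_Archimedean2 by blast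
      show "\<forall>\<^sub>F n in sequentially. indicator (box (- real n *\<^sub>R One) (real n *\<^sub>R One)) x *\<^sub>R w x = w x"
        using eventually_ge_at_top[of N]
      proof eventually_elim
        case (elim n)
        have "\<bar>x \<bullet> i\<bar> < real n" if "i \<in> Basis" for i
          using Basis_le_norm[OF that, of x] N elim by (simp add: le_less_trans)
        then have "x \<in> box (- real n *\<^sub>R One) (real n *\<^sub>R One)"
          by (auto simp: box_def abs_less_iff) (metis minus_less_iff)
        then show ?case by simp
      qed
    qed
    have "(\<lambda>n. LINT x|lborel. indicator (box (- real n *\<^sub>R One) (real n *\<^sub>R One)) x *\<^sub>R w x)
        \<longlonglongrightarrow> (LINT x|lborel. w x)"
      by (rule integral_dominated_convergence[where w = "\<lambda>x. norm (w x)"])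
         (use w ind in \<open>auto simp: indicator_def intro!: integrable_norm borel_measurable_integrable
            borel_measurable_scaleR borel_measurable_indicator\<close>)
    then show ?thesis
      using box0 unfolding set_lebesgue_integral_def by (simp add: LIMSEQ_const_iff)
  qed
  let ?G = "range (\<lambda>(a, b). box a b :: 'a set)"
  have "Int_stable ?G"
  proof (rule Int_stableI_image)
    fix i j :: "'a \<times> 'a"
    show "\<exists>k\<in>UNIV. (case i of (a, b) \<Rightarrow> box a b) \<inter> (case j of (a, b) \<Rightarrow> box a b) = (case k of (a, b) \<Rightarrow> box a b)"
      by (cases i; cases j) (auto simp: box_Int_box)
  qed
  moreover have "?G \<subseteq> Pow UNIV" by simp
  moreover have "A \<in> sigma_sets UNIV ?G"
    using \<open>A \<in> sets lborel\<close> by (subst (asm) sets_lborel, subst (asm) borel_eq_box) simp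
  ultimately show "(LINT x:A|lborel. w x) = 0"
  proof (induction rule: sigma_sets_induct_disjoint)
    case (basic A) then show ?case using box0 by auto
  next
    case empty show ?case by (simp add: set_lebesgue_integral_def)
  next
    case (compl A)
    have A: "A \<in> sets borel" using compl(1) unfolding borel_eq_box by simp
    have "(LINT x:UNIV - A|lborel. w x) = (LINT x:UNIV|lborel. w x) - (LINT x:A|lborel. w x)"
    proof -
      have "indicator (UNIV - A) x *\<^sub>R w x = indicator UNIV x *\<^sub>R w x - indicator A x *\<^sub>R w x" for x
        by (auto simp: indicator_def)
      then show ?thesis using si[OF A] si[of UNIV]
        unfolding set_lebesgue_integral_def set_integrable_def by simp
    qed
    then show ?case using compl(2) all0 by (simp add: set_lebesgue_integral_def)
  next
    case (union A)
    have A: "A i \<in> sets borel" for i using union(2) unfolding borel_eq_box by auto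
    have "(LINT x:(\<Union>i. A i)|lborel. w x) = (\<Sum>i. (LINT x:(A i)|lborel. w x))"
      by (rule lebesgue_integral_countable_add)
         (use A union(1) in \<open>auto simp: disjoint_family_on_def intro!: si\<close>)
    then show ?case using union(3) by simp
  qed
qed

section \<open>Uniqueness of weak gradients\<close>

lemma AE_lebesgue_on_iff:
  "open \<Omega> \<Longrightarrow> (AE x in lebesgue_on \<Omega>. P x) \<longleftrightarrow> (AE x in lborel. x \<in> \<Omega> \<longrightarrow> P x)"
  by (subst AE_restrict_space_iff) (auto simp: AE_completion_iff)

lemma borel_measurable_lebesgue_on:
  fixes f :: "'a::euclidean_space \<Rightarrow> 'b::real_normed_vector"
  shows "f \<in> borel_measurable borel \<Longrightarrow> f \<in> borel_measurable (lebesgue_on \<Omega>)"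
  by (intro measurable_restrict_space1 measurable_completion) simp

lemma integrable_lebesgue_on_iff:
  fixes f :: "'a::euclidean_space \<Rightarrow> 'b::euclidean_space"
  assumes "open \<Omega>" and [measurable]: "f \<in> borel_measurable borel"
  shows "integrable (lebesgue_on \<Omega>) f \<longleftrightarrow> integrable lborel (\<lambda>x. indicator \<Omega> x *\<^sub>R f x)"
  using assms(1) by (subst integrable_restrict_space) (auto intro!: integrable_completion)

lemma integral_lebesgue_on_eq:
  fixes f :: "'a::euclidean_space \<Rightarrow> 'b::euclidean_space"
  assumes "open \<Omega>" and [measurable]: "f \<in> borel_measurable borel"
  shows "(LINT x|lebesgue_on \<Omega>. f x) = (LINT x|lborel. indicator \<Omega> x *\<^sub>R f x)"
  using assms(1) by (subst integral_restrict_space) (auto intro!: integral_completion)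

lemma integral_lebesgue_on_eq_lborel:
  fixes f :: "'a::euclidean_space \<Rightarrow> 'b::euclidean_space"
  assumes "open \<Omega>" and [measurable]: "f \<in> borel_measurable borel" and "AE x in lborel. x \<notin> \<Omega> \<longrightarrow> f x = 0"
  shows "(LINT x|lebesgue_on \<Omega>. f x) = (LINT x|lborel. f x)"
proof -
  have [measurable]: "\<Omega> \<in> sets borel" using assms(1) by simp
  show ?thesis unfolding integral_lebesgue_on_eq[OF assms(1,2)]
  proof (rule integral_cong_AE)
    show "AE x in lborel. indicator \<Omega> x *\<^sub>R f x = f x"
      using assms(3) by eventually_elim (auto simp: indicator_def)
  qed measurable
qed

lemma integrable_lebesgue_on_lborel:
  fixes f :: "'a::euclidean_space \<Rightarrow> 'b::euclidean_space"
  assumes "open \<Omega>" "integrable lborel f"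
  shows "integrable (lebesgue_on \<Omega>) f"
  using assms integrable_mult_indicator[of \<Omega> lborel f]
  by (subst integrable_lebesgue_on_iff) auto

lemma L2_lborel_imp_lebesgue_on:
  "open \<Omega> \<Longrightarrow> f \<in> L2 lborel \<Longrightarrow> f \<in> L2 (lebesgue_on \<Omega>)"
  using L2D[of f lborel]
  by (intro L2I integrable_lebesgue_on_lborel borel_measurable_lebesgue_on) (simp_all add: L2_integrable)

lemma norm_L2_lebesgue_on_le:
  assumes "open \<Omega>" "f \<in> L2 lborel"
  shows "norm_L2 (lebesgue_on \<Omega>) f \<le> norm_L2 lborel f"
proof -
  have [measurable]: "\<Omega> \<in> sets borel" "f \<in> borel_measurable borel" using assms by (auto dest: L2D)
  have "(LINT x|lebesgue_on \<Omega>. (norm (f x))\<^sup>2) \<le> (LINT x|lborel. (norm (f x))\<^sup>2)"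
    unfolding integral_lebesgue_on_eq[OF assms(1), of "\<lambda>x. (norm (f x))\<^sup>2", simplified]
    using L2_integrable[OF assms(2)] integrable_mult_indicator[OF _ L2_integrable[OF assms(2)], of \<Omega>]
    by (intro integral_mono) (auto simp: indicator_def)
  then show ?thesis by (simp add: norm_L2_def)
qed

lemma norm_L2_lebesgue_on_eq:
  assumes "open \<Omega>" "f \<in> L2 lborel" "AE x in lborel. x \<notin> \<Omega> \<longrightarrow> f x = 0"
  shows "norm_L2 (lebesgue_on \<Omega>) f = norm_L2 lborel f"
proof -
  have [measurable]: "f \<in> borel_measurable borel" using assms by (auto dest: L2D)
  have "AE x in lborel. x \<notin> \<Omega> \<longrightarrow> (norm (f x))\<^sup>2 = 0" using assms(3) by eventually_elim simp
  then show ?thesis unfolding norm_L2_def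
    by (subst integral_lebesgue_on_eq_lborel[OF assms(1)]) auto
qed

text \<open>
  Borel functions on the whole space can be translated and integrated iteratively, which is awkward for
  functions that are only Lebesgue measurable on \<open>\<Omega>\<close>.
\<close>

lemma lebesgue_on_borel_representative:
  fixes f :: "'a::euclidean_space \<Rightarrow> 'b::euclidean_space"
  assumes "open \<Omega>" "f \<in> borel_measurable (lebesgue_on \<Omega>)"
  obtains h where "h \<in> borel_measurable borel" "\<And>x. x \<notin> \<Omega> \<Longrightarrow> h x = 0"
    "AE x in lebesgue_on \<Omega>. f x = h x"
proof -
  have [measurable]: "\<Omega> \<in> sets borel" using assms(1) by simp
  have m: "(\<lambda>x. indicator \<Omega> x *\<^sub>R f x) \<in> borel_measurable lebesgue"
    using assms by (subst borel_measurable_restrict_space_iff[symmetric]) auto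
  have "\<exists>h. h \<in> borel_measurable lborel \<and> (AE x in lborel. (indicator \<Omega> x *\<^sub>R f x) \<bullet> i = h x)" for i
    using completion_ex_borel_measurable_real[OF borel_measurable_inner[OF m borel_measurable_const], of i]
    by blast
  then obtain h where h: "\<And>i. h i \<in> borel_measurable lborel"
    "\<And>i. AE x in lborel. (indicator \<Omega> x *\<^sub>R f x) \<bullet> i = h i x" by metis
  have [measurable]: "h i \<in> borel_measurable borel" for i using h(1)[of i] by simp
  define k where "k x = indicator \<Omega> x *\<^sub>R (\<Sum>i\<in>Basis. h i x *\<^sub>R i)" for x
  have "AE x in lborel. \<forall>i\<in>Basis. (indicator \<Omega> x *\<^sub>R f x) \<bullet> i = h i x"
    by (rule AE_finite_allI) (use h in auto)
  then have "AE x in lborel. x \<in> \<Omega> \<longrightarrow> f x = k x"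
  proof eventually_elim
    case (elim x)
    show ?case
    proof
      assume "x \<in> \<Omega>"
      then show "f x = k x" using elim
        by (intro euclidean_eqI[where 'a
            = 'b]) (simp add: k_def inner_sum_left inner_Basis if_distrib cong: if_cong)
    qed
  qed
  then have "AE x in lebesgue_on \<Omega>. f x = k x" by (simp add: AE_lebesgue_on_iff[OF assms(1)])
  moreover have "k \<in> borel_measurable borel" unfolding k_def by measurable
  moreover have "k x = 0" if "x \<notin> \<Omega>" for x using that by (simp add: k_def)
  ultimately show thesis using that by blast
qed

lemma borel_measurable_lebesgue_on_AE:
  fixes f g :: "'a::euclidean_space \<Rightarrow> 'b::euclidean_space"
  assumes "open \<Omega>" "f \<in> borel_measurable (lebesgue_on \<Omega>)" "AE x in lebesgue_on \<Omega>. f x = g x"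
  shows "g \<in> borel_measurable (lebesgue_on \<Omega>)"
proof -
  have O: "\<Omega> \<inter> space lebesgue \<in> sets lebesgue" using assms(1) by auto
  have "AE x in lborel. indicator \<Omega> x *\<^sub>R f x = indicator \<Omega> x *\<^sub>R g x"
    using assms(3) unfolding AE_lebesgue_on_iff[OF assms(1)]
    by eventually_elim (auto simp: indicator_def)
  then have "AE x in lebesgue. indicator \<Omega> x *\<^sub>R f x = indicator \<Omega> x *\<^sub>R g x" by (rule AE_completion)
  from borel_measurable_AE[OF _ this] show ?thesis
    using assms(2) by (simp add: borel_measurable_restrict_space_iff[OF O])
qed

lemma integrable_times_compactly_supported:
  fixes f \<psi> :: "'a::euclidean_space \<Rightarrow> real"
  assumes "open \<Omega>" "compact K" "K \<subseteq> \<Omega>" "integrable (lebesgue_on K) f"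
    and [measurable]: "\<psi> \<in> borel_measurable borel"
    and "\<And>x. \<bar>\<psi> x\<bar> \<le> B" "\<And>x. x \<notin> K \<Longrightarrow> \<psi> x = 0"
  shows "integrable (lebesgue_on \<Omega>) (\<lambda>x. f x * \<psi> x)"
proof -
  have K: "K \<inter> space lebesgue \<in> sets lebesgue" using assms(2) by (auto simp: borel_compact)
  have O: "\<Omega> \<inter> space lebesgue \<in> sets lebesgue" using assms(1) by auto
  have 1: "integrable lebesgue (\<lambda>x. indicator K x *\<^sub>R f x)"
    using assms(4) by (simp add: integrable_restrict_space[OF K])
  have m: "\<psi> \<in> borel_measurable lebesgue" by (intro measurable_completion) simp
  have "integrable lebesgue (\<lambda>x. (indicator K x *\<^sub>R f x) * \<psi> x)"
  proof (rule Bochner_Integration.integrable_bound)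
    show "integrable lebesgue (\<lambda>x. B * (indicator K x *\<^sub>R f x))" using 1 by (intro integrable_mult_right)
    show "(\<lambda>x. (indicator K x *\<^sub>R f x) * \<psi> x) \<in> borel_measurable lebesgue"
      using borel_measurable_integrable[OF 1] m by (intro borel_measurable_times)
    show "AE x in lebesgue. norm ((indicator K x *\<^sub>R f x) * \<psi> x) \<le> norm (B * (indicator K x *\<^sub>R f x))"
    proof (intro AE_I2)
      fix x show "norm ((indicator K x *\<^sub>R f x) * \<psi> x) \<le> norm (B * (indicator K x *\<^sub>R f x))"
        using assms(6)[of x] by (cases "x \<in> K") (auto simp: abs_mult mult.commute intro!: mult_right_mono)
    qed
  qed
  moreover have "(\<lambda>x. (indicator K x *\<^sub>R f x) * \<psi> x) = (\<lambda>x. indicator \<Omega> x *\<^sub>R (f x * \<psi> x))"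
  proof
    fix x show "(indicator K x *\<^sub>R f x) * \<psi> x = indicator \<Omega> x *\<^sub>R (f x * \<psi> x)"
      using assms(3) assms(7)[of x] by (cases "x \<in> K") auto
  qed
  ultimately show ?thesis by (simp add: integrable_restrict_space[OF O])
qed

text \<open>
  Bumps bounded by \<open>1\<close> approximate the indicator of each box whose closure lies in \<open>\<Omega>\<close>, so \<open>w\<close> integrates to zero
  over all of them, and countably many closed boxes cover \<open>\<Omega>\<close>.
\<close>

lemma fundamental_lemma_calculus_of_variations:
  fixes w :: "'a::euclidean_space \<Rightarrow> real"
  assumes \<Omega>: "open \<Omega>"
    and w: "\<And>K. compact K \<Longrightarrow> K \<subseteq> \<Omega> \<Longrightarrow> integrable (lebesgue_on K) w"
    and test: "\<And>\<phi>. \<phi> \<in> test_funs \<Omega> \<Longrightarrow> (LINT x|lebesgue_on \<Omega>. w x * \<phi> x) = 0"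
  shows "AE x in lebesgue_on \<Omega>. w x = 0"
proof -
  have O: "\<Omega> \<inter> space lebesgue \<in> sets lebesgue" using \<Omega> by auto
  have box: "AE x in lborel. x \<in> cbox c d \<longrightarrow> w x = 0" if cd: "cbox c d \<subseteq> \<Omega>" for c d
  proof -
    have "integrable lebesgue (\<lambda>x. indicator (cbox c d) x *\<^sub>R w x)"
      using w[OF compact_cbox cd] by (subst (asm) integrable_restrict_space) auto
    from integrable_mult_indicator[OF _ this, of "box c d"]
    have "integrable lebesgue (\<lambda>x. indicator (box c d) x *\<^sub>R (indicator (cbox c d) x *\<^sub>R w x))" by simp
    moreover have "(\<lambda>x. indicator (box c d) x *\<^sub>R (indicator (cbox c d) x *\<^sub>R w x))
        = (\<lambda>x. indicator (box c d) x * w x)"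
      using box_subset_cbox[of c d] by (intro ext) (auto simp: indicator_def)
    ultimately have 1: "integrable lebesgue (\<lambda>x. indicator (box c d) x * w x)" by (simp only:)
    obtain w' where w'[measurable]: "w' \<in> borel_measurable lborel"
      and ae: "AE x in lborel. indicator (box c d) x * w x = w' x"
      using completion_ex_borel_measurable_real[OF borel_measurable_integrable[OF 1]] by blast
    have ae': "AE x in lebesgue. indicator (box c d) x * w x = w' x" using ae by (rule AE_completion)
    have "integrable lebesgue w'"
      by (rule integrable_cong_AE_imp[OF 1]) (use ae' in \<open>auto intro: measurable_completion\<close>)
    then have w'int: "integrable lborel w'" by (simp add: integrable_completion)
    have test': "(LINT x|lborel. w' x * \<phi> x) = 0"
      if \<phi>: "\<phi> \<in> test_funs \<Omega>" "\<And>x. x \<notin> box c d \<Longrightarrow> \<phi> x = 0" for \<phi>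
    proof -
      have [measurable]: "\<phi> \<in> borel_measurable borel" using \<phi>(1) by (rule test_fun_measurable)
      have ml: "\<phi> \<in> borel_measurable lebesgue" by (intro measurable_completion) simp
      have "(LINT x|lborel. w' x * \<phi> x) = (LINT x|lebesgue. w' x * \<phi> x)"
        by (intro integral_completion[symmetric]) measurable
      also have "\<dots> = (LINT x|lebesgue. (indicator (box c d) x * w x) * \<phi> x)"
      proof (rule integral_cong_AE)
        show "(\<lambda>x. w' x * \<phi> x) \<in> borel_measurable lebesgue" by (intro measurable_completion) measurable
        show "(\<lambda>x. (indicator (box c d) x * w x) * \<phi> x) \<in> borel_measurable lebesgue"
          by (intro borel_measurable_times ml borel_measurable_integrable[OF 1])
        show "AE x in lebesgue. w' x * \<phi> x = (indicator (box c d) x * w x) * \<phi> x"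
          using ae' by eventually_elim simp
      qed
      also have "\<dots> = (LINT x|lebesgue. indicator \<Omega> x *\<^sub>R (w x * \<phi> x))"
      proof (intro Bochner_Integration.integral_cong refl)
        fix x show "(indicator (box c d) x * w x) * \<phi> x = indicator \<Omega> x *\<^sub>R (w x * \<phi> x)"
          using cd box_subset_cbox[of c d] \<phi>(2)[of x] by (cases "x \<in> box c d") (auto simp: subset_iff)
      qed
      also have "\<dots> = (LINT x|lebesgue_on \<Omega>. w x * \<phi> x)"
        by (rule integral_restrict_space[OF O, symmetric])
      finally show ?thesis using test[OF \<phi>(1)] by simp
    qed
    have "AE x in lborel. w' x = 0"
    proof (rule AE_zero_if_integral_box_zero[OF w'int])
      fix a b
      obtain a' b' where ab: "box a b \<inter> box c d = box a' b'"
        using box_Int_box by blast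
      have "(LINT x:box a b|lborel. w' x) = (LINT x|lborel. w' x * indicator (box a' b') x)"
        unfolding set_lebesgue_integral_def
      proof (rule integral_cong_AE)
        show "AE x in lborel. indicator (box a b) x *\<^sub>R w' x = w' x * indicator (box a' b') x"
          using ae
        proof eventually_elim
          case (elim x)
          show ?case
          proof (cases "x \<in> box c d")
            case True
            then have "x \<in> box a b \<longleftrightarrow> x \<in> box a' b'" using ab by blast
            then show ?thesis by (simp add: indicator_def)
          next
            case False
            then have "w' x = 0" using elim by simp
            then show ?thesis by simp
          qed
        qed
      qed measurable
      also have "\<dots> = 0"
      proof (cases "box a' b' = {}")
        case False
        have "closure (box a' b') \<subseteq> closure (box c d)" by (intro closure_mono) (use ab in blast)
        then have "cbox a' b' \<subseteq> \<Omega>"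
          using False cd closure_box[of c d] ab by (cases "box c d = {}") auto
        then have tf: "box_bump a' b' (real (Suc n)) \<in> test_funs \<Omega>" for n
          by (intro box_bump_test_fun) auto
        have "(\<lambda>n. LINT x|lborel. w' x * box_bump a' b' (real (Suc n)) x)
            \<longlonglongrightarrow> (LINT x|lborel. w' x * indicator (box a' b') x)"
        proof (rule integral_dominated_convergence[where w = "\<lambda>x. \<bar>w' x\<bar>"])
          show "(\<lambda>x. w' x * box_bump a' b' (real (Suc n)) x) \<in> borel_measurable lborel" for n
            using test_fun_measurable[OF tf] by measurable
          show "integrable lborel (\<lambda>x. \<bar>w' x\<bar>)" using w'int by (rule integrable_abs)
          show "AE x in lborel. (\<lambda>n. w' x * box_bump a' b' (real (Suc n)) x) \<longlonglongrightarrow> w' x * indicator (box a' b') x"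
            by (intro AE_I2 tendsto_mult_left box_bump_tendsto_indicator)
          show "AE x in lborel. norm (w' x * box_bump a' b' (real (Suc n)) x) \<le> \<bar>w' x\<bar>" for n
            by (intro AE_I2) (auto simp: abs_mult box_bump_nonneg box_bump_le_1 intro!: mult_left_le)
        qed measurable
        moreover have "(LINT x|lborel. w' x * box_bump a' b' (real (Suc n)) x) = 0" for n
          by (rule test'[OF tf]) (use ab box_bump_eq_0[of "real (Suc n)" _ a' b'] in auto)
        ultimately show ?thesis by (simp add: LIMSEQ_const_iff)
      qed simp
      finally show "(LINT x:box a b|lborel. w' x) = 0" .
    qed
    moreover have "AE x in lborel. x \<notin> cbox c d - box c d"
      by (rule AE_not_in) (rule null_sets_cbox_Diff_box)
    ultimately show ?thesis using ae by eventually_elim (auto simp: indicator_def)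
  qed
  obtain D where D: "countable D" "D \<subseteq> Pow \<Omega>" "\<And>X. X \<in> D \<Longrightarrow> \<exists>a b. X = cbox a b" "\<Union>D = \<Omega>"
    using open_countable_Union_open_cbox[OF \<Omega>] by metis
  have "AE x in lborel. \<forall>X\<in>D. x \<in> X \<longrightarrow> w x = 0"
    unfolding AE_ball_countable[OF D(1)] using D(2,3) box by blast
  then have "AE x in lborel. x \<in> \<Omega> \<longrightarrow> w x = 0"
    by eventually_elim (use D(4) in blast)
  then show ?thesis by (simp add: AE_lebesgue_on_iff[OF \<Omega>])
qed

lemma weak_gradient_unique:
  assumes \<Omega>: "open \<Omega>" and g: "has_weak_gradient \<Omega> u g" and h: "has_weak_gradient \<Omega> u h"
  shows "AE x in lebesgue_on \<Omega>. g x = h x"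
proof -
  have "AE x in lebesgue_on \<Omega>. g x \<bullet> i - h x \<bullet> i = 0" if i: "i \<in> Basis" for i
  proof (rule fundamental_lemma_calculus_of_variations[OF \<Omega>])
    have loc: "integrable (lebesgue_on K) (\<lambda>x. g x \<bullet> i)" "integrable (lebesgue_on K) (\<lambda>x. h x \<bullet> i)"
      if "compact K" "K \<subseteq> \<Omega>" for K
      using g h that by (auto simp: has_weak_gradient_def locally_integrable_def)
    show "integrable (lebesgue_on K) (\<lambda>x. g x \<bullet> i - h x \<bullet> i)" if "compact K" "K \<subseteq> \<Omega>" for K
      using loc[OF that] by (rule Bochner_Integration.integrable_diff)
    fix \<phi> assume \<phi>: "\<phi> \<in> test_funs \<Omega>"
    obtain K where K: "compact K" "K \<subseteq> \<Omega>" "\<And>x. x \<notin> K \<Longrightarrow> \<phi> x = 0"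
      using test_fun_supportE[OF \<phi>] by metis
    obtain B where B: "\<And>x. \<bar>\<phi> x\<bar> \<le> B" using test_fun_bounded[OF \<phi>] by blast
    have "integrable (lebesgue_on \<Omega>) (\<lambda>x. (g x \<bullet> i) * \<phi> x)" "integrable (lebesgue_on \<Omega>) (\<lambda>x. (h x \<bullet> i) * \<phi> x)"
      using integrable_times_compactly_supported[OF \<Omega> K(1,2) _ test_fun_measurable[OF \<phi>] B K(3)] loc[OF K(1,2)]
      by auto
    moreover have "(LINT x|lebesgue_on \<Omega>. (g x \<bullet> i) * \<phi> x) = (LINT x|lebesgue_on \<Omega>. (h x \<bullet> i) * \<phi> x)"
      using g h \<phi> i by (auto simp: has_weak_gradient_def)
    ultimately show "(LINT x|lebesgue_on \<Omega>. (g x \<bullet> i - h x \<bullet> i) * \<phi> x) = 0"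
      by (simp add: left_diff_distrib)
  qed
  then have "AE x in lebesgue_on \<Omega>. \<forall>i\<in>Basis. g x \<bullet> i - h x \<bullet> i = 0"
    by (intro AE_finite_allI) auto
  then show ?thesis by eventually_elim (auto intro: euclidean_eqI)
qed

section \<open>\<open>H\<^sub>0\<^sup>1\<close> as the closure of the graph of the gradient\<close>

text \<open>
  The closure in \<open>L\<^sup>2 \<times> L\<^sup>2\<close> of the graph of the gradient on test functions, with Borel representatives on
  the whole space. The estimates are proved for this relation and transported to \<open>H10 \<Omega>\<close> by
  \<open>H10_of_graph\<close> and \<open>H10_imp_graph\<close>.
\<close>

definition H10_graph :: "'a::euclidean_space set \<Rightarrow> ('a \<Rightarrow> real) \<Rightarrow> ('a \<Rightarrow> 'a) \<Rightarrow> bool" where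
  "H10_graph \<Omega> u g \<longleftrightarrow> u \<in> L2 lborel \<and> g \<in> L2 lborel \<and>
     (\<exists>\<phi>. (\<forall>n::nat. \<phi> n \<in> test_funs \<Omega>) \<and>
       (\<lambda>n. norm_L2 lborel (\<lambda>x. \<phi> n x - u x)) \<longlonglongrightarrow> 0 \<and>
       (\<lambda>n. norm_L2 lborel (\<lambda>x. grad (\<phi> n) x - g x)) \<longlonglongrightarrow> 0)"

lemma H10_graph_L2: "H10_graph \<Omega> u g \<Longrightarrow> u \<in> L2 lborel" "H10_graph \<Omega> u g \<Longrightarrow> g \<in> L2 lborel"
  by (auto simp: H10_graph_def)

lemma H10_graph_measurable:
  assumes "H10_graph \<Omega> u g" shows "u \<in> borel_measurable borel" "g \<in> borel_measurable borel"
  using L2D[OF H10_graph_L2(1)[OF assms]] L2D[OF H10_graph_L2(2)[OF assms]] by simp_all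

lemma H10_graph_test_fun: "\<phi> \<in> test_funs \<Omega> \<Longrightarrow> H10_graph \<Omega> \<phi> (grad \<phi>)"
  unfolding H10_graph_def by (intro conjI test_fun_L2 grad_L2 exI[of _ "\<lambda>n. \<phi>"]) (auto simp: norm_L2_def)

lemma H10_graph_approx:
  assumes "H10_graph \<Omega> u g" "e > 0"
  obtains \<phi> where "\<phi> \<in> test_funs \<Omega>" "norm_L2 lborel (\<lambda>x. \<phi> x - u x) < e"
    "norm_L2 lborel (\<lambda>x. grad \<phi> x - g x) < e"
proof -
  obtain \<phi> where \<phi>: "\<And>n. \<phi> n \<in> test_funs \<Omega>"
    and lim: "(\<lambda>n. norm_L2 lborel (\<lambda>x. \<phi> n x - u x)) \<longlonglongrightarrow> 0" "(\<lambda>n. norm_L2 lborel (\<lambda>x. grad (\<phi> n) x - g x)) \<longlonglongrightarrow> 0"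
    using assms(1) unfolding H10_graph_def by blast
  have "\<forall>\<^sub>F n in sequentially. norm_L2 lborel (\<lambda>x. \<phi> n x - u x) < e \<and> norm_L2 lborel (\<lambda>x. grad (\<phi> n) x
    - g x) < e"
    using order_tendstoD(2)[OF lim(1) assms(2)] order_tendstoD(2)[OF lim(2) assms(2)] by eventually_elim simp
  from eventually_happens'[OF sequentially_bot this]
  obtain n where "norm_L2 lborel (\<lambda>x. \<phi> n x - u x) < e \<and> norm_L2 lborel (\<lambda>x. grad (\<phi> n) x - g x) < e" by blast
  then show thesis using \<phi> that by blast
qed

lemma norm_L2_tendsto_0_trans:
  assumes "\<And>n. f n \<in> L2 M" "\<And>n. g n \<in> L2 M" "h \<in> L2 M"
    and near: "\<And>n. norm_L2 M (\<lambda>x. f n x - g n x) \<le> inverse (real (Suc n))"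
    and lim: "(\<lambda>n. norm_L2 M (\<lambda>x. g n x - h x)) \<longlonglongrightarrow> 0"
  shows "(\<lambda>n. norm_L2 M (\<lambda>x. f n x - h x)) \<longlonglongrightarrow> 0"
proof (rule Lim_null_comparison[OF always_eventually])
  show "(\<lambda>n. inverse (real (Suc n)) + norm_L2 M (\<lambda>x. g n x - h x)) \<longlonglongrightarrow> 0"
    using tendsto_add[OF LIMSEQ_inverse_real_of_nat lim] by simp
  show "\<forall>n. norm (norm_L2 M (\<lambda>x. f n x - h x)) \<le> inverse (real (Suc n)) + norm_L2 M (\<lambda>x. g n x - h x)"
  proof
    fix n
    show "norm (norm_L2 M (\<lambda>x. f n x - h x)) \<le> inverse (real (Suc n)) + norm_L2 M (\<lambda>x. g n x - h x)"
      using norm_L2_triangle_diff[OF assms(1)[of n] assms(2)[of n] assms(3)] near[of n]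
      by (simp add: norm_L2_nonneg del: of_nat_Suc)
  qed
qed

lemma norm_L2_tendsto_0_lincomb:
  assumes "\<And>n. f n \<in> L2 M" "f' \<in> L2 M" "\<And>n. g n \<in> L2 M" "g' \<in> L2 M"
    and lim: "(\<lambda>n. norm_L2 M (\<lambda>x. f n x - f' x)) \<longlonglongrightarrow> 0" "(\<lambda>n. norm_L2 M (\<lambda>x. g n x - g' x)) \<longlonglongrightarrow> 0"
  shows "(\<lambda>n. norm_L2 M (\<lambda>x. (f n x + c *\<^sub>R g n x) - (f' x + c *\<^sub>R g' x))) \<longlonglongrightarrow> 0"
proof (rule Lim_null_comparison[OF always_eventually])
  show "(\<lambda>n. norm_L2 M (\<lambda>x. f n x - f' x) + \<bar>c\<bar> * norm_L2 M (\<lambda>x. g n x - g' x)) \<longlonglongrightarrow> 0"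
    using tendsto_add[OF lim(1) tendsto_mult_left[OF lim(2), of "\<bar>c\<bar>"]] by simp
  show "\<forall>n. norm (norm_L2 M (\<lambda>x. (f n x + c *\<^sub>R g n x) - (f' x + c *\<^sub>R g' x)))
      \<le> norm_L2 M (\<lambda>x. f n x - f' x) + \<bar>c\<bar> * norm_L2 M (\<lambda>x. g n x - g' x)"
  proof
    fix n
    have "norm_L2 M (\<lambda>x. (f n x - f' x) + c *\<^sub>R (g n x - g' x))
        \<le> norm_L2 M (\<lambda>x. f n x - f' x) + norm_L2 M (\<lambda>x. c *\<^sub>R (g n x - g' x))"
      by (intro norm_L2_triangle L2_diff L2_scaleR assms)
    then show "norm (norm_L2 M (\<lambda>x. (f n x + c *\<^sub>R g n x) - (f' x + c *\<^sub>R g' x)))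
        \<le> norm_L2 M (\<lambda>x. f n x - f' x) + \<bar>c\<bar> * norm_L2 M (\<lambda>x. g n x - g' x)"
      unfolding norm_L2_scaleR by (simp add: algebra_simps norm_L2_nonneg)
  qed
qed

text \<open>
  Replace each \<open>(u n, g n)\<close> by a test function at distance below \<open>1 / (n + 1)\<close>.
\<close>

lemma H10_graph_closed:
  assumes W: "\<And>n. H10_graph \<Omega> (u n) (g n)" and L: "v \<in> L2 lborel" "h \<in> L2 lborel"
    and lim: "(\<lambda>n. norm_L2 lborel (\<lambda>x. u n x - v x)) \<longlonglongrightarrow> 0" "(\<lambda>n. norm_L2 lborel (\<lambda>x. g n x - h x)) \<longlonglongrightarrow> 0"
  shows "H10_graph \<Omega> v h"
proof -
  have "\<exists>\<phi>. \<phi> \<in> test_funs \<Omega> \<and> norm_L2 lborel (\<lambda>x. \<phi> x - u n x) < inverse (real (Suc n)) \<and>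
      norm_L2 lborel (\<lambda>x. grad \<phi> x - g n x) < inverse (real (Suc n))" for n
    using H10_graph_approx[OF W[of n], of "inverse (real (Suc n))"]
    by (metis inverse_positive_iff_positive of_nat_0_less_iff zero_less_Suc)
  then obtain \<phi> where \<phi>: "\<And>n. \<phi> n \<in> test_funs \<Omega>"
    "\<And>n. norm_L2 lborel (\<lambda>x. \<phi> n x - u n x) < inverse (real (Suc n))"
    "\<And>n. norm_L2 lborel (\<lambda>x. grad (\<phi> n) x - g n x) < inverse (real (Suc n))"
    by metis
  have "(\<lambda>n. norm_L2 lborel (\<lambda>x. \<phi> n x - v x)) \<longlonglongrightarrow> 0"
    by (rule norm_L2_tendsto_0_trans[OF test_fun_L2[OF \<phi>(1)] H10_graph_L2(1)[OF W] L(1) less_imp_le[OF \<phi>(2)] lim(1)])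
  moreover have "(\<lambda>n. norm_L2 lborel (\<lambda>x. grad (\<phi> n) x - h x)) \<longlonglongrightarrow> 0"
    by (rule norm_L2_tendsto_0_trans[OF grad_L2[OF \<phi>(1)] H10_graph_L2(2)[OF W] L(2) less_imp_le[OF \<phi>(3)] lim(2)])
  ultimately show ?thesis using L \<phi>(1) unfolding H10_graph_def by blast
qed

lemma H10_graph_lincomb:
  assumes "H10_graph \<Omega> u g" "H10_graph \<Omega> v h"
  shows "H10_graph \<Omega> (\<lambda>x. u x + c * v x) (\<lambda>x. g x + c *\<^sub>R h x)"
proof -
  obtain \<phi> where \<phi>: "\<And>n. \<phi> n \<in> test_funs \<Omega>"
    and lu: "(\<lambda>n. norm_L2 lborel (\<lambda>x. \<phi> n x - u x)) \<longlonglongrightarrow> 0" "(\<lambda>n. norm_L2 lborel (\<lambda>x. grad (\<phi> n) x - g x)) \<longlonglongrightarrow> 0"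
    using assms(1) unfolding H10_graph_def by blast
  obtain \<psi> where \<psi>: "\<And>n. \<psi> n \<in> test_funs \<Omega>"
    and lv: "(\<lambda>n. norm_L2 lborel (\<lambda>x. \<psi> n x - v x)) \<longlonglongrightarrow> 0" "(\<lambda>n. norm_L2 lborel (\<lambda>x. grad (\<psi> n) x - h x)) \<longlonglongrightarrow> 0"
    using assms(2) unfolding H10_graph_def by blast
  define \<theta> where "\<theta> n x = \<phi> n x + c * \<psi> n x" for n x
  have \<theta>: "\<theta> n \<in> test_funs \<Omega>" for n unfolding \<theta>_def by (intro test_fun_add test_fun_cmult \<phi> \<psi>)
  have g\<theta>: "grad (\<theta> n) x = grad (\<phi> n) x + c *\<^sub>R grad (\<psi> n) x" for n x
    unfolding \<theta>_def by (subst grad_add[OF \<phi> test_fun_cmult[OF \<psi>]]) (simp add: grad_cmult[OF \<psi>])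
  note L = H10_graph_L2[OF assms(1)] H10_graph_L2[OF assms(2)]
  have "(\<lambda>n. norm_L2 lborel (\<lambda>x. \<theta> n x - (u x + c * v x))) \<longlonglongrightarrow> 0"
    using norm_L2_tendsto_0_lincomb[OF test_fun_L2[OF \<phi>] L(1) test_fun_L2[OF \<psi>] L(3) lu(1) lv(1), of c]
    by (simp add: \<theta>_def)
  moreover have "(\<lambda>n. norm_L2 lborel (\<lambda>x. grad (\<theta> n) x - (g x + c *\<^sub>R h x))) \<longlonglongrightarrow> 0"
    using norm_L2_tendsto_0_lincomb[OF grad_L2[OF \<phi>] L(2) grad_L2[OF \<psi>] L(4) lu(2) lv(2), of c]
    by (simp add: g\<theta>)
  moreover have "(\<lambda>x. u x + c * v x) \<in> L2 lborel" "(\<lambda>x. g x + c *\<^sub>R h x) \<in> L2 lborel"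
    by (intro L2_add L2_mult L2_scaleR L)+
  ultimately show ?thesis using \<theta> unfolding H10_graph_def by blast
qed

lemma test_fun_zero_outside:
  assumes "\<phi> \<in> test_funs \<Omega>" "x \<notin> \<Omega>"
  shows "\<phi> x = 0" "grad \<phi> x = 0"
proof -
  have z: "\<psi> x = 0" if "\<psi> \<in> test_funs \<Omega>" for \<psi>
    by (rule test_fun_supportE[OF that]) (use assms(2) in blast)
  show "\<phi> x = 0" by (rule z[OF assms(1)])
  show "grad \<phi> x = 0"
    unfolding grad_def by (rule sum.neutral) (use z[OF test_fun_pderiv[OF assms(1)]] in simp)
qed

lemma H10_graph_zero_outside:
  assumes "H10_graph \<Omega> u g"
  shows "AE x in lborel. x \<notin> \<Omega> \<longrightarrow> u x = 0 \<and> g x = 0"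
proof -
  obtain \<phi> where \<phi>: "\<And>n. \<phi> n \<in> test_funs \<Omega>"
    and lim: "(\<lambda>n. norm_L2 lborel (\<lambda>x. \<phi> n x - u x)) \<longlonglongrightarrow> 0" "(\<lambda>n. norm_L2 lborel (\<lambda>x. grad (\<phi> n) x - g x)) \<longlonglongrightarrow> 0"
    using assms unfolding H10_graph_def by blast
  note z = test_fun_zero_outside[OF \<phi>]
  obtain r where "AE x in lborel. (\<lambda>n. \<phi> (r n) x) \<longlonglongrightarrow> u x"
    using norm_L2_AE_subseq[OF test_fun_L2[OF \<phi>] H10_graph_L2(1)[OF assms] lim(1)] by blast
  moreover obtain s where "AE x in lborel. (\<lambda>n. grad (\<phi> (s n)) x) \<longlonglongrightarrow> g x"
    using norm_L2_AE_subseq[OF grad_L2[OF \<phi>] H10_graph_L2(2)[OF assms] lim(2)] by blast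
  ultimately show ?thesis
  proof eventually_elim
    case (elim x)
    then show ?case using z by (auto simp: LIMSEQ_const_iff)
  qed
qed

lemma H10_graph_translation_estimate:
  assumes W: "H10_graph \<Omega> u g"
  shows "norm_L2 lborel (\<lambda>x. u (x + z) - u x) \<le> norm z * norm_L2 lborel g"
proof -
  obtain \<phi> where \<phi>: "\<And>n. \<phi> n \<in> test_funs \<Omega>"
    and lim: "(\<lambda>n. norm_L2 lborel (\<lambda>x. \<phi> n x - u x)) \<longlonglongrightarrow> 0" "(\<lambda>n. norm_L2 lborel (\<lambda>x. grad (\<phi> n) x - g x)) \<longlonglongrightarrow> 0"
    using W unfolding H10_graph_def by blast
  note L = H10_graph_L2[OF W] test_fun_L2[OF \<phi>]
  have "(\<lambda>n. norm_L2 lborel (\<lambda>x. \<phi> n (x + z) - \<phi> n x)) \<longlonglongrightarrow> norm_L2 lborel (\<lambda>x. u (x + z) - u x)"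
  proof (rule norm_L2_tendsto)
    have "(\<lambda>n. norm_L2 lborel (\<lambda>x. \<phi> n (x + z) - u (x + z))) \<longlonglongrightarrow> 0"
      using lim(1) norm_L2_translate[OF L2_diff[OF L(3,1)], of _ z] by simp
    from norm_L2_tendsto_0_lincomb[OF L2_translate[OF L(3)] L2_translate[OF L(1)] L(3) L(1) this lim(1), of "- 1"]
    show "(\<lambda>n. norm_L2 lborel (\<lambda>x. (\<phi> n (x + z) - \<phi> n x) - (u (x + z) - u x))) \<longlonglongrightarrow> 0" by simp
  qed (intro L2_diff L2_translate L)+
  moreover have "(\<lambda>n. norm z * norm_L2 lborel (grad (\<phi> n))) \<longlonglongrightarrow> norm z * norm_L2 lborel g"
    by (intro tendsto_mult_left norm_L2_tendsto grad_L2[OF \<phi>] L lim)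
  ultimately show ?thesis
    by (rule LIMSEQ_le) (use test_fun_translation_estimate[OF \<phi>] in auto)
qed

lemma L2_locally_integrable:
  fixes f :: "'a::euclidean_space \<Rightarrow> 'b::euclidean_space"
  assumes f: "f \<in> L2 lborel"
  shows "locally_integrable \<Omega> f"
  unfolding locally_integrable_def
proof (intro allI impI)
  fix K assume K: "compact K \<and> K \<subseteq> \<Omega>"
  then have [measurable]: "K \<in> sets borel" by (auto simp: borel_compact)
  have [measurable]: "f \<in> borel_measurable borel" using L2D[OF f] by simp
  have "integrable lborel (\<lambda>x. indicator K x *\<^sub>R f x)"
  proof (rule Bochner_Integration.integrable_bound)
    show "integrable lborel (\<lambda>x. indicator K x + (norm (f x))\<^sup>2)"
      using K emeasure_compact_finite[of K]
      by (intro Bochner_Integration.integrable_add L2_integrable[OF f] integrable_real_indicator) auto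
    show "AE x in lborel. norm (indicator K x *\<^sub>R f x) \<le> norm (indicator K x + (norm (f x))\<^sup>2)"
    proof (intro AE_I2)
      fix x
      have "norm (f x) \<le> 1 + (norm (f x))\<^sup>2"
        using sum_squares_bound[of "norm (f x)" 1] norm_ge_zero[of "f x"] by (simp del: norm_ge_zero)
      then show "norm (indicator K x *\<^sub>R f x) \<le> norm (indicator K x + (norm (f x))\<^sup>2)"
        by (cases "x \<in> K") auto
    qed
  qed measurable
  then have "integrable lebesgue (\<lambda>x. indicator K x *\<^sub>R f x)"
    by (subst integrable_completion) measurable
  then show "integrable (lebesgue_on K) f"
    by (subst integrable_restrict_space) auto
qed

lemma test_fun_integration_by_parts:
  assumes \<phi>: "\<phi> \<in> test_funs \<Omega>" and \<psi>: "\<psi> \<in> test_funs \<Omega>" and i: "i \<in> Basis"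
  shows "(LINT x|lborel. \<phi> x * frechet_derivative \<psi> (at x) i) = - (LINT x|lborel. (grad \<phi> x \<bullet> i) * \<psi> x)"
proof -
  have p: "(\<lambda>x. \<phi> x * \<psi> x) \<in> test_funs \<Omega>" by (intro test_fun_mult \<phi> test_fun_smooth[OF \<psi>])
  have d: "frechet_derivative (\<lambda>x. \<phi> x * \<psi> x) (at x) i = \<phi> x * (grad \<psi> x \<bullet> i) + (grad \<phi> x \<bullet> i) * \<psi> x" for x
    using frechet_derivative_at[OF has_derivative_mult[OF test_fun_has_derivative[OF \<phi>] test_fun_has_derivative[OF \<psi>]], symmetric, of x]
    by simp
  have 1: "integrable lborel (\<lambda>x. \<phi> x * (grad \<psi> x \<bullet> i))" "integrable lborel (\<lambda>x. (grad \<phi> x \<bullet> i) * \<psi> x)"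
    unfolding grad_inner_Basis[OF i]
    by (intro test_fun_integrable[of _ \<Omega>] test_fun_mult \<phi> test_fun_pderiv[OF \<phi>] i test_fun_smooth[OF \<psi>]
        test_fun_smooth[OF test_fun_pderiv[OF \<psi> i]])+
  show ?thesis
    using integral_pderiv_test_fun[OF p i] 1 unfolding d
    by (simp add: grad_inner_Basis[OF i] eq_neg_iff_add_eq_0)
qed

text \<open>
  Integration by parts against a fixed test function is continuous in \<open>L\<^sup>2\<close>.
\<close>

lemma H10_graph_has_weak_gradient:
  assumes \<Omega>: "open \<Omega>" and W: "H10_graph \<Omega> u g"
  shows "has_weak_gradient \<Omega> u g"
  unfolding has_weak_gradient_def
proof (intro conjI ballI L2_locally_integrable H10_graph_L2[OF W])
  fix \<psi> and i :: 'a assume \<psi>: "\<psi> \<in> test_funs \<Omega>" and i: "i \<in> Basis"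
  obtain \<phi> where \<phi>: "\<And>n. \<phi> n \<in> test_funs \<Omega>"
    and lim: "(\<lambda>n. norm_L2 lborel (\<lambda>x. \<phi> n x - u x)) \<longlonglongrightarrow> 0" "(\<lambda>n. norm_L2 lborel (\<lambda>x. grad (\<phi> n) x - g x)) \<longlonglongrightarrow> 0"
    using W unfolding H10_graph_def by blast
  note p = test_fun_pderiv[OF \<psi> i]
  note [measurable] = H10_graph_measurable[OF W] test_fun_measurable[OF \<psi>] test_fun_measurable[OF p]
  note z = test_fun_zero_outside(1)[OF \<psi>] test_fun_zero_outside(1)[OF p]
  have \<psi>i: "(\<lambda>x. \<psi> x *\<^sub>R i) \<in> L2 lborel"
    using L2_integrable[OF test_fun_L2[OF \<psi>]] i by (intro L2I) (simp_all add: power_mult_distrib)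
  have "(\<lambda>n. LINT x|lborel. \<phi> n x \<bullet> frechet_derivative \<psi> (at x) i) \<longlonglongrightarrow> (LINT x|lborel. u x \<bullet> frechet_derivative \<psi> (at x) i)"
    by (intro norm_L2_integral_inner_tendsto test_fun_L2[OF \<phi>] H10_graph_L2[OF W] lim test_fun_L2[OF p])
  moreover have "(\<lambda>n. - (LINT x|lborel. grad (\<phi> n) x \<bullet> (\<psi> x *\<^sub>R i))) \<longlonglongrightarrow> - (LINT x|lborel. g x \<bullet> (\<psi> x *\<^sub>R i))"
    by (intro tendsto_minus norm_L2_integral_inner_tendsto grad_L2[OF \<phi>] H10_graph_L2[OF W] lim \<psi>i)
  moreover have "(LINT x|lborel. \<phi> n x \<bullet> frechet_derivative \<psi> (at x) i)
    = - (LINT x|lborel. grad (\<phi> n) x \<bullet> (\<psi> x *\<^sub>R i))" for n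
    using test_fun_integration_by_parts[OF \<phi> \<psi> i] by (simp add: mult.commute)
  ultimately have "(LINT x|lborel. u x * frechet_derivative \<psi> (at x) i) = - (LINT x|lborel. (g x \<bullet> i) * \<psi> x)"
    using LIMSEQ_unique by (fastforce simp: mult.commute)
  moreover have "(LINT x|lebesgue_on \<Omega>. u x * frechet_derivative \<psi> (at x) i)
    = (LINT x|lborel. u x * frechet_derivative \<psi> (at x) i)"
    by (rule integral_lebesgue_on_eq_lborel[OF \<Omega>]) (auto simp: z)
  moreover have "(LINT x|lebesgue_on \<Omega>. (g x \<bullet> i) * \<psi> x) = (LINT x|lborel. (g x \<bullet> i) * \<psi> x)"
    by (rule integral_lebesgue_on_eq_lborel[OF \<Omega>]) (auto simp: z)
  ultimately show "(LINT x|lebesgue_on \<Omega>. u x * frechet_derivative \<psi> (at x) i)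
    = - (LINT x|lebesgue_on \<Omega>. (g x \<bullet> i) * \<psi> x)"
    by simp
qed

lemma weak_grad_AE_eq:
  assumes "open \<Omega>" "has_weak_gradient \<Omega> u g"
  shows "AE x in lebesgue_on \<Omega>. weak_grad \<Omega> u x = g x"
  unfolding weak_grad_def
  by (rule weak_gradient_unique[OF assms(1) _ assms(2)]) (rule someI[of "has_weak_gradient \<Omega> u"], rule assms(2))

lemma weak_grad_measurable:
  assumes "open \<Omega>" "has_weak_gradient \<Omega> u g" "g \<in> borel_measurable (lebesgue_on \<Omega>)"
  shows "weak_grad \<Omega> u \<in> borel_measurable (lebesgue_on \<Omega>)"
  using borel_measurable_lebesgue_on_AE[OF assms(1,3)] weak_grad_AE_eq[OF assms(1,2)]
  by (simp add: eq_commute)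

lemma H1_norm_eq:
  assumes \<Omega>: "open \<Omega>" and g: "has_weak_gradient \<Omega> u g"
    and L: "g \<in> L2 (lebesgue_on \<Omega>)" "u \<in> L2 (lebesgue_on \<Omega>)"
  shows "(H1_norm \<Omega> u)\<^sup>2 = (norm_L2 (lebesgue_on \<Omega>) g)\<^sup>2 + (norm_L2 (lebesgue_on \<Omega>) u)\<^sup>2"
proof -
  have "(LINT x|lebesgue_on \<Omega>. (norm (weak_grad \<Omega> u x))\<^sup>2 + (u x)\<^sup>2)
    = (LINT x|lebesgue_on \<Omega>. (norm (g x))\<^sup>2 + (u x)\<^sup>2)"
  proof (rule integral_cong_AE)
    show "(\<lambda>x. (norm (weak_grad \<Omega> u x))\<^sup>2 + (u x)\<^sup>2) \<in> borel_measurable (lebesgue_on \<Omega>)"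
      using weak_grad_measurable[OF \<Omega> g L2D[OF L(1)]] L2D[OF L(2)] by measurable
    show "(\<lambda>x. (norm (g x))\<^sup>2 + (u x)\<^sup>2) \<in> borel_measurable (lebesgue_on \<Omega>)"
      using L2D[OF L(1)] L2D[OF L(2)] by measurable
    show "AE x in lebesgue_on \<Omega>. (norm (weak_grad \<Omega> u x))\<^sup>2 + (u x)\<^sup>2 = (norm (g x))\<^sup>2 + (u x)\<^sup>2"
      using weak_grad_AE_eq[OF \<Omega> g] by eventually_elim simp
  qed
  also have "\<dots> = (LINT x|lebesgue_on \<Omega>. (norm (g x))\<^sup>2) + (LINT x|lebesgue_on \<Omega>. (u x)\<^sup>2)"
    using L2_integrable[OF L(1)] L2_integrable[OF L(2)] by simp
  finally show ?thesis by (simp add: H1_norm_def norm_L2_sq)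
qed

lemma H1_iff:
  "u \<in> H1 \<Omega> \<longleftrightarrow> u \<in> L2 (lebesgue_on \<Omega>) \<and> (\<exists>g. has_weak_gradient \<Omega> u g \<and> g \<in> L2 (lebesgue_on \<Omega>))"
  by (simp add: H1_def square_integrable_def L2_def)

lemma H10_L2: "u \<in> H10 \<Omega> \<Longrightarrow> u \<in> L2 (lebesgue_on \<Omega>)"
  by (simp add: H10_def H1_iff)

lemma H10_weak_gradientE:
  assumes "u \<in> H10 \<Omega>"
  obtains g where "has_weak_gradient \<Omega> u g" "g \<in> L2 (lebesgue_on \<Omega>)"
  using assms unfolding H10_def H1_iff by blast

lemma H10_test_funsE:
  assumes "u \<in> H10 \<Omega>"
  obtains \<phi> where "\<And>n::nat. \<phi> n \<in> test_funs \<Omega>" "(\<lambda>n. H1_norm \<Omega> (\<lambda>x. \<phi> n x - u x)) \<longlonglongrightarrow> 0"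
  using assms unfolding H10_def by blast

lemma H10I:
  assumes "u \<in> H1 \<Omega>" "\<And>n::nat. \<phi> n \<in> test_funs \<Omega>" "(\<lambda>n. H1_norm \<Omega> (\<lambda>x. \<phi> n x - u x)) \<longlonglongrightarrow> 0"
  shows "u \<in> H10 \<Omega>"
  using assms unfolding H10_def by blast

lemma has_weak_gradient_cong_AE:
  assumes \<Omega>: "open \<Omega>" and ab: "AE x in lebesgue_on \<Omega>. a x = b x"
    and m: "a \<in> borel_measurable (lebesgue_on \<Omega>)" and g: "has_weak_gradient \<Omega> a g"
  shows "has_weak_gradient \<Omega> b g"
  unfolding has_weak_gradient_def
proof (intro conjI ballI)
  have bm: "b \<in> borel_measurable (lebesgue_on \<Omega>)" by (rule borel_measurable_lebesgue_on_AE[OF \<Omega> m ab])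
  show "locally_integrable \<Omega> b" unfolding locally_integrable_def
  proof (intro allI impI)
    fix K assume K: "compact K \<and> K \<subseteq> \<Omega>"
    have KO: "restrict_space (lebesgue_on \<Omega>) K = lebesgue_on K"
      using K \<Omega> by (subst restrict_restrict_space) (auto simp: borel_compact Int_absorb1)
    show "integrable (lebesgue_on K) b"
    proof (rule integrable_cong_AE_imp)
      show "integrable (lebesgue_on K) a" using g K by (auto simp: has_weak_gradient_def locally_integrable_def)
      show "b \<in> borel_measurable (lebesgue_on K)" unfolding KO[symmetric]
        by (rule measurable_restrict_space1[OF bm])
      show "AE x in lebesgue_on K. a x = b x"
        unfolding KO[symmetric] using K \<Omega>
        by (subst AE_restrict_space_iff)
            (use ab in \<open>auto simp: sets_restrict_space_iff borel_compact elim: eventually_mono\<close>)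
    qed
  qed
  show "locally_integrable \<Omega> g" using g by (simp add: has_weak_gradient_def)
  fix \<psi> and i :: 'a assume \<psi>: "\<psi> \<in> test_funs \<Omega>" and i: "i \<in> Basis"
  have tm: "(\<lambda>x. frechet_derivative \<psi> (at x) i) \<in> borel_measurable (lebesgue_on \<Omega>)"
    by (intro borel_measurable_lebesgue_on test_fun_measurable[OF test_fun_pderiv[OF \<psi> i]])
  have "(LINT x|lebesgue_on \<Omega>. b x * frechet_derivative \<psi> (at x) i)
    = (LINT x|lebesgue_on \<Omega>. a x * frechet_derivative \<psi> (at x) i)"
  proof (rule integral_cong_AE)
    show "AE x in lebesgue_on \<Omega>. b x * frechet_derivative \<psi> (at x) i = a x * frechet_derivative \<psi> (at x) i"
      using ab by eventually_elim simp
  qed (intro borel_measurable_times m bm tm)+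
  then show "(LINT x|lebesgue_on \<Omega>. b x * frechet_derivative \<psi> (at x) i)
    = - (LINT x|lebesgue_on \<Omega>. (g x \<bullet> i) * \<psi> x)"
    using g \<psi> i by (simp add: has_weak_gradient_def)
qed

lemma L2_cong_AE:
  assumes "f \<in> L2 M" "AE x in M. f x = h x" "h \<in> borel_measurable M"
  shows "h \<in> L2 M"
proof (rule L2I[OF assms(3)])
  show "integrable M (\<lambda>x. (norm (h x))\<^sup>2)"
  proof (rule integrable_cong_AE_imp[OF L2_integrable[OF assms(1)]])
    show "(\<lambda>x. (norm (h x))\<^sup>2) \<in> borel_measurable M" using assms(3) by measurable
    show "AE x in M. (norm (f x))\<^sup>2 = (norm (h x))\<^sup>2" using assms(2) by eventually_elim simp
  qed
qed

text \<open>
  Since the weak gradient is unique, the arbitrary choice in \<open>weak_grad\<close> returns \<open>g\<close>, and \<open>H1_norm\<close> of a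
  difference is the distance in the graph.
\<close>

lemma H10_of_graph:
  assumes \<Omega>: "open \<Omega>" and W: "H10_graph \<Omega> v g" and ae: "AE x in lebesgue_on \<Omega>. v x = u x"
  shows "u \<in> H10 \<Omega>" "AE x in lebesgue_on \<Omega>. weak_grad \<Omega> u x = g x" "weak_grad \<Omega> u \<in> L2 (lebesgue_on \<Omega>)"
    "norm_L2 (lebesgue_on \<Omega>) u = norm_L2 lborel v" "norm_L2 (lebesgue_on \<Omega>) (weak_grad \<Omega> u) = norm_L2 lborel g"
proof -
  let ?M = "lebesgue_on \<Omega>"
  obtain \<phi> where \<phi>: "\<And>n. \<phi> n \<in> test_funs \<Omega>"
    and lim: "(\<lambda>n. norm_L2 lborel (\<lambda>x. \<phi> n x - v x)) \<longlonglongrightarrow> 0" "(\<lambda>n. norm_L2 lborel (\<lambda>x. grad (\<phi> n) x - g x)) \<longlonglongrightarrow> 0"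
    using W unfolding H10_graph_def by blast
  have L: "v \<in> L2 ?M" "g \<in> L2 ?M"
    using H10_graph_L2[OF W] L2_lborel_imp_lebesgue_on[OF \<Omega>] by auto
  have um: "u \<in> borel_measurable ?M" by (rule borel_measurable_lebesgue_on_AE[OF \<Omega> L2D[OF L(1)] ae])
  have uL: "u \<in> L2 ?M" by (rule L2_cong_AE[OF L(1) ae um])
  have wu: "has_weak_gradient \<Omega> u g"
    by (rule has_weak_gradient_cong_AE[OF \<Omega> ae L2D[OF L(1)] H10_graph_has_weak_gradient[OF \<Omega> W]])
  show aeg: "AE x in ?M. weak_grad \<Omega> u x = g x" by (rule weak_grad_AE_eq[OF \<Omega> wu])
  then have ae': "AE x in ?M. g x = weak_grad \<Omega> u x" by eventually_elim simp
  have wm: "weak_grad \<Omega> u \<in> borel_measurable ?M" by (rule weak_grad_measurable[OF \<Omega> wu L2D[OF L(2)]])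
  show "weak_grad \<Omega> u \<in> L2 ?M" by (rule L2_cong_AE[OF L(2) ae' wm])
  have z: "AE x in lborel. x \<notin> \<Omega> \<longrightarrow> v x = 0" "AE x in lborel. x \<notin> \<Omega> \<longrightarrow> g x = 0"
    using H10_graph_zero_outside[OF W] by (auto elim: eventually_mono)
  show "norm_L2 ?M u = norm_L2 lborel v"
    using norm_L2_cong_AE[OF ae L2D[OF L(1)] um] norm_L2_lebesgue_on_eq[OF \<Omega> H10_graph_L2(1)[OF W] z(1)] by simp
  show "norm_L2 ?M (weak_grad \<Omega> u) = norm_L2 lborel g"
    using norm_L2_cong_AE[OF aeg wm L2D[OF L(2)]] norm_L2_lebesgue_on_eq[OF \<Omega> H10_graph_L2(2)[OF W] z(2)]
        by simp
  have "(\<lambda>n. H1_norm \<Omega> (\<lambda>x. \<phi> n x - u x)) \<longlonglongrightarrow> 0"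
  proof (rule Lim_null_comparison[OF always_eventually])
    show "(\<lambda>n. norm_L2 lborel (\<lambda>x. grad (\<phi> n) x - g x) + norm_L2 lborel (\<lambda>x. \<phi> n x - v x)) \<longlonglongrightarrow> 0"
      using tendsto_add[OF lim(2,1)] by simp
    show "\<forall>n. norm (H1_norm \<Omega> (\<lambda>x. \<phi> n x - u x))
        \<le> norm_L2 lborel (\<lambda>x. grad (\<phi> n) x - g x) + norm_L2 lborel (\<lambda>x. \<phi> n x - v x)"
    proof
      fix n
      have Wn: "H10_graph \<Omega> (\<lambda>x. \<phi> n x - v x) (\<lambda>x. grad (\<phi> n) x - g x)"
        using H10_graph_lincomb[OF H10_graph_test_fun[OF \<phi>] W, of n "-1"] by simp
      note Ln = H10_graph_L2[OF Wn] note LM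
        = L2_lborel_imp_lebesgue_on[OF \<Omega> Ln(1)] L2_lborel_imp_lebesgue_on[OF \<Omega> Ln(2)]
      have aen: "AE x in ?M. \<phi> n x - v x = \<phi> n x - u x" using ae by eventually_elim simp
      have dL: "(\<lambda>x. \<phi> n x - u x) \<in> L2 ?M"
        by (intro L2_diff uL L2_lborel_imp_lebesgue_on[OF \<Omega>] test_fun_L2[OF \<phi>])
      let ?a = "norm_L2 ?M (\<lambda>x. grad (\<phi> n) x - g x)" and ?b = "norm_L2 ?M (\<lambda>x. \<phi> n x - u x)"
      have "(H1_norm \<Omega> (\<lambda>x. \<phi> n x - u x))\<^sup>2 = ?a\<^sup>2 + ?b\<^sup>2"
        by (rule H1_norm_eq[OF \<Omega> has_weak_gradient_cong_AE[OF \<Omega> aen L2D[OF LM(1)] H10_graph_has_weak_gradient[OF \<Omega> Wn]] LM(2) dL])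
      also have "\<dots> \<le> (?a + ?b)\<^sup>2" by (simp add: power2_sum norm_L2_nonneg)
      finally have "H1_norm \<Omega> (\<lambda>x. \<phi> n x - u x) \<le> ?a + ?b"
        by (rule power2_le_imp_le) (simp add: norm_L2_nonneg)
      also have "?b = norm_L2 ?M (\<lambda>x. \<phi> n x - v x)"
        by (rule norm_L2_cong_AE[OF aen L2D[OF LM(1)] L2D[OF dL], symmetric])
      also have "?a + norm_L2 ?M (\<lambda>x. \<phi> n x - v x)
        \<le> norm_L2 lborel (\<lambda>x. grad (\<phi> n) x - g x) + norm_L2 lborel (\<lambda>x. \<phi> n x - v x)"
        by (intro add_mono norm_L2_lebesgue_on_le[OF \<Omega>] Ln)
      finally show "norm (H1_norm \<Omega> (\<lambda>x. \<phi> n x - u x))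
        \<le> norm_L2 lborel (\<lambda>x. grad (\<phi> n) x - g x) + norm_L2 lborel (\<lambda>x. \<phi> n x - v x)"
        by (simp add: H1_norm_def)
    qed
  qed
  moreover have "u \<in> H1 \<Omega>" using uL wu L(2) unfolding H1_iff by blast
  ultimately show "u \<in> H10 \<Omega>" using \<phi> by (intro H10I[of _ _ \<phi>])
qed

lemma L2_borel_representative:
  assumes \<Omega>: "open \<Omega>" and f: "f \<in> L2 (lebesgue_on \<Omega>)"
  obtains h where "h \<in> L2 lborel" "\<And>x. x \<notin> \<Omega> \<Longrightarrow> h x = 0" "AE x in lebesgue_on \<Omega>. f x = h x"
proof -
  obtain h where h[measurable]: "h \<in> borel_measurable borel" and h0: "\<And>x. x \<notin> \<Omega> \<Longrightarrow> h x = 0"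
    and ae: "AE x in lebesgue_on \<Omega>. f x = h x"
    using lebesgue_on_borel_representative[OF \<Omega> L2D[OF f]] by blast
  have "h \<in> L2 (lebesgue_on \<Omega>)" by (rule L2_cong_AE[OF f ae borel_measurable_lebesgue_on[OF h]])
  then have "integrable lborel (\<lambda>x. indicator \<Omega> x *\<^sub>R (norm (h x))\<^sup>2)"
    by (subst integrable_lebesgue_on_iff[OF \<Omega>, symmetric]) (auto intro: L2_integrable)
  moreover have "(\<lambda>x. indicator \<Omega> x *\<^sub>R (norm (h x))\<^sup>2) = (\<lambda>x. (norm (h x))\<^sup>2)"
    using h0 by (intro ext) (auto simp: indicator_def)
  ultimately have "h \<in> L2 lborel" by (intro L2I) simp_all
  then show thesis using that h0 ae by blast
qed

text \<open>
  The approximating test functions of \<open>u\<close> converge in the graph to Borel representatives of \<open>u\<close> and of its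
  weak gradient, extended by zero.
\<close>

lemma H10_imp_graph:
  assumes \<Omega>: "open \<Omega>" and u: "u \<in> H10 \<Omega>"
  obtains v g where "H10_graph \<Omega> v g" "AE x in lebesgue_on \<Omega>. v x = u x"
proof -
  let ?M = "lebesgue_on \<Omega>"
  obtain G where G: "has_weak_gradient \<Omega> u G" "G \<in> L2 ?M"
    using H10_weak_gradientE[OF u] by blast
  note uL = H10_L2[OF u]
  obtain \<phi> where \<phi>: "\<And>n. \<phi> n \<in> test_funs \<Omega>" and lim: "(\<lambda>n. H1_norm \<Omega> (\<lambda>x. \<phi> n x - u x)) \<longlonglongrightarrow> 0"
    using H10_test_funsE[OF u] by blast
  obtain v where vL: "v \<in> L2 lborel" and v0: "\<And>x. x \<notin> \<Omega> \<Longrightarrow> v x = 0" and uv: "AE x in ?M. u x = v x"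
    using L2_borel_representative[OF \<Omega> uL] by blast
  obtain g where gL: "g \<in> L2 lborel" and g0: "\<And>x. x \<notin> \<Omega> \<Longrightarrow> g x = 0" and Gg: "AE x in ?M. G x = g x"
    using L2_borel_representative[OF \<Omega> G(2)] by blast
  have transfer: "norm_L2 lborel (\<lambda>x. \<theta> x - h x) = norm_L2 ?M (\<lambda>x. \<theta> x - f x)"
    if \<theta>: "\<theta> \<in> L2 lborel" "\<And>x. x \<notin> \<Omega> \<Longrightarrow> \<theta> x = 0" and h: "h \<in> L2 lborel" "\<And>x. x \<notin> \<Omega> \<Longrightarrow> h x = 0"
      and f: "f \<in> L2 ?M" "AE x in ?M. f x = h x" for \<theta> h f :: "'a \<Rightarrow> 'c::euclidean_space"
  proof -
    note d = L2_diff[OF \<theta>(1) h(1)]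
    have "norm_L2 lborel (\<lambda>x. \<theta> x - h x) = norm_L2 ?M (\<lambda>x. \<theta> x - h x)"
      by (intro norm_L2_lebesgue_on_eq[symmetric] \<Omega> d) (simp add: \<theta> h)
    also have "\<dots> = norm_L2 ?M (\<lambda>x. \<theta> x - f x)"
    proof (rule norm_L2_cong_AE)
      show "AE x in ?M. \<theta> x - h x = \<theta> x - f x" using f(2) by eventually_elim simp
    qed (intro L2D L2_diff L2_lborel_imp_lebesgue_on[OF \<Omega>] \<theta> h f)+
    finally show ?thesis .
  qed
  have est: "norm_L2 lborel (\<lambda>x. grad (\<phi> n) x - g x) \<le> H1_norm \<Omega> (\<lambda>x. \<phi> n x - u x)"
    "norm_L2 lborel (\<lambda>x. \<phi> n x - v x) \<le> H1_norm \<Omega> (\<lambda>x. \<phi> n x - u x)" for n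
  proof -
    note z = test_fun_zero_outside[OF \<phi>[of n]]
    have wd: "has_weak_gradient \<Omega> (\<lambda>x. \<phi> n x - u x) (\<lambda>x. grad (\<phi> n) x - G x)"
    proof -
      have P: "has_weak_gradient \<Omega> (\<phi> n) (grad (\<phi> n))"
        by (rule H10_graph_has_weak_gradient[OF \<Omega> H10_graph_test_fun[OF \<phi>]])
      show ?thesis unfolding has_weak_gradient_def
      proof (intro conjI ballI)
        show "locally_integrable \<Omega> (\<lambda>x. \<phi> n x - u x)" "locally_integrable \<Omega> (\<lambda>x. grad (\<phi> n) x - G x)"
          using P G(1) by (auto simp: has_weak_gradient_def locally_integrable_def)
        fix \<psi> and i :: 'a assume \<psi>: "\<psi> \<in> test_funs \<Omega>" and i: "i \<in> Basis"
        note p = test_fun_pderiv[OF \<psi> i]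
        note tL = L2_lborel_imp_lebesgue_on[OF \<Omega> test_fun_L2]
        have i1: "integrable ?M (\<lambda>x. \<phi> n x * frechet_derivative \<psi> (at x) i)"
          "integrable ?M (\<lambda>x. u x * frechet_derivative \<psi> (at x) i)"
          by (intro L2_mult_integrable tL[OF \<phi>] tL[OF p] uL)+
        have "(\<lambda>x. \<psi> x *\<^sub>R i) \<in> L2 ?M"
          using L2_integrable[OF tL[OF \<psi>]] L2D[OF tL[OF \<psi>]] i by (intro L2I) (simp_all add: power_mult_distrib)
        from L2_inner[OF L2_lborel_imp_lebesgue_on[OF \<Omega> grad_L2[OF \<phi>[of n]]] this] L2_inner[OF G(2) this]
        have i2: "integrable ?M (\<lambda>x. (grad (\<phi> n) x \<bullet> i) * \<psi> x)" "integrable ?M (\<lambda>x. (G x \<bullet> i) * \<psi> x)"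
          by (simp_all add: mult.commute)
        show "(LINT x|?M. (\<phi> n x - u x) * frechet_derivative \<psi> (at x) i) =
            - (LINT x|?M. ((grad (\<phi> n) x - G x) \<bullet> i) * \<psi> x)"
          using P G(1) \<psi> i i1 i2 unfolding has_weak_gradient_def
          by (simp add: left_diff_distrib inner_diff_left)
      qed
    qed
    have L: "(\<lambda>x. grad (\<phi> n) x - G x) \<in> L2 ?M" "(\<lambda>x. \<phi> n x - u x) \<in> L2 ?M"
      by (intro L2_diff L2_lborel_imp_lebesgue_on[OF \<Omega>] grad_L2[OF \<phi>] test_fun_L2[OF \<phi>] G uL)+
    have sq: "(H1_norm \<Omega> (\<lambda>x. \<phi> n x - u x))\<^sup>2
        = (norm_L2 lborel (\<lambda>x. grad (\<phi> n) x - g x))\<^sup>2 + (norm_L2 lborel (\<lambda>x. \<phi> n x - v x))\<^sup>2"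
    proof -
      have "norm_L2 lborel (\<lambda>x. grad (\<phi> n) x - g x) = norm_L2 ?M (\<lambda>x. grad (\<phi> n) x - G x)"
        by (rule transfer[OF grad_L2[OF \<phi>] z(2) gL g0 G(2) Gg])
      moreover have "norm_L2 lborel (\<lambda>x. \<phi> n x - v x) = norm_L2 ?M (\<lambda>x. \<phi> n x - u x)"
        by (rule transfer[OF test_fun_L2[OF \<phi>] z(1) vL v0 uL uv])
      ultimately show ?thesis using H1_norm_eq[OF \<Omega> wd L] by (simp only:)
    qed
    have nn: "0 \<le> H1_norm \<Omega> (\<lambda>x. \<phi> n x - u x)" by (simp add: H1_norm_def)
    show "norm_L2 lborel (\<lambda>x. grad (\<phi> n) x - g x) \<le> H1_norm \<Omega> (\<lambda>x. \<phi> n x - u x)"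
      "norm_L2 lborel (\<lambda>x. \<phi> n x - v x) \<le> H1_norm \<Omega> (\<lambda>x. \<phi> n x - u x)"
      by (rule power2_le_imp_le[OF _ nn]; simp add: sq)+
  qed
  have "H10_graph \<Omega> v g"
    unfolding H10_graph_def
  proof (intro conjI exI[of _ \<phi>] allI \<phi> vL gL)
    show "(\<lambda>n. norm_L2 lborel (\<lambda>x. \<phi> n x - v x)) \<longlonglongrightarrow> 0" "(\<lambda>n. norm_L2 lborel (\<lambda>x. grad (\<phi> n) x - g x)) \<longlonglongrightarrow> 0"
      by (rule Lim_null_comparison[OF always_eventually lim], simp add: est norm_L2_nonneg)+
  qed
  moreover have "AE x in ?M. v x = u x" using uv by eventually_elim simp
  ultimately show thesis using that by blast
qed

section \<open>Lower semicontinuity of the Dirichlet energy; absolute values\<close>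

lemma H10_graph_scale: assumes "H10_graph \<Omega> u g" shows "H10_graph \<Omega> (\<lambda>x. c * u x) (\<lambda>x. c *\<^sub>R g x)"
  using H10_graph_lincomb[OF assms assms, of "c - 1"] by (simp add: algebra_simps)

lemma norm_L2_parallelogram:
  assumes "f \<in> L2 M" "g \<in> L2 M"
  shows "(norm_L2 M (\<lambda>x. f x - g x))\<^sup>2 + (norm_L2 M (\<lambda>x. f x + g x))\<^sup>2
    = 2 * (norm_L2 M f)\<^sup>2 + 2 * (norm_L2 M g)\<^sup>2"
proof -
  have "(norm_L2 M (\<lambda>x. f x - g x))\<^sup>2 + (norm_L2 M (\<lambda>x. f x + g x))\<^sup>2
      = (LINT x|M. (norm (f x - g x))\<^sup>2 + (norm (f x + g x))\<^sup>2)"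
    using L2_integrable[OF L2_diff[OF assms]] L2_integrable[OF L2_add[OF assms]] by (simp add: norm_L2_sq)
  also have "\<dots> = (LINT x|M. 2 * (norm (f x))\<^sup>2 + 2 * (norm (g x))\<^sup>2)"
    by (intro Bochner_Integration.integral_cong refl)
       (simp add: power2_norm_eq_inner inner_diff inner_add inner_commute)
  also have "\<dots> = 2 * (norm_L2 M f)\<^sup>2 + 2 * (norm_L2 M g)\<^sup>2"
    using assms by (simp add: norm_L2_sq L2_integrable)
  finally show ?thesis .
qed

text \<open>
  Lower semicontinuity of the Dirichlet energy under \<open>L\<^sup>2\<close> convergence. Choose \<open>(w k, \<gamma> k)\<close> that nearly
  minimises the norm of the gradient among the elements of the graph within \<open>1 / (k + 1)\<close> of \<open>v\<close>. The midpoint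
  of two such choices is again admissible, so the parallelogram law makes \<open>\<gamma>\<close> a Cauchy sequence; its limit is
  the gradient of \<open>v\<close>, and its norm is a limit of infima that are at most \<open>a\<close>.
\<close>

lemma H10_graph_weak_limit:
  assumes W: "\<And>n. H10_graph \<Omega> (u n) (g n)" and v: "v \<in> L2 lborel"
    and lim: "(\<lambda>n. norm_L2 lborel (\<lambda>x. u n x - v x)) \<longlonglongrightarrow> 0"
    and b: "\<And>n. norm_L2 lborel (g n) \<le> b n" "b \<longlonglongrightarrow> a"
  obtains h where "H10_graph \<Omega> v h" "norm_L2 lborel h \<le> a"
proof -
  define V where "V e = {norm_L2 lborel \<gamma> | w \<gamma>. H10_graph \<Omega> w \<gamma> \<and> norm_L2 lborel (\<lambda>x. w x - v x) \<le> e}" for e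
  define d where "d k = Inf (V (inverse (real (Suc k))))" for k
  have bdd: "bdd_below (V e)" for e
    by (rule bdd_belowI[of _ 0]) (auto simp: V_def norm_L2_nonneg)
  have near: "\<exists>y\<in>V e. y < a + t" if "e > 0" "t > 0" for e t
  proof -
    have "\<forall>\<^sub>F n in sequentially. norm_L2 lborel (\<lambda>x. u n x - v x) < e \<and> b n < a + t"
      using order_tendstoD(2)[OF lim that(1)] order_tendstoD(2)[OF b(2), of "a + t"] that(2)
      by (auto elim: eventually_elim2)
    from eventually_happens'[OF sequentially_bot this]
    obtain n where "norm_L2 lborel (\<lambda>x. u n x - v x) < e" "b n < a + t" by blast
    then have "norm_L2 lborel (g n) \<in> V e" "norm_L2 lborel (g n) < a + t"
      using W[of n] b(1)[of n] unfolding V_def by (blast intro: less_imp_le, linarith)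
    then show ?thesis by blast
  qed
  have ne: "V e \<noteq> {}" if "e > 0" for e using near[OF that, of 1] by auto
  have d_le: "d k \<le> a" for k
  proof (rule field_le_epsilon)
    fix t :: real assume "t > 0"
    then obtain y where "y \<in> V (inverse (real (Suc k)))" "y < a + t"
        using near[of "inverse (real (Suc k))" t] by auto
    then show "d k \<le> a + t" unfolding d_def using cInf_lower[OF _ bdd] by fastforce
  qed
  have "incseq d"
  proof (rule incseq_SucI)
    fix k
    have "V (inverse (real (Suc (Suc k)))) \<subseteq> V (inverse (real (Suc k)))"
    proof -
      have "inverse (real (Suc (Suc k))) \<le> inverse (real (Suc k))" by (intro le_imp_inverse_le) auto
      then show ?thesis unfolding V_def using order_trans by blast
    qed
    then show "d k \<le> d (Suc k)" unfolding d_def by (intro cInf_superset_mono ne bdd) auto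
  qed
  then obtain D where D: "d \<longlonglongrightarrow> D" using incseq_convergent[of d a] d_le by metis
  have "D \<le> a" using LIMSEQ_le_const2[OF D] d_le by blast
  have d0: "d k \<ge> 0" for k unfolding d_def
    by (intro cInf_greatest ne) (auto simp: V_def norm_L2_nonneg)
  have "\<exists>w \<gamma>. H10_graph \<Omega> w \<gamma> \<and> norm_L2 lborel (\<lambda>x. w x - v x)
    \<le> inverse (real (Suc k)) \<and> norm_L2 lborel \<gamma> < d k + inverse (real (Suc k))" for k
  proof -
    have "\<exists>y\<in>V (inverse (real (Suc k))). y < d k + inverse (real (Suc k))"
      unfolding d_def using cInf_lessD[OF ne, of "inverse (real (Suc k))"]
      by (metis inverse_positive_iff_positive less_add_same_cancel1 of_nat_0_less_iff zero_less_Suc)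
    then show ?thesis by (auto simp: V_def)
  qed
  then obtain w \<gamma> where w\<gamma>: "\<And>k. H10_graph \<Omega> (w k) (\<gamma> k)" "\<And>k. norm_L2 lborel (\<lambda>x. w k x - v x)
    \<le> inverse (real (Suc k))"
    "\<And>k. norm_L2 lborel (\<gamma> k) < d k + inverse (real (Suc k))" by metis
  note Lw = H10_graph_L2(1)[OF w\<gamma>(1)] and L\<gamma> = H10_graph_L2(2)[OF w\<gamma>(1)]
  \<comment> \<open>The midpoint is admissible for the larger of the two distances, so its gradient norm is at least \<open>d k\<close>.\<close>
  have mid: "2 * d k \<le> norm_L2 lborel (\<lambda>x. \<gamma> k x + \<gamma> j x)" if "k \<le> j" for k j
  proof -
    have W': "H10_graph \<Omega> (\<lambda>x. (1/2) * w k x + (1/2) * w j x) (\<lambda>x. (1/2) *\<^sub>R \<gamma> k x + (1/2) *\<^sub>R \<gamma> j x)"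
      by (intro H10_graph_lincomb H10_graph_scale w\<gamma>)
    have "norm_L2 lborel (\<lambda>x. ((1/2) *\<^sub>R (w k x - v x)) + (1/2) *\<^sub>R (w j x - v x)) \<le>
        norm_L2 lborel (\<lambda>x. (1/2) *\<^sub>R (w k x - v x)) + norm_L2 lborel (\<lambda>x. (1/2) *\<^sub>R (w j x - v x))"
      by (intro norm_L2_triangle L2_scaleR L2_diff Lw v)
    also have "\<dots> = (norm_L2 lborel (\<lambda>x. w k x - v x) + norm_L2 lborel (\<lambda>x. w j x - v x)) / 2"
      unfolding norm_L2_scaleR by simp
    also have "\<dots> \<le> inverse (real (Suc k))"
    proof -
      have "inverse (real (Suc j)) \<le> inverse (real (Suc k))" using that by (intro le_imp_inverse_le) auto
      moreover have "(A + B) / 2 \<le> r" if "A \<le> r" "B \<le> t" "t \<le> r" for A B r t :: real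
        using that by simp
      ultimately show ?thesis using w\<gamma>(2) by blast
    qed
    also have "(\<lambda>x. ((1/2) *\<^sub>R (w k x - v x)) + (1/2) *\<^sub>R (w j x - v x))
        = (\<lambda>x. ((1/2) * w k x + (1/2) * w j x) - v x)"
      by (intro ext) (simp add: field_simps)
    finally have "norm_L2 lborel (\<lambda>x. ((1/2) * w k x + (1/2) * w j x) - v x) \<le> inverse (real (Suc k))" .
    then have "norm_L2 lborel (\<lambda>x. (1/2) *\<^sub>R \<gamma> k x + (1/2) *\<^sub>R \<gamma> j x) \<in> V (inverse (real (Suc k)))"
      using W' unfolding V_def by blast
    then have "d k \<le> norm_L2 lborel (\<lambda>x. (1/2) *\<^sub>R \<gamma> k x + (1/2) *\<^sub>R \<gamma> j x)"
      unfolding d_def by (intro cInf_lower bdd)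
    also have "(\<lambda>x. (1/2) *\<^sub>R \<gamma> k x + (1/2) *\<^sub>R \<gamma> j x) = (\<lambda>x. (1/2) *\<^sub>R (\<gamma> k x + \<gamma> j x))"
      by (simp add: scaleR_add_right)
    finally show ?thesis unfolding norm_L2_scaleR by simp
  qed
  have key: "(norm_L2 lborel (\<lambda>x. \<gamma> k x - \<gamma> j x))\<^sup>2 \<le>
      2 * (d k + inverse (real (Suc k)))\<^sup>2 + 2 * (d j + inverse (real (Suc j)))\<^sup>2 - 4 * (d k)\<^sup>2" if "k
        \<le> j" for k j
  proof -
    have "(2 * d k)\<^sup>2 \<le> (norm_L2 lborel (\<lambda>x. \<gamma> k x + \<gamma> j x))\<^sup>2"
      using mid[OF that] d0[of k] by (intro power_mono) auto
    moreover have "(norm_L2 lborel (\<gamma> i))\<^sup>2 \<le> (d i + inverse (real (Suc i)))\<^sup>2" for i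
      by (intro power_mono norm_L2_nonneg less_imp_le w\<gamma>)
    ultimately show ?thesis
      using norm_L2_parallelogram[OF L\<gamma> L\<gamma>, of k j] by (simp add: power_mult_distrib) (smt (verit))
  qed
  have limA: "(\<lambda>k. (d k + inverse (real (Suc k)))\<^sup>2) \<longlonglongrightarrow> D\<^sup>2"
    using tendsto_power[OF tendsto_add[OF D LIMSEQ_inverse_real_of_nat], of 2] by simp
  have limB: "(\<lambda>k. (d k)\<^sup>2) \<longlonglongrightarrow> D\<^sup>2" by (intro tendsto_power D)
  have "\<exists>h\<in>L2 lborel. (\<lambda>n. norm_L2 lborel (\<lambda>x. \<gamma> n x - h x)) \<longlonglongrightarrow> 0"
  proof (rule L2_complete[OF L\<gamma>])
    fix e :: real assume e: "e > 0"
    have "\<forall>\<^sub>F k in sequentially. (d k + inverse (real (Suc k)))\<^sup>2 < D\<^sup>2 + e\<^sup>2 / 8 \<and> (d k)\<^sup>2 > D\<^sup>2 - e\<^sup>2 / 8"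
      using order_tendstoD(2)[OF limA, of "D\<^sup>2 + e\<^sup>2 / 8"] order_tendstoD(1)[OF limB, of "D\<^sup>2 - e\<^sup>2 / 8"] e
      by (auto elim: eventually_elim2)
    then obtain N where N: "\<And>k. k \<ge> N \<Longrightarrow> (d k + inverse (real (Suc k)))\<^sup>2 < D\<^sup>2 + e\<^sup>2 / 8"
      "\<And>k. k \<ge> N \<Longrightarrow> (d k)\<^sup>2 > D\<^sup>2 - e\<^sup>2 / 8"
      unfolding eventually_sequentially by blast
    have *: "norm_L2 lborel (\<lambda>x. \<gamma> k x - \<gamma> j x) < e" if "N \<le> k" "k \<le> j" for k j
    proof (rule power2_less_imp_less)
      show "(norm_L2 lborel (\<lambda>x. \<gamma> k x - \<gamma> j x))\<^sup>2 < e\<^sup>2"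
        using key[OF that(2)] N(1)[OF that(1)] N(2)[OF that(1)] N(1)[of j] that by linarith
    qed (use e in simp)
    show "\<exists>N. \<forall>m\<ge>N. \<forall>n\<ge>N. norm_L2 lborel (\<lambda>x. \<gamma> m x - \<gamma> n x) < e"
    proof (intro exI allI impI)
      fix m n assume "N \<le> m" "N \<le> n"
      then show "norm_L2 lborel (\<lambda>x. \<gamma> m x - \<gamma> n x) < e"
        using *[of m n] *[of n m] norm_L2_diff_commute[of lborel "\<gamma> m" "\<gamma> n"] by (cases "m \<le> n") auto
    qed
  qed
  then obtain h where h: "h \<in> L2 lborel" "(\<lambda>n. norm_L2 lborel (\<lambda>x. \<gamma> n x - h x)) \<longlonglongrightarrow> 0" by blast
  have "H10_graph \<Omega> v h"
  proof (rule H10_graph_closed[OF w\<gamma>(1) v h(1) _ h(2)])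
    show "(\<lambda>n. norm_L2 lborel (\<lambda>x. w n x - v x)) \<longlonglongrightarrow> 0"
      by (rule Lim_null_comparison[OF always_eventually LIMSEQ_inverse_real_of_nat])
         (simp add: w\<gamma>(2) norm_L2_nonneg del: of_nat_Suc)
  qed
  moreover have "norm_L2 lborel h \<le> a"
  proof -
    have "(\<lambda>n. norm_L2 lborel (\<gamma> n)) \<longlonglongrightarrow> norm_L2 lborel h" by (rule norm_L2_tendsto[OF L\<gamma> h])
    moreover have "(\<lambda>n. d n + inverse (real (Suc n))) \<longlonglongrightarrow> D + 0"
      by (intro tendsto_add D LIMSEQ_inverse_real_of_nat)
    ultimately have "norm_L2 lborel h \<le> D + 0"
      by (rule LIMSEQ_le) (use w\<gamma>(3) in \<open>auto intro: less_imp_le\<close>)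
    then show ?thesis using \<open>D \<le> a\<close> by simp
  qed
  ultimately show thesis using that by blast
qed

lemma Cdiff_powr_quadratic:
  assumes "e > 0"
  shows "Cdiff n (\<lambda>s::real. (s\<^sup>2 + e\<^sup>2) powr a)"
proof (induction n arbitrary: a)
  have pos: "s\<^sup>2 + e\<^sup>2 > 0" for s using assms by (simp add: add_nonneg_pos)
  have D: "((\<lambda>s. (s\<^sup>2 + e\<^sup>2) powr a) has_real_derivative 2 * a * s * (s\<^sup>2 + e\<^sup>2) powr (a - 1)) (at s)" for a s
    using pos[of s] by (auto intro!: derivative_eq_intros simp: field_simps powr_diff)
  {
    case 0
    then show ?case using D by (auto simp: real_differentiable_def)
  next
    case (Suc n)
    have "Cdiff n (\<lambda>s. (2 * a) * (s \<bullet> 1) * (s\<^sup>2 + e\<^sup>2) powr (a - 1))"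
      by (intro Cdiff_mult Cdiff_const Cdiff_inner Suc.IH)
    then show ?case by (intro Cdiff_realI[OF D]) simp
  }
qed

text \<open>
  With \<open>r = sqrt (s\<^sup>2 + e\<^sup>2)\<close>, the number \<open>\<bar>s\<bar> + e - r\<close> is non-negative and at most \<open>e\<close> as well as \<open>\<bar>s\<bar>\<close>.
  A bound that is linear in \<open>\<bar>s\<bar>\<close> is integrable after inserting a test function.
\<close>

lemma smooth_abs_bounds:
  fixes s e :: real
  assumes "e > 0"
  shows "(sqrt (s\<^sup>2 + e\<^sup>2) - e - \<bar>s\<bar>)\<^sup>2 \<le> e * \<bar>s\<bar>"
proof -
  define r where "r = sqrt (s\<^sup>2 + e\<^sup>2)"
  have r: "r \<le> \<bar>s\<bar> + e" "r \<ge> e" "r \<ge> \<bar>s\<bar>"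
    unfolding r_def using assms by (auto intro!: real_le_lsqrt real_le_rsqrt simp: power2_sum)
  have "(\<bar>s\<bar> + e - r)\<^sup>2 = (\<bar>s\<bar> + e - r) * (\<bar>s\<bar> + e - r)" by (simp add: power2_eq_square)
  also have "\<dots> \<le> e * \<bar>s\<bar>" by (intro mult_mono) (use r assms in auto)
  also have "(\<bar>s\<bar> + e - r)\<^sup>2 = (r - e - \<bar>s\<bar>)\<^sup>2" by (simp add: power2_eq_square algebra_simps)
  finally show ?thesis by (simp add: r_def)
qed

text \<open>
  The smooth approximation of the absolute value vanishes at \<open>0\<close> and has slope at most \<open>1\<close>.
\<close>

lemma smooth_abs_test_fun:
  assumes \<phi>: "\<phi> \<in> test_funs \<Omega>" and e: "e > 0"
  defines "\<psi> \<equiv> \<lambda>x. sqrt ((\<phi> x)\<^sup>2 + e\<^sup>2) - e"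
  shows "\<psi> \<in> test_funs \<Omega>" "norm (grad \<psi> x) \<le> norm (grad \<phi> x)"
proof -
  have pos: "s\<^sup>2 + e\<^sup>2 > 0" for s using e by (simp add: add_nonneg_pos)
  have "Cdiff n (\<lambda>s::real. (s\<^sup>2 + e\<^sup>2) powr (1/2) + (- e))" for n
    by (intro Cdiff_add Cdiff_const Cdiff_powr_quadratic e)
  then have C: "Cdiff n (\<lambda>s::real. sqrt (s\<^sup>2 + e\<^sup>2) - e)" for n
    using pos by (simp add: powr_half_sqrt less_imp_le)
  show t: "\<psi> \<in> test_funs \<Omega>"
    unfolding \<psi>_def by (rule test_fun_compose[OF \<phi> C]) (use e in simp)
  define c where "c = \<phi> x / sqrt ((\<phi> x)\<^sup>2 + e\<^sup>2)"
  have Fd: "((\<lambda>s. sqrt (s\<^sup>2 + e\<^sup>2) - e) has_derivative (\<lambda>h. c * h)) (at (\<phi> x))"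
    using pos[of "\<phi> x"] unfolding has_field_derivative_def[symmetric] c_def
    by (auto intro!: derivative_eq_intros simp: field_simps)
  have "grad \<psi> x = c *\<^sub>R grad \<phi> x"
    by (rule grad_eqI)
       (use diff_chain_at[OF test_fun_has_derivative[OF \<phi>] Fd] in \<open>simp add: \<psi>_def o_def\<close>)
  moreover have "\<bar>c\<bar> \<le> 1"
  proof -
    have "\<bar>\<phi> x\<bar> \<le> sqrt ((\<phi> x)\<^sup>2 + e\<^sup>2)" by (rule real_le_rsqrt) simp
    then show ?thesis using pos[of "\<phi> x"] by (simp add: c_def abs_divide)
  qed
  ultimately show "norm (grad \<psi> x) \<le> norm (grad \<phi> x)"
    by (simp add: mult_left_le_one_le)
qed

lemma norm_L2_mono:
  assumes "f \<in> L2 M" "g \<in> L2 M" "\<And>x. norm (f x) \<le> norm (g x)"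
  shows "norm_L2 M f \<le> norm_L2 M g"
  unfolding norm_L2_def using assms
  by (intro real_sqrt_le_mono integral_mono power_mono) (auto simp: L2_integrable)

text \<open>
  Smooth approximations of \<open>\<bar>\<phi> n\<bar>\<close> have gradients no larger than those of \<open>\<phi> n\<close>, so lower semicontinuity applies
  to them.
\<close>

lemma H10_graph_abs:
  assumes W: "H10_graph \<Omega> u g"
  obtains h where "H10_graph \<Omega> (\<lambda>x. \<bar>u x\<bar>) h" "norm_L2 lborel h \<le> norm_L2 lborel g"
proof -
  obtain \<phi> where \<phi>: "\<And>n. \<phi> n \<in> test_funs \<Omega>"
    and lim: "(\<lambda>n. norm_L2 lborel (\<lambda>x. \<phi> n x - u x)) \<longlonglongrightarrow> 0" "(\<lambda>n. norm_L2 lborel (\<lambda>x. grad (\<phi> n) x - g x)) \<longlonglongrightarrow> 0"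
    using W unfolding H10_graph_def by blast
  define I where "I n = (LINT x|lborel. \<bar>\<phi> n x\<bar>) + 1" for n
  have I: "I n > 0" for n unfolding I_def by (simp add: add_nonneg_pos)
  define e where "e n = inverse (real (Suc n)) / I n" for n
  have e: "e n > 0" for n using I by (simp add: e_def)
  define \<psi> where "\<psi> n x = sqrt ((\<phi> n x)\<^sup>2 + (e n)\<^sup>2) - e n" for n x
  have \<psi>: "\<psi> n \<in> test_funs \<Omega>" "norm (grad (\<psi> n) x) \<le> norm (grad (\<phi> n) x)" for n x
    unfolding \<psi>_def by (rule smooth_abs_test_fun[OF \<phi> e])+
  note L\<phi> = test_fun_L2[OF \<phi>] and L\<psi> = test_fun_L2[OF \<psi>(1)]
  have La: "(\<lambda>x. \<bar>f x\<bar>) \<in> L2 lborel" if "f \<in> L2 lborel" for f :: "'a \<Rightarrow> real" using L2_norm[OF that] by simp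
  have near: "(norm_L2 lborel (\<lambda>x. \<psi> n x - \<bar>\<phi> n x\<bar>))\<^sup>2 \<le> inverse (real (Suc n))" for n
  proof -
    have "(norm_L2 lborel (\<lambda>x. \<psi> n x - \<bar>\<phi> n x\<bar>))\<^sup>2 \<le> (LINT x|lborel. e n * \<bar>\<phi> n x\<bar>)"
      unfolding norm_L2_sq
    proof (rule integral_mono)
      show "integrable lborel (\<lambda>x. (norm (\<psi> n x - \<bar>\<phi> n x\<bar>))\<^sup>2)"
        by (intro L2_integrable L2_diff L\<psi> La L\<phi>)
      show "integrable lborel (\<lambda>x. e n * \<bar>\<phi> n x\<bar>)" using test_fun_integrable[OF \<phi>] by simp
    qed (use smooth_abs_bounds[OF e] in \<open>simp add: \<psi>_def\<close>)
    also have "\<dots> \<le> e n * I n" using e[of n] by (simp add: I_def)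
    also have "\<dots> = inverse (real (Suc n))" using I[of n] by (simp add: e_def)
    finally show ?thesis .
  qed
  have lim\<psi>: "(\<lambda>n. norm_L2 lborel (\<lambda>x. \<psi> n x - \<bar>u x\<bar>)) \<longlonglongrightarrow> 0"
  proof (rule Lim_null_comparison[OF always_eventually])
    show "(\<lambda>n. sqrt (inverse (real (Suc n))) + norm_L2 lborel (\<lambda>x. \<phi> n x - u x)) \<longlonglongrightarrow> 0"
      using tendsto_add[OF tendsto_real_sqrt[OF LIMSEQ_inverse_real_of_nat] lim(1)] by simp
    show "\<forall>n. norm (norm_L2 lborel (\<lambda>x. \<psi> n x - \<bar>u x\<bar>))
        \<le> sqrt (inverse (real (Suc n))) + norm_L2 lborel (\<lambda>x. \<phi> n x - u x)"
    proof
      fix n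
      have "norm_L2 lborel (\<lambda>x. \<psi> n x - \<bar>u x\<bar>)
        \<le> norm_L2 lborel (\<lambda>x. \<psi> n x - \<bar>\<phi> n x\<bar>) + norm_L2 lborel (\<lambda>x. \<bar>\<phi> n x\<bar> - \<bar>u x\<bar>)"
        by (intro norm_L2_triangle_diff L\<psi> La L\<phi> H10_graph_L2[OF W])
      moreover have "norm_L2 lborel (\<lambda>x. \<psi> n x - \<bar>\<phi> n x\<bar>) \<le> sqrt (inverse (real (Suc n)))"
        using near by (rule real_le_rsqrt)
      moreover have "norm_L2 lborel (\<lambda>x. \<bar>\<phi> n x\<bar> - \<bar>u x\<bar>) \<le> norm_L2 lborel (\<lambda>x. \<phi> n x - u x)"
        by (intro norm_L2_mono L2_diff La L\<phi> H10_graph_L2[OF W]) (simp add: abs_triangle_ineq3)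
      ultimately show "norm (norm_L2 lborel (\<lambda>x. \<psi> n x - \<bar>u x\<bar>))
        \<le> sqrt (inverse (real (Suc n))) + norm_L2 lborel (\<lambda>x. \<phi> n x - u x)"
        by (simp add: norm_L2_nonneg)
    qed
  qed
  show thesis
  proof (rule H10_graph_weak_limit[OF H10_graph_test_fun[OF \<psi>(1)] La[OF H10_graph_L2(1)[OF W]] lim\<psi>])
    show "norm_L2 lborel (grad (\<psi> n)) \<le> norm_L2 lborel (grad (\<phi> n))" for n
      by (intro norm_L2_mono grad_L2[OF \<phi>] grad_L2[OF \<psi>(1)] \<psi>(2))
    show "(\<lambda>n. norm_L2 lborel (grad (\<phi> n))) \<longlonglongrightarrow> norm_L2 lborel g"
      by (rule norm_L2_tendsto[OF grad_L2[OF \<phi>] H10_graph_L2(2)[OF W] lim(2)])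
  qed (rule that)
qed

section \<open>Averages over cubes\<close>

text \<open>
  The mean of \<open>u\<close> over the cube of side \<open>s\<close> whose lower corner is \<open>y\<close>.
\<close>

definition cube_avg :: "real \<Rightarrow> ('a::euclidean_space \<Rightarrow> real) \<Rightarrow> 'a \<Rightarrow> real" where
  "cube_avg s u y = (LINT z|lborel. indicator (cbox 0 (s *\<^sub>R One)) z * u (y + z)) / s ^ DIM('a)"

lemma measure_cube: 
  "s \<ge> 0 \<Longrightarrow> measure lborel (cbox (a *\<^sub>R One) ((a + s) *\<^sub>R One) :: 'a::euclidean_space set) = s ^ DIM('a)"
  by (simp add: measure_lborel_cbox_eq inner_diff_left algebra_simps)

lemma integrable_indicator_cbox: "integrable lborel (\<lambda>x. indicator (cbox a b) x :: real)"
  by (rule integrable_real_indicator) (auto simp: emeasure_lborel_cbox_eq)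

lemma norm_indicator_sq: "(norm (indicator A z :: real))\<^sup>2 = indicator A z"
  by (simp add: indicator_def)

lemma L2_indicator_cbox: "(\<lambda>z. indicator (cbox a b) z :: real) \<in> L2 lborel"
  by (rule L2I) (simp_all only: norm_indicator_sq integrable_indicator_cbox, simp)

lemma cube_avg_integrable:
  fixes u :: "'a::euclidean_space \<Rightarrow> real"
  assumes "u \<in> L2 lborel"
  shows "integrable lborel (\<lambda>z. indicator (cbox a b) z * u (y + z))"
  using L2_mult_integrable[OF L2_indicator_cbox L2_translate[OF assms, of y]] by (simp add: add.commute)

lemma norm_L2_indicator_cube:
  assumes "s \<ge> 0"
  shows "(norm_L2 lborel (\<lambda>z::'a::euclidean_space. indicator (cbox 0 (s *\<^sub>R One)) z :: real))\<^sup>2 = s ^ DIM('a)"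
  unfolding norm_L2_sq norm_indicator_sq using measure_cube[OF assms, of 0, where 'a = 'a] by simp

lemma cube_avg_measurable [measurable]:
  fixes u :: "'a::euclidean_space \<Rightarrow> real"
  assumes [measurable]: "u \<in> borel_measurable borel"
  shows "cube_avg s u \<in> borel_measurable borel"
proof -
  have "(\<lambda>y. LINT z|lborel. indicator (cbox 0 (s *\<^sub>R One)) z * u (y + z)) \<in> borel_measurable borel"
    by measurable
  then show ?thesis unfolding cube_avg_def[abs_def] by measurable
qed

lemma cube_avg_abs_le:
  fixes u :: "'a::euclidean_space \<Rightarrow> real"
  assumes u: "u \<in> L2 lborel" and s: "s > 0"
  shows "\<bar>cube_avg s u y\<bar> \<le> sqrt (s ^ DIM('a)) * norm_L2 lborel u / s ^ DIM('a)"
proof -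
  have "\<bar>LINT z|lborel. indicator (cbox 0 (s *\<^sub>R One)) z \<bullet> u (z + y)\<bar> \<le>
      norm_L2 lborel (\<lambda>z::'a. indicator (cbox 0 (s *\<^sub>R One)) z :: real) * norm_L2 lborel (\<lambda>z. u (z + y))"
    by (intro L2_Cauchy_Schwarz L2_indicator_cbox L2_translate u)
  also have "\<dots> = sqrt (s ^ DIM('a)) * norm_L2 lborel u"
    using norm_L2_indicator_cube[of s, where 'a = 'a] s norm_L2_translate[OF u] norm_L2_nonneg
    by (metis less_imp_le real_sqrt_unique)
  finally show ?thesis using s by (simp add: cube_avg_def abs_divide divide_right_mono add.commute)
qed

text \<open>
  By the Cauchy-Schwarz inequality the square of the difference is at most the mean over the cube of
  \<open>(u (y + z) - u x)\<^sup>2\<close>. Substituting \<open>w = y + z - x\<close> gives a bound that does not depend on \<open>y\<close>, since the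
  coordinates of \<open>w\<close> stay between \<open>- s\<close> and \<open>2 * s\<close>.
\<close>

lemma cube_avg_pointwise_estimate:
  fixes u :: "'a::euclidean_space \<Rightarrow> real"
  assumes u: "u \<in> L2 lborel" and s: "s > 0" and xy: "\<And>i. i \<in> Basis \<Longrightarrow> \<bar>(y - x) \<bullet> i\<bar> \<le> s"
  shows "ennreal ((u x - cube_avg s u y)\<^sup>2) \<le>
    ennreal (1 / s ^ DIM('a)) * (\<integral>\<^sup>+w. indicator (cbox ((-s) *\<^sub>R One) ((2 * s) *\<^sub>R One)) w * ennreal ((u (x
        + w) - u x)\<^sup>2) \<partial>lborel)"
proof -
  let ?N = "s ^ DIM('a)" and ?B = "cbox 0 (s *\<^sub>R One) :: 'a set"
  have [measurable]: "u \<in> borel_measurable borel" using L2D[OF u] by simp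
  have N: "?N > 0" using s by simp
  note LB = L2_indicator_cbox[of "0::'a" "s *\<^sub>R One"]
  define f where "f z = indicator ?B z * (u (y + z) - u x)" for z
  have fL: "f \<in> L2 lborel"
  proof -
    have 1: "(\<lambda>z. indicator ?B z * u (y + z)) \<in> L2 lborel"
    proof (rule L2I)
      have "integrable lborel (\<lambda>z. (u (z + y))\<^sup>2)" using L2_integrable[OF L2_translate[OF u, of y]] by simp
      from integrable_mult_indicator[OF _ this, of ?B]
      moreover have "(norm (indicator ?B z * u (y + z)))\<^sup>2 = indicator ?B z *\<^sub>R (u (z + y))\<^sup>2" for z
        by (cases "z \<in> ?B") (simp_all add: add.commute)
      ultimately show "integrable lborel (\<lambda>z. (norm (indicator ?B z * u (y + z)))\<^sup>2)"
        by (simp only:) simp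
    qed measurable
    have "(\<lambda>z. indicator ?B z * u (y + z) + (- u x) * indicator ?B z) \<in> L2 lborel"
      by (intro L2_add 1 L2_mult LB)
    then show ?thesis unfolding f_def by (simp add: algebra_simps)
  qed
  have cube_avg_eq: "cube_avg s u y - u x = (LINT z|lborel. indicator ?B z \<bullet> f z) / ?N"
  proof -
    have "(LINT z|lborel. indicator ?B z \<bullet> f z)
        = (LINT z|lborel. indicator ?B z * u (y + z) - u x * indicator ?B z)"
      by (intro Bochner_Integration.integral_cong refl) (auto simp: f_def indicator_def algebra_simps)
    also have "\<dots> = (LINT z|lborel. indicator ?B z * u (y + z)) - u x * ?N"
      using cube_avg_integrable[OF u] integrable_indicator_cbox measure_cube[of s 0, where 'a='a] s by simp
    finally show ?thesis using s by (simp add: cube_avg_def diff_divide_distrib)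
  qed
  have "(LINT z|lborel. indicator ?B z \<bullet> f z)\<^sup>2 \<le> ?N * (norm_L2 lborel f)\<^sup>2"
  proof -
    have "\<bar>LINT z|lborel. indicator ?B z \<bullet> f z\<bar>\<^sup>2
        \<le> (norm_L2 lborel (\<lambda>z::'a. indicator ?B z :: real) * norm_L2 lborel f)\<^sup>2"
      by (intro power_mono L2_Cauchy_Schwarz LB fL) simp
    then show ?thesis using norm_L2_indicator_cube[of s, where 'a='a] s by (simp add: power_mult_distrib)
  qed
  then have "(cube_avg s u y - u x)\<^sup>2 \<le> (?N * (norm_L2 lborel f)\<^sup>2) / ?N\<^sup>2"
    unfolding cube_avg_eq power_divide by (intro divide_right_mono) auto
  then have "(u x - cube_avg s u y)\<^sup>2 \<le> (1 / ?N) * (norm_L2 lborel f)\<^sup>2"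
    using s by (simp add: power2_commute power2_eq_square[of ?N])
  then have "ennreal ((u x - cube_avg s u y)\<^sup>2) \<le> ennreal (1 / ?N) * ennreal ((norm_L2 lborel f)\<^sup>2)"
    using N by (subst ennreal_mult[symmetric]) (auto intro!: ennreal_leI)
  also have "ennreal ((norm_L2 lborel f)\<^sup>2) = (\<integral>\<^sup>+z. ennreal ((norm (f z))\<^sup>2) \<partial>lborel)"
    by (rule norm_L2_nn_integral[OF fL, symmetric])
  also have "\<dots> = (\<integral>\<^sup>+z. ennreal ((norm (f z))\<^sup>2) \<partial>distr lborel borel ((+) (x - y)))"
    by (simp add: lborel_distr_plus)
  also have "\<dots> = (\<integral>\<^sup>+w. ennreal ((norm (f (x - y + w)))\<^sup>2) \<partial>lborel)"
    unfolding f_def by (subst nn_integral_distr) measurable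
  also have "\<dots> \<le> (\<integral>\<^sup>+w. indicator (cbox ((-s) *\<^sub>R One) ((2 * s) *\<^sub>R One)) w * ennreal ((u (x + w)
    - u x)\<^sup>2) \<partial>lborel)"
  proof (rule nn_integral_mono)
    fix w :: 'a
    show "ennreal ((norm (f (x - y + w)))\<^sup>2)
        \<le> indicator (cbox ((-s) *\<^sub>R One) ((2 * s) *\<^sub>R One)) w * ennreal ((u (x + w) - u x)\<^sup>2)"
    proof (cases "x - y + w \<in> ?B")
      case True
      have "w \<in> cbox ((-s) *\<^sub>R One) ((2 * s) *\<^sub>R One)"
        unfolding mem_box
      proof
        fix i :: 'a assume i: "i \<in> Basis"
        have "0 \<le> (x - y + w) \<bullet> i" "(x - y + w) \<bullet> i \<le> s" using True i by (auto simp: mem_box)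
        then show "((-s) *\<^sub>R One) \<bullet> i \<le> w \<bullet> i \<and> w \<bullet> i \<le> ((2 * s) *\<^sub>R One) \<bullet> i"
          using xy[OF i] i by (auto simp: inner_add_left inner_diff_left abs_le_iff)
      qed
      moreover have "y + (x - y + w) = x + w" by simp
      ultimately show ?thesis using True by (simp add: f_def)
    qed (simp add: f_def)
  qed
  finally show ?thesis by (simp add: mult_left_mono)
qed

text \<open>
  The corner may be any function \<open>c\<close> within \<open>s\<close> of the identity: compactness uses corners of a grid, the
  Sobolev embedding uses \<open>c x = x\<close>.
\<close>

lemma cube_avg_L2_estimate:
  fixes u :: "'a::euclidean_space \<Rightarrow> real"
  assumes W: "H10_graph \<Omega> u g" and s: "s > 0" and c: "\<And>x i. i \<in> Basis \<Longrightarrow> \<bar>(c x - x) \<bullet> i\<bar> \<le> s"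
  shows "(\<integral>\<^sup>+x. ennreal ((u x - cube_avg s u (c x))\<^sup>2) \<partial>lborel)
    \<le> ennreal (3 ^ DIM('a) * (2 * s * real DIM('a) * norm_L2 lborel g)\<^sup>2)"
proof -
  let ?N = "s ^ DIM('a)" and ?B = "cbox ((-s) *\<^sub>R One) ((2 * s) *\<^sub>R One) :: 'a set"
  have [measurable]: "u \<in> borel_measurable borel" using H10_graph_measurable[OF W] by simp
  have norm_B: "norm w \<le> 2 * s * real DIM('a)" if "w \<in> ?B" for w
  proof -
    have "norm w \<le> (\<Sum>i\<in>Basis. \<bar>w \<bullet> i\<bar>)" by (rule norm_le_l1)
    also have "\<dots> \<le> (\<Sum>i\<in>(Basis::'a set). 2 * s)"
    proof (rule sum_mono)
      fix i :: 'a assume "i \<in> Basis"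
      then have "- s \<le> w \<bullet> i" "w \<bullet> i \<le> 2 * s" using that by (auto simp: mem_box)
      then show "\<bar>w \<bullet> i\<bar> \<le> 2 * s" using s by linarith
    qed
    finally show ?thesis by (simp add: mult.commute)
  qed
  have "(\<integral>\<^sup>+x. ennreal ((u x - cube_avg s u (c x))\<^sup>2) \<partial>lborel) \<le>
      (\<integral>\<^sup>+x. ennreal (1 / ?N) * (\<integral>\<^sup>+w. indicator ?B w * ennreal ((u (x + w) - u x)\<^sup>2) \<partial>lborel) \<partial>lborel)"
    by (intro nn_integral_mono cube_avg_pointwise_estimate H10_graph_L2[OF W] s c)
  also have "\<dots> = ennreal (1 / ?N) * (\<integral>\<^sup>+x. (\<integral>\<^sup>+w. indicator ?B w * ennreal ((u (x + w)
    - u x)\<^sup>2) \<partial>lborel) \<partial>lborel)"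
    by (rule nn_integral_cmult) measurable
  also have "(\<integral>\<^sup>+x. (\<integral>\<^sup>+w. indicator ?B w * ennreal ((u (x + w) - u x)\<^sup>2) \<partial>lborel) \<partial>lborel)
      = (\<integral>\<^sup>+w. (\<integral>\<^sup>+x. indicator ?B w * ennreal ((u (x + w) - u x)\<^sup>2) \<partial>lborel) \<partial>lborel)"
    by (rule lborel_pair.Fubini') measurable
  also have "\<dots> \<le> (\<integral>\<^sup>+w. indicator ?B w * ennreal ((2 * s * real DIM('a) * norm_L2 lborel g)\<^sup>2) \<partial>lborel)"
  proof (rule nn_integral_mono)
    fix w :: 'a
    have "(\<integral>\<^sup>+x. ennreal ((u (x + w) - u x)\<^sup>2) \<partial>lborel) = ennreal ((norm_L2 lborel (\<lambda>x. u (x + w) - u x))\<^sup>2)"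
      using norm_L2_nn_integral[OF L2_diff[OF L2_translate[OF H10_graph_L2(1)[OF W], of w] H10_graph_L2(1)[OF W]]] by simp
    also have "\<dots> \<le> ennreal ((norm w * norm_L2 lborel g)\<^sup>2)"
      by (intro ennreal_leI power_mono H10_graph_translation_estimate[OF W] norm_L2_nonneg)
    finally have 1: "(\<integral>\<^sup>+x. ennreal ((u (x + w) - u x)\<^sup>2) \<partial>lborel) \<le> ennreal ((norm w * norm_L2 lborel g)\<^sup>2)" .
    show "(\<integral>\<^sup>+x. indicator ?B w * ennreal ((u (x + w) - u x)\<^sup>2) \<partial>lborel)
        \<le> indicator ?B w * ennreal ((2 * s * real DIM('a) * norm_L2 lborel g)\<^sup>2)"
    proof (cases "w \<in> ?B")
      case True
      have "(norm w * norm_L2 lborel g)\<^sup>2 \<le> (2 * s * real DIM('a) * norm_L2 lborel g)\<^sup>2"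
        using norm_B[OF True] by (intro power_mono mult_right_mono) (auto simp: norm_L2_nonneg)
      then show ?thesis using True 1 by (simp add: order_trans[OF _ ennreal_leI])
    qed simp
  qed
  also have "\<dots> = emeasure lborel ?B * ennreal ((2 * s * real DIM('a) * norm_L2 lborel g)\<^sup>2)"
    by (simp add: nn_integral_multc)
  also have "emeasure lborel ?B = ennreal ((3 * s) ^ DIM('a))"
    using s by (simp add: emeasure_lborel_cbox_eq inner_diff_left algebra_simps)
  also have "ennreal (1 / ?N) * (ennreal ((3 * s) ^ DIM('a)) * ennreal ((2 * s * real DIM('a) * norm_L2 lborel g)\<^sup>2))
      = ennreal (3 ^ DIM('a) * (2 * s * real DIM('a) * norm_L2 lborel g)\<^sup>2)"
    using s by (simp add: ennreal_mult[symmetric] power_mult_distrib)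
  finally show ?thesis by (simp add: mult_left_mono)
qed

section \<open>Rellich compactness\<close>

text \<open>
  The lower corner of the cell that contains \<open>x\<close> in the grid of mesh size \<open>s\<close>.
\<close>

definition grid_corner :: "real \<Rightarrow> 'a::euclidean_space \<Rightarrow> 'a" where
  "grid_corner s x = (\<Sum>i\<in>Basis. (s * of_int \<lfloor>x \<bullet> i / s\<rfloor>) *\<^sub>R i)"

lemma grid_corner_close:
  assumes "s > 0" "i \<in> Basis"
  shows "\<bar>(grid_corner s x - x) \<bullet> i\<bar> \<le> s"
proof -
  have "grid_corner s x \<bullet> i = s * of_int \<lfloor>x \<bullet> i / s\<rfloor>" using assms(2) by (simp add: grid_corner_def)
  moreover have "s * of_int \<lfloor>x \<bullet> i / s\<rfloor> \<le> x \<bullet> i" "x \<bullet> i < s * of_int \<lfloor>x \<bullet> i / s\<rfloor> + s"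
    using floor_divide_lower[OF assms(1), of "x \<bullet> i"] floor_divide_upper[OF assms(1), of "x \<bullet> i"]
    by (simp_all add: algebra_simps)
  ultimately show ?thesis by (simp add: inner_diff_left abs_le_iff)
qed

lemma grid_corner_measurable [measurable]: "grid_corner s \<in> borel_measurable borel"
  unfolding grid_corner_def[abs_def] by measurable

lemma countable_range_grid_corner: "countable (range (grid_corner s :: 'a::euclidean_space \<Rightarrow> 'a))"
proof -
  have "range (grid_corner s :: 'a \<Rightarrow> 'a) \<subseteq>
      (\<lambda>m. \<Sum>i\<in>Basis. (s * of_int (m i)) *\<^sub>R i) ` (Basis \<rightarrow>\<^sub>E (UNIV :: int set))"
  proof
    fix y :: 'a assume "y \<in> range (grid_corner s)"
    then obtain x where "y = grid_corner s x" by blast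
    then show "y \<in> (\<lambda>m. \<Sum>i\<in>Basis. (s * of_int (m i)) *\<^sub>R i) ` (Basis \<rightarrow>\<^sub>E (UNIV :: int set))"
      by (intro image_eqI[of _ _ "restrict (\<lambda>i. \<lfloor>x \<bullet> i / s\<rfloor>) Basis"]) (auto simp: grid_corner_def)
  qed
  moreover have "countable (Basis \<rightarrow>\<^sub>E (UNIV :: int set) :: ('a \<Rightarrow> int) set)"
    by (intro countable_PiE) auto
  ultimately show ?thesis by (rule countable_subset[OF _ countable_image])
qed

lemma diagonal_convergent_subsequence:
  fixes a :: "'i \<Rightarrow> nat \<Rightarrow> real"
  assumes "countable I" and bdd: "\<And>i. i \<in> I \<Longrightarrow> bounded (range (a i))"
  obtains r where "strict_mono (r :: nat \<Rightarrow> nat)" "\<And>i. i \<in> I \<Longrightarrow> convergent (\<lambda>n. a i (r n))"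
proof (cases "I = {}")
  case True
  then show thesis using that[of id] by (simp add: strict_mono_id)
next
  case False
  define P where "P k s = convergent (\<lambda>n. a (from_nat_into I k) (s n))" for k and s :: "nat \<Rightarrow> nat"
  interpret subseqs P
  proof
    fix k and s :: "nat \<Rightarrow> nat" assume "strict_mono s"
    have "bounded (range (\<lambda>n. a (from_nat_into I k) (s n)))"
      by (rule bounded_subset[OF bdd[OF from_nat_into[OF False]]]) auto
    from bounded_imp_convergent_subsequence[OF this]
    obtain l r where "strict_mono r" "((\<lambda>n. a (from_nat_into I k) (s n)) \<circ> r) \<longlonglongrightarrow> l" by blast
    then show "\<exists>r'. strict_mono r' \<and> P k (s \<circ> r')"
      by (intro exI[of _ r]) (auto simp: P_def o_def convergent_def)
  qed
  have conv: "convergent (\<lambda>n. a (from_nat_into I k) (diagseq n))" for k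
  proof -
    have "P k (diagseq \<circ> ((+) (Suc k)))"
      by (rule diagseq_holds) (auto simp: P_def o_def dest: convergent_subseq_convergent)
    then have "convergent (\<lambda>n. a (from_nat_into I k) (diagseq (n + Suc k)))"
      unfolding P_def[of k "diagseq \<circ> ((+) (Suc k))"] by (simp add: o_def add.commute)
    then show ?thesis
      by (subst (asm) convergent_ignore_initial_segment)
  qed
  show thesis
  proof (rule that[OF subseq_diagseq])
    fix i assume "i \<in> I"
    then obtain k where "from_nat_into I k = i" using from_nat_into_surj[OF assms(1)] by blast
    then show "convergent (\<lambda>n. a i (diagseq n))" using conv[of k] by simp
  qed
qed

text \<open>
  Averages over the cells of the grids of mesh \<open>1 / (k + 1)\<close> form a countable family of bounded sequences, so
  they all converge along one diagonal subsequence. On the bounded set \<open>\<Omega>\<close> the averaged functions then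
  converge in \<open>L\<^sup>2\<close> by dominated convergence, and they are uniformly close to the functions themselves.
\<close>

lemma rellich_compactness:
  fixes u :: "nat \<Rightarrow> 'a::euclidean_space \<Rightarrow> real"
  assumes \<Omega>: "open \<Omega>" "bounded \<Omega>" and W: "\<And>n. H10_graph \<Omega> (u n) (g n)"
    and K: "\<And>n. norm_L2 lborel (u n) \<le> K" "\<And>n. norm_L2 lborel (g n) \<le> K"
  obtains r v where "strict_mono (r :: nat \<Rightarrow> nat)" "v \<in> L2 lborel"
    "(\<lambda>n. norm_L2 lborel (\<lambda>x. u (r n) x - v x)) \<longlonglongrightarrow> 0"
proof -
  define s where "s k = inverse (real (Suc k))" for k
  have s: "s k > 0" for k by (simp add: s_def)
  define I where "I = (\<Union>k. {k} \<times> range (grid_corner (s k) :: 'a \<Rightarrow> 'a))"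
  define a where "a i n = cube_avg (s (fst i)) (u n) (snd i)" for i n
  define C where "C k = sqrt (s k ^ DIM('a)) * K / s k ^ DIM('a)" for k
  note Lu = H10_graph_L2(1)[OF W]
  have [measurable]: "u n \<in> borel_measurable borel" for n using H10_graph_measurable[OF W] by simp
  have [measurable]: "\<Omega> \<in> sets borel" using \<Omega> by simp
  have K0: "K \<ge> 0" using order_trans[OF norm_L2_nonneg K(1)] .
  have avgC: "\<bar>cube_avg (s k) (u n) y\<bar> \<le> C k" for k n y
    unfolding C_def using s[of k]
    by (intro order_trans[OF cube_avg_abs_le[OF Lu s]] divide_right_mono mult_left_mono K) auto
  have "countable I" unfolding I_def
    by (intro countable_UN countable_SIGMA countable_range_grid_corner) auto
  moreover have "bounded (range (a i))" if "i \<in> I" for i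
    by (rule boundedI[of _ "C (fst i)"]) (auto simp: a_def avgC)
  ultimately obtain r where r: "strict_mono (r :: nat \<Rightarrow> nat)" and conv: "\<And>i. i \<in> I \<Longrightarrow> convergent (\<lambda>n. a i (r n))"
    using diagonal_convergent_subsequence[of I a] by metis
  define f where "f k n x = indicator \<Omega> x * cube_avg (s k) (u (r n)) (grid_corner (s k) x)" for k n x
  define F where "F k x = lim (\<lambda>n. f k n x)" for k x
  have fm[measurable]: "f k n \<in> borel_measurable borel" for k n unfolding f_def by measurable
  have flim: "(\<lambda>n. f k n x) \<longlonglongrightarrow> F k x" for k x
  proof -
    have "(k, grid_corner (s k) x) \<in> I" by (auto simp: I_def)
    from conv[OF this] have "convergent (\<lambda>n. f k n x)"
      unfolding f_def a_def by (intro convergent_mult convergent_const) simp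
    then show ?thesis unfolding F_def by (simp add: convergent_LIMSEQ_iff)
  qed
  have Fm[measurable]: "F k \<in> borel_measurable borel" for k
    by (rule borel_measurable_LIMSEQ_metric[OF fm flim])
  have fC: "\<bar>f k n x\<bar> \<le> C k * indicator \<Omega> x" for k n x
    using avgC by (auto simp: f_def indicator_def)
  have FC: "\<bar>F k x\<bar> \<le> C k * indicator \<Omega> x" for k x
    by (rule LIMSEQ_le_const2[OF tendsto_rabs[OF flim]]) (use fC in auto)
  have dom: "integrable lborel (\<lambda>x. c * indicator \<Omega> x :: real)" for c
    using emeasure_bounded_finite[OF \<Omega>(2)] by (intro integrable_mult_right integrable_real_indicator) auto
  have L2dom: "h \<in> L2 lborel" if [measurable]: "h \<in> borel_measurable borel" and "\<And>x. \<bar>h x\<bar>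
    \<le> c * indicator \<Omega> x" for h :: "'a \<Rightarrow> real" and c
  proof (rule L2I)
    show "integrable lborel (\<lambda>x. (norm (h x))\<^sup>2)"
    proof (rule Bochner_Integration.integrable_bound[OF dom[of "c\<^sup>2"]])
      show "AE x in lborel. norm ((norm (h x))\<^sup>2) \<le> norm (c\<^sup>2 * indicator \<Omega> x)"
      proof (intro AE_I2)
        fix x
        have "\<bar>h x\<bar>\<^sup>2 \<le> (c * indicator \<Omega> x)\<^sup>2" by (intro power_mono that) auto
        then show "norm ((norm (h x))\<^sup>2) \<le> norm (c\<^sup>2 * indicator \<Omega> x)" by (cases "x \<in> \<Omega>") auto
      qed
    qed measurable
  qed measurable
  have fL: "f k n \<in> L2 lborel" and FL: "F k \<in> L2 lborel" for k n
    by (rule L2dom[OF fm fC], rule L2dom[OF Fm FC])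
  have fF: "(\<lambda>n. norm_L2 lborel (\<lambda>x. f k n x - F k x)) \<longlonglongrightarrow> 0" for k
  proof -
    have "(\<lambda>n. LINT x|lborel. (norm (f k n x - F k x))\<^sup>2) \<longlonglongrightarrow> (LINT x|(lborel :: 'a measure). (0::real))"
    proof (rule integral_dominated_convergence[where w = "\<lambda>x. (2 * C k)\<^sup>2 * indicator \<Omega> x"])
      show "integrable lborel (\<lambda>x. (2 * C k)\<^sup>2 * indicator \<Omega> x)" by (rule dom)
      show "AE x in lborel. (\<lambda>n. (norm (f k n x - F k x))\<^sup>2) \<longlonglongrightarrow> 0"
      proof (intro AE_I2)
        fix x
        have "(\<lambda>n. (norm (f k n x - F k x))\<^sup>2) \<longlonglongrightarrow> (norm (F k x - F k x))\<^sup>2" by (intro tendsto_intros flim)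
        then show "(\<lambda>n. (norm (f k n x - F k x))\<^sup>2) \<longlonglongrightarrow> 0" by simp
      qed
      show "AE x in lborel. norm ((norm (f k n x - F k x))\<^sup>2) \<le> (2 * C k)\<^sup>2 * indicator \<Omega> x" for n
      proof (intro AE_I2)
        fix x
        have "\<bar>f k n x - F k x\<bar> \<le> 2 * C k * indicator \<Omega> x" using fC[of k n x] FC[of k x] by linarith
        then have "\<bar>f k n x - F k x\<bar>\<^sup>2 \<le> (2 * C k * indicator \<Omega> x)\<^sup>2" by (intro power_mono) auto
        then show "norm ((norm (f k n x - F k x))\<^sup>2) \<le> (2 * C k)\<^sup>2 * indicator \<Omega> x" by (cases "x \<in> \<Omega>") auto
      qed
    qed measurable
    then show ?thesis using tendsto_real_sqrt unfolding norm_L2_def by fastforce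
  qed
  define E where "E = sqrt (3 ^ DIM('a)) * (2 * real DIM('a) * K)"
  have E0: "E \<ge> 0" using K0 by (simp add: E_def)
  have near: "norm_L2 lborel (\<lambda>x. u (r n) x - f k n x) \<le> E * s k" for k n
  proof (rule L2_of_nn_integral(2))
    show "0 \<le> E * s k" using E0 s[of k] by simp
    have "(\<integral>\<^sup>+x. ennreal ((norm (u (r n) x - f k n x))\<^sup>2) \<partial>lborel)
        \<le> (\<integral>\<^sup>+x. ennreal ((u (r n) x - cube_avg (s k) (u (r n)) (grid_corner (s k) x))\<^sup>2) \<partial>lborel)"
    proof (rule nn_integral_mono_AE)
      show "AE x in lborel. ennreal ((norm (u (r n) x - f k n x))\<^sup>2)
        \<le> ennreal ((u (r n) x - cube_avg (s k) (u (r n)) (grid_corner (s k) x))\<^sup>2)"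
        using H10_graph_zero_outside[OF W[of "r n"]]
      proof eventually_elim
        case (elim x)
        then show ?case by (cases "x \<in> \<Omega>") (simp_all add: f_def)
      qed
    qed
    also have "\<dots> \<le> ennreal (3 ^ DIM('a) * (2 * s k * real DIM('a) * norm_L2 lborel (g (r n)))\<^sup>2)"
      by (rule cube_avg_L2_estimate[OF W s grid_corner_close[OF s]])
    also have "\<dots> \<le> ennreal ((E * s k)\<^sup>2)"
    proof (rule ennreal_leI)
      have "3 ^ DIM('a) * (2 * s k * real DIM('a) * norm_L2 lborel (g (r n)))\<^sup>2
        \<le> 3 ^ DIM('a) * (2 * s k * real DIM('a) * K)\<^sup>2"
        using s[of k] K(2)[of "r n"] norm_L2_nonneg[of lborel "g (r n)"]
            by (intro mult_left_mono power_mono) auto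
      also have "\<dots> = (E * s k)\<^sup>2" by (simp add: E_def power_mult_distrib)
      finally show "3 ^ DIM('a) * (2 * s k * real DIM('a) * norm_L2 lborel (g (r n)))\<^sup>2 \<le> (E * s k)\<^sup>2" .
    qed
    finally show "(\<integral>\<^sup>+x. ennreal ((norm (u (r n) x - f k n x))\<^sup>2) \<partial>lborel) \<le> ennreal ((E * s k)\<^sup>2)" .
  qed measurable
  have "\<exists>v\<in>L2 lborel. (\<lambda>n. norm_L2 lborel (\<lambda>x. u (r n) x - v x)) \<longlonglongrightarrow> 0"
  proof (rule L2_complete)
    show "u (r n) \<in> L2 lborel" for n by (rule Lu)
    fix e :: real assume e: "e > 0"
    obtain k where k: "E * s k < e / 4"
    proof -
      have "(\<lambda>k. E * s k) \<longlonglongrightarrow> E * 0" unfolding s_def by (intro tendsto_mult_left LIMSEQ_inverse_real_of_nat)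
      then have "\<forall>\<^sub>F k in sequentially. E * s k < e / 4" using e by (intro order_tendstoD(2)) auto
      from eventually_happens'[OF sequentially_bot this] show thesis using that by blast
    qed
    have "\<forall>\<^sub>F n in sequentially. norm_L2 lborel (\<lambda>x. f k n x - F k x) < e / 4"
      using e by (intro order_tendstoD(2)[OF fF]) auto
    then obtain N where N: "\<And>n. n \<ge> N \<Longrightarrow> norm_L2 lborel (\<lambda>x. f k n x - F k x) < e / 4"
      unfolding eventually_sequentially by blast
    have *: "norm_L2 lborel (\<lambda>x. u (r n) x - F k x) < e / 2" if "n \<ge> N" for n
      using norm_L2_triangle_diff[OF Lu[of "r n"] fL[of k n] FL[of k]] near[of n k] k N[OF that] by linarith
    show "\<exists>N. \<forall>m\<ge>N. \<forall>n\<ge>N. norm_L2 lborel (\<lambda>x. u (r m) x - u (r n) x) < e"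
    proof (intro exI allI impI)
      fix m n assume "N \<le> m" "N \<le> n"
      then show "norm_L2 lborel (\<lambda>x. u (r m) x - u (r n) x) < e"
        using norm_L2_triangle_diff[OF Lu[of "r m"] FL[of k] Lu[of "r n"]] *[of m] *[of n]
          norm_L2_diff_commute[of lborel "u (r n)" "F k"] by linarith
    qed
  qed
  then show thesis using that r by blast
qed

section \<open>Subcritical Sobolev embedding\<close>

lemma dyadic_bracket:
  fixes t :: real
  assumes "t > 1"
  obtains k :: nat where "2 powr real k < t" "t \<le> 2 powr real (Suc k)"
proof -
  obtain n :: nat where "t < 2 ^ n" using real_arch_pow[of 2 t] by auto
  then have ex: "\<exists>n::nat. t \<le> 2 ^ n" by (auto intro: less_imp_le)
  define n where "n = (LEAST n::nat. t \<le> 2 ^ n)"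
  have n: "t \<le> 2 ^ n" unfolding n_def using ex by (rule LeastI_ex)
  have "n \<noteq> 0" using n assms by (intro notI) simp
  then obtain k where k: "n = Suc k" by (cases n) auto
  have "\<not> t \<le> 2 ^ k" using not_less_Least[of k "\<lambda>n. t \<le> 2 ^ n"] k unfolding n_def by simp
  then show thesis using n k by (intro that[of k]) (simp_all add: powr_realpow[symmetric] powr_add)
qed

text \<open>
  The inequality \<open>\<bar>a\<bar> \<le> L + L\<^sup>1\<^sup>-\<^sup>q \<bar>a\<bar>\<^sup>q\<close> replaces that of Hoelder; the parameter \<open>L\<close> is chosen later.
\<close>

lemma cube_avg_abs_le_powr:
  fixes u :: "'a::euclidean_space \<Rightarrow> real"
  assumes u: "u \<in> L2 lborel" and q: "q \<ge> 1" "integrable lborel (\<lambda>x. \<bar>u x\<bar> powr q)"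
    and M: "(LINT x|lborel. \<bar>u x\<bar> powr q) \<le> M" and L: "L > 0" and s: "s > 0"
  shows "\<bar>cube_avg s u y\<bar> \<le> L + L powr (1 - q) * M / s ^ DIM('a)"
proof -
  let ?B = "cbox 0 (s *\<^sub>R One) :: 'a set"
  have [measurable]: "u \<in> borel_measurable borel" using L2D[OF u] by simp
  have iq: "integrable lborel (\<lambda>z. \<bar>u (y + z)\<bar> powr q)"
    using q(2) lborel_integrable_translate[of "\<lambda>x. \<bar>u x\<bar> powr q" y] by (simp add: add.commute)
  have pt: "\<bar>a\<bar> \<le> L + L powr (1 - q) * \<bar>a\<bar> powr q" for a :: real
  proof (cases "\<bar>a\<bar> \<le> L")
    case False
    have "\<bar>a\<bar> = \<bar>a\<bar> powr (1 - q) * \<bar>a\<bar> powr q" using False L by (simp add: powr_add[symmetric])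
    also have "\<dots> \<le> L powr (1 - q) * \<bar>a\<bar> powr q"
      using False L q(1) by (intro mult_right_mono powr_mono2') auto
    finally show ?thesis using L by simp
  qed (simp add: add_increasing2)
  have "\<bar>LINT z|lborel. indicator ?B z * u (y + z)\<bar> \<le> (LINT z|lborel. \<bar>indicator ?B z * u (y + z)\<bar>)"
    by (rule integral_abs_bound)
  also have "\<dots> \<le> (LINT z|lborel. L * indicator ?B z + L powr (1 - q) * \<bar>u (y + z)\<bar> powr q)"
  proof (rule integral_mono)
    show "integrable lborel (\<lambda>z. \<bar>indicator ?B z * u (y + z)\<bar>)" by (intro integrable_abs cube_avg_integrable u)
    show "integrable lborel (\<lambda>z. L * indicator ?B z + L powr (1 - q) * \<bar>u (y + z)\<bar> powr q)"
      by (intro Bochner_Integration.integrable_add integrable_mult_right integrable_indicator_cbox iq)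
    show "\<bar>indicator ?B z * u (y + z)\<bar> \<le> L * indicator ?B z + L powr (1 - q) * \<bar>u (y + z)\<bar> powr q" for z
      using pt[of "u (y + z)"] by (cases "z \<in> ?B") auto
  qed
  also have "\<dots> = L * s ^ DIM('a) + L powr (1 - q) * (LINT z|lborel. \<bar>u (y + z)\<bar> powr q)"
    using integrable_indicator_cbox iq measure_cube[of s 0, where 'a='a] s
    by simp
  also have "(LINT z|lborel. \<bar>u (y + z)\<bar> powr q) = (LINT z|lborel. \<bar>u z\<bar> powr q)"
    using lborel_integral_translate[of "\<lambda>x. \<bar>u x\<bar> powr q" y] by (simp add: add.commute)
  finally have "\<bar>LINT z|lborel. indicator ?B z * u (y + z)\<bar> \<le> L * s ^ DIM('a) + L powr (1 - q) * M"
    using M by (smt (verit) mult_left_mono powr_ge_zero)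
  then have "\<bar>LINT z|lborel. indicator ?B z * u (y + z)\<bar> / s ^ DIM('a)
    \<le> (L * s ^ DIM('a) + L powr (1 - q) * M) / s ^ DIM('a)"
    using s by (intro divide_right_mono) auto
  then show ?thesis using s by (simp add: cube_avg_def abs_divide add_divide_distrib)
qed

text \<open>
  Where \<open>\<bar>u\<bar>\<close> is between \<open>2\<^sup>k\<close> and \<open>2\<^sup>k\<^sup>+\<^sup>1\<close>, average over cubes of a side \<open>s k\<close> for which integrability of
  \<open>\<bar>u\<bar>\<^sup>q\<close> keeps the averages at most \<open>2\<^sup>k / 4\<close>. There \<open>u\<close> is controlled by its difference from the average,
  whose square has integral of order \<open>(s k)\<^sup>2\<close>, that is, of order \<open>2\<^sup>k\<close> to the power \<open>- 2 q / N\<close>. Summing over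
  \<open>k\<close> with weights \<open>2\<^sup>k\<close> to the power \<open>r - 2\<close> gives a geometric series, convergent exactly if
  \<open>r < 2 + 2 q / N\<close>.
\<close>

lemma sobolev_step:
  fixes u :: "'a::euclidean_space \<Rightarrow> real"
  assumes W: "H10_graph \<Omega> u g" and q: "q \<ge> 1" "integrable lborel (\<lambda>x. \<bar>u x\<bar> powr q)"
    and r: "2 \<le> r" "r < 2 + 2 * q / real DIM('a)"
  shows "integrable lborel (\<lambda>x. \<bar>u x\<bar> powr r)"
proof -
  let ?N = "real DIM('a)"
  have [measurable]: "u \<in> borel_measurable borel" using H10_graph_measurable[OF W] by simp
  note uL = H10_graph_L2(1)[OF W]
  have N: "?N > 0" by simp
  define M where "M = (LINT x|lborel. \<bar>u x\<bar> powr q) + 1"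
  have M: "M > 0" unfolding M_def by (simp add: add_nonneg_pos)
  define T where "T k = 2 powr real k" for k :: nat
  have T: "T k > 0" for k by (simp add: T_def)
  \<comment> \<open>This side makes both terms in the bound for the averages, taken with \<open>L = T k / 8\<close>, equal to \<open>T k / 8\<close>.\<close>
  define s where "s k = (8 powr q * M * T k powr (- q)) powr (1 / ?N)" for k
  have s: "s k > 0" for k using M T[of k] by (simp add: s_def)
  have sN: "s k ^ DIM('a) = 8 powr q * M * T k powr (- q)" for k
  proof -
    have "s k ^ DIM('a) = s k powr ?N" using s[of k] by (simp add: powr_realpow)
    also have "\<dots> = 8 powr q * M * T k powr (- q)"
      unfolding s_def powr_powr using M T[of k] by simp
    finally show ?thesis .
  qed
  have s2: "(s k)\<^sup>2 = (8 powr q * M) powr (2 / ?N) * T k powr (- (2 * q / ?N))" for k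
  proof -
    have "(s k)\<^sup>2 = s k powr 2" using s[of k] by simp
    also have "\<dots> = (8 powr q * M * T k powr (- q)) powr (2 / ?N)" by (simp add: s_def powr_powr)
    also have "\<dots> = (8 powr q * M) powr (2 / ?N) * T k powr (- (2 * q / ?N))"
      using M T[of k] by (subst powr_mult) (auto simp: powr_powr mult.commute)
    finally show ?thesis .
  qed
  have avgT: "\<bar>cube_avg (s k) u y\<bar> \<le> T k / 4" for k y
  proof -
    have "\<bar>cube_avg (s k) u y\<bar> \<le> T k / 8 + (T k / 8) powr (1 - q) * M / s k ^ DIM('a)"
      by (rule cube_avg_abs_le_powr[OF uL q]) (use T s in \<open>auto simp: M_def\<close>)
    also have "(T k / 8) powr (1 - q) * M / s k ^ DIM('a) = T k / 8"
    proof -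
      have "(T k / 8) powr (1 - q) = (T k * T k powr (- q)) / (8 * 8 powr (- q))"
        using T[of k] by (simp add: powr_divide powr_diff powr_minus divide_simps)
      then show ?thesis unfolding sN using M T[of k] by (simp add: powr_minus field_simps)
    qed
    finally show ?thesis by simp
  qed
  define D where "D k = 4 * (2 * T k) powr (r - 2)" for k
  have D0: "D k \<ge> 0" for k by (simp add: D_def)
  have pointwise: "ennreal (\<bar>u x\<bar> powr r)
    \<le> ennreal ((u x)\<^sup>2) + (\<Sum>k. ennreal (D k) * ennreal ((u x - cube_avg (s k) u x)\<^sup>2))" for x
  proof (cases "\<bar>u x\<bar> \<le> 1")
    case True
    have "\<bar>u x\<bar> powr r \<le> \<bar>u x\<bar> powr 2"
      using True r(1) by (intro powr_mono') auto
    then have "\<bar>u x\<bar> powr r \<le> (u x)\<^sup>2" by simp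
    then show ?thesis by (meson add_increasing2 ennreal_leI zero_le)
  next
    case False
    then obtain k where k: "T k < \<bar>u x\<bar>" "\<bar>u x\<bar> \<le> 2 * T k"
      using dyadic_bracket[of "\<bar>u x\<bar>"] unfolding T_def
        by (metis not_le of_nat_Suc powr_add powr_one zero_le_numeral)
    have half: "a \<le> 2 * d" if "b \<le> t / 4" "t < a" "a - b \<le> d" "0 < t" for a b d t :: real
      using that by simp
    have "\<bar>u x\<bar> \<le> 2 * \<bar>u x - cube_avg (s k) u x\<bar>"
      by (rule half[OF avgT k(1) abs_triangle_ineq2 T])
    then have "\<bar>u x\<bar>\<^sup>2 \<le> (2 * \<bar>u x - cube_avg (s k) u x\<bar>)\<^sup>2" by (intro power_mono) auto
    then have sq: "(u x)\<^sup>2 \<le> 4 * (u x - cube_avg (s k) u x)\<^sup>2" by (simp add: power_mult_distrib)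
    have "\<bar>u x\<bar> powr r = \<bar>u x\<bar> powr (r - 2) * \<bar>u x\<bar> powr 2"
      unfolding powr_add[symmetric] by simp
    also have "\<dots> = \<bar>u x\<bar> powr (r - 2) * (u x)\<^sup>2" by simp
    also have "\<dots> \<le> (2 * T k) powr (r - 2) * (4 * (u x - cube_avg (s k) u x)\<^sup>2)"
      using k r(1) sq by (intro mult_mono powr_mono2) auto
    also have "\<dots> = D k * (u x - cube_avg (s k) u x)\<^sup>2" by (simp add: D_def)
    finally have "ennreal (\<bar>u x\<bar> powr r) \<le> ennreal (D k) * ennreal ((u x - cube_avg (s k) u x)\<^sup>2)"
      using D0[of k] by (simp add: ennreal_mult[symmetric] ennreal_leI)
    also have "\<dots> = (\<Sum>k\<in>{k}. ennreal (D k) * ennreal ((u x - cube_avg (s k) u x)\<^sup>2))" by simp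
    also have "\<dots> \<le> (\<Sum>k. ennreal (D k) * ennreal ((u x - cube_avg (s k) u x)\<^sup>2))"
      by (rule sum_le_suminf[OF summableI]) auto
    finally show ?thesis by (simp add: add_increasing)
  qed
  define \<rho> where "\<rho> = 2 powr (r - 2 - 2 * q / ?N)"
  define C where "C = 4 * 2 powr (r - 2) * 3 ^ DIM('a) * (2 * ?N * norm_L2 lborel g)\<^sup>2 * (8 powr q * M) powr (2 / ?N)"
  have "\<rho> < 1" unfolding \<rho>_def using r(2) by (simp add: powr_less_one)
  have kth: "ennreal (D k) * (\<integral>\<^sup>+x. ennreal ((u x - cube_avg (s k) u x)\<^sup>2) \<partial>lborel) \<le> ennreal (C * \<rho> ^ k)" for k
  proof -
    have "ennreal (D k) * (\<integral>\<^sup>+x. ennreal ((u x - cube_avg (s k) u x)\<^sup>2) \<partial>lborel)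
        \<le> ennreal (D k) * ennreal (3 ^ DIM('a) * (2 * s k * ?N * norm_L2 lborel g)\<^sup>2)"
      using cube_avg_L2_estimate[OF W s, of "\<lambda>x. x" k] s[of k] by (intro mult_left_mono) auto
    also have "\<dots> = ennreal (D k * (3 ^ DIM('a) * (2 * s k * ?N * norm_L2 lborel g)\<^sup>2))"
      using D0 by (simp add: ennreal_mult[symmetric])
    also have "D k * (3 ^ DIM('a) * (2 * s k * ?N * norm_L2 lborel g)\<^sup>2) = C * \<rho> ^ k"
    proof -
      have "\<rho> ^ k = T k powr (r - 2) * T k powr (- (2 * q / ?N))"
      proof -
        have "\<rho> ^ k = \<rho> powr real k" by (simp add: \<rho>_def powr_realpow)
        also have "\<dots> = T k powr (r - 2 - 2 * q / ?N)" by (simp add: \<rho>_def T_def powr_powr mult.commute)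
        also have "\<dots> = T k powr (r - 2) * T k powr (- (2 * q / ?N))" by (simp add: powr_add[symmetric])
        finally show ?thesis .
      qed
      moreover have "D k = 4 * 2 powr (r - 2) * T k powr (r - 2)"
        using T[of k] by (simp add: D_def powr_mult)
      moreover have "(2 * s k * ?N * norm_L2 lborel g)\<^sup>2 = (2 * ?N * norm_L2 lborel g)\<^sup>2 * (s k)\<^sup>2"
        by (simp add: power_mult_distrib)
      ultimately show ?thesis unfolding C_def s2 by simp
    qed
    finally show ?thesis .
  qed
  have "(\<integral>\<^sup>+x. ennreal (\<bar>u x\<bar> powr r) \<partial>lborel)
      \<le> (\<integral>\<^sup>+x. ennreal ((u x)\<^sup>2) + (\<Sum>k. ennreal (D k) * ennreal ((u x - cube_avg (s k) u x)\<^sup>2)) \<partial>lborel)"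
    by (intro nn_integral_mono pointwise)
  also have "\<dots> = (\<integral>\<^sup>+x. ennreal ((u x)\<^sup>2) \<partial>lborel) + (\<Sum>k. ennreal (D k) * (\<integral>\<^sup>+x. ennreal ((u x
    - cube_avg (s k) u x)\<^sup>2) \<partial>lborel))"
    by (simp add: nn_integral_add nn_integral_suminf nn_integral_cmult)
  also have "\<dots> \<le> ennreal ((norm_L2 lborel u)\<^sup>2) + (\<Sum>k. ennreal (C * \<rho> ^ k))"
    using norm_L2_nn_integral[OF uL] by (intro add_mono suminf_le summableI kth) simp
  also have "\<dots> < \<infinity>"
  proof -
    have "(\<Sum>k. ennreal (C * \<rho> ^ k)) \<noteq> \<infinity>"
    proof (subst suminf_ennreal2)
      show "0 \<le> C * \<rho> ^ k" for k by (simp add: C_def \<rho>_def)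
      show "summable (\<lambda>k. C * \<rho> ^ k)" using \<open>\<rho> < 1\<close>
        by (intro summable_mult summable_geometric) (simp add: \<rho>_def)
    qed simp
    then show ?thesis by (simp add: less_top)
  qed
  finally have "(\<integral>\<^sup>+x. ennreal (\<bar>u x\<bar> powr r) \<partial>lborel) < \<infinity>" .
  then show ?thesis by (intro integrableI_bounded) auto
qed

lemma powr_interpolate:
  fixes a :: real
  assumes "2 \<le> p" "p \<le> q"
  shows "\<bar>a\<bar> powr p \<le> a\<^sup>2 + \<bar>a\<bar> powr q"
proof (cases "\<bar>a\<bar> \<le> 1")
  case True
  have "\<bar>a\<bar> powr p \<le> \<bar>a\<bar> powr 2" using True assms by (intro powr_mono') auto
  then show ?thesis by (simp add: add_increasing2)
next
  case False
  then have "\<bar>a\<bar> powr p \<le> \<bar>a\<bar> powr q" using assms by (intro powr_mono) auto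
  then show ?thesis by (simp add: add_increasing)
qed

text \<open>
  For \<open>N \<ge> 3\<close> the critical exponent is the fixed point of \<open>q \<mapsto> 2 + 2 q / N\<close>.
\<close>

lemma subcritical_gap:
  assumes "2 \<le> p" "ereal p < critical_exponent N" "N > 0"
  shows "p < 2 + 2 * p / real N"
proof (cases "N \<ge> 3")
  case True
  then have "p < 2 * real N / (real N - 2)" using assms(2) by (simp add: critical_exponent_def)
  then show ?thesis using True by (simp add: field_simps)
next
  case False
  then have "N = 1 \<or> N = 2" using assms(3) by auto
  then show ?thesis using assms(1) by auto
qed

text \<open>
  If the supremum \<open>Q\<close> of the exponents of integrability were subcritical, one step starting close enough to
  \<open>Q\<close> would lead beyond \<open>Q\<close>.
\<close>

lemma sobolev_embedding:
  fixes u :: "'a::euclidean_space \<Rightarrow> real"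
  assumes W: "H10_graph \<Omega> u g" and p: "2 \<le> p" "ereal p < critical_exponent DIM('a)"
  shows "integrable lborel (\<lambda>x. \<bar>u x\<bar> powr p)"
proof (rule ccontr)
  assume np: "\<not> integrable lborel (\<lambda>x. \<bar>u x\<bar> powr p)"
  let ?N = "real DIM('a)"
  have [measurable]: "u \<in> borel_measurable borel" using H10_graph_measurable[OF W] by simp
  have i2: "integrable lborel (\<lambda>x. (u x)\<^sup>2)" using L2_integrable[OF H10_graph_L2(1)[OF W]] by simp
  define S where "S = {q. 2 \<le> q \<and> integrable lborel (\<lambda>x. \<bar>u x\<bar> powr q)}"
  have S2: "2 \<in> S" using i2 by (simp add: S_def)
  have ub: "q \<le> p" if "q \<in> S" for q
  proof (rule ccontr)
    assume "\<not> q \<le> p"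
    then have q: "p \<le> q" by simp
    have "integrable lborel (\<lambda>x. \<bar>u x\<bar> powr p)"
    proof (rule Bochner_Integration.integrable_bound)
      show "integrable lborel (\<lambda>x. (u x)\<^sup>2 + \<bar>u x\<bar> powr q)" using i2 that by (simp add: S_def)
      show "AE x in lborel. norm (\<bar>u x\<bar> powr p) \<le> norm ((u x)\<^sup>2 + \<bar>u x\<bar> powr q)"
        using powr_interpolate[OF p(1) q] by (auto simp: add_nonneg_nonneg)
    qed measurable
    then show False using np by blast
  qed
  have bdd: "bdd_above S" using ub by (auto simp: bdd_above_def)
  define Q where "Q = Sup S"
  have Q: "2 \<le> Q" "Q \<le> p"
    unfolding Q_def using cSup_upper[OF S2 bdd] cSup_least[of S p] S2 ub by auto
  have "ereal Q \<le> ereal p" using Q by simp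
  then have "ereal Q < critical_exponent DIM('a)" using p(2) by (rule le_less_trans)
  then have gap: "Q < 2 + 2 * Q / ?N" using Q by (intro subcritical_gap) auto
  define d where "d = 2 + 2 * Q / ?N - Q"
  have d: "d > 0" using gap by (simp add: d_def)
  have "Q - ?N * d / 4 < Q" using d by simp
  then obtain q where q: "q \<in> S" "Q - ?N * d / 4 < q"
    unfolding Q_def using less_cSup_iff[OF _ bdd] S2 by blast
  have "integrable lborel (\<lambda>x. \<bar>u x\<bar> powr (Q + d / 4))"
  proof (rule sobolev_step[OF W])
    show "1 \<le> q" "integrable lborel (\<lambda>x. \<bar>u x\<bar> powr q)" using q(1) by (auto simp: S_def)
    show "2 \<le> Q + d / 4" using Q d by simp
    have "2 * (Q - ?N * d / 4) / ?N < 2 * q / ?N"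
        by (rule divide_strict_right_mono[OF mult_strict_left_mono[OF q(2)]]) simp_all
    moreover have "2 * (Q - ?N * d / 4) / ?N = 2 * Q / ?N - d / 2" by (simp add: field_simps)
    ultimately show "Q + d / 4 < 2 + 2 * q / ?N" using d d_def by linarith
  qed
  then have "Q + d / 4 \<in> S" using Q d by (simp add: S_def)
  then have "Q + d / 4 \<le> Q" unfolding Q_def using cSup_upper[OF _ bdd] by blast
  then show False using d by simp
qed

section \<open>Properties of \<open>H\<^sub>0\<^sup>1\<close>; the first Dirichlet eigenvalue\<close>

lemma weak_grad_L2: "open \<Omega> \<Longrightarrow> u \<in> H10 \<Omega> \<Longrightarrow> weak_grad \<Omega> u \<in> L2 (lebesgue_on \<Omega>)"
  by (rule H10_imp_graph) (auto intro: H10_of_graph(3))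

lemma H10_lincomb:
  assumes \<Omega>: "open \<Omega>" and u: "u \<in> H10 \<Omega>" and v: "v \<in> H10 \<Omega>"
  shows "(\<lambda>x. u x + c * v x) \<in> H10 \<Omega>"
    "AE x in lebesgue_on \<Omega>. weak_grad \<Omega> (\<lambda>x. u x + c * v x) x = weak_grad \<Omega> u x + c *\<^sub>R weak_grad \<Omega> v x"
proof -
  obtain u' g where U: "H10_graph \<Omega> u' g" "AE x in lebesgue_on \<Omega>. u' x = u x"
    using H10_imp_graph[OF \<Omega> u] by blast
  obtain v' h where V: "H10_graph \<Omega> v' h" "AE x in lebesgue_on \<Omega>. v' x = v x"
    using H10_imp_graph[OF \<Omega> v] by blast
  have ae: "AE x in lebesgue_on \<Omega>. u' x + c * v' x = u x + c * v x"
    using U(2) V(2) by eventually_elim simp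
  note H = H10_of_graph[OF \<Omega> H10_graph_lincomb[OF U(1) V(1)] ae]
  show "(\<lambda>x. u x + c * v x) \<in> H10 \<Omega>" by (rule H(1))
  show "AE x in lebesgue_on \<Omega>. weak_grad \<Omega> (\<lambda>x. u x + c * v x) x = weak_grad \<Omega> u x + c *\<^sub>R weak_grad \<Omega> v x"
    using H(2) H10_of_graph(2)[OF \<Omega> U] H10_of_graph(2)[OF \<Omega> V] by eventually_elim simp
qed

lemma norm_L2_sq_lincomb:
  assumes "f \<in> L2 M" "g \<in> L2 M"
  shows "(norm_L2 M (\<lambda>x. f x + c *\<^sub>R g x))\<^sup>2
    = (norm_L2 M f)\<^sup>2 + 2 * c * (LINT x|M. f x \<bullet> g x) + c\<^sup>2 * (norm_L2 M g)\<^sup>2"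
proof -
  have "(norm_L2 M (\<lambda>x. f x + c *\<^sub>R g x))\<^sup>2
    = (LINT x|M. (norm (f x))\<^sup>2 + (2 * c) * (f x \<bullet> g x) + c\<^sup>2 * (norm (g x))\<^sup>2)"
    unfolding norm_L2_sq by (intro Bochner_Integration.integral_cong refl)
      (simp add: power2_norm_eq_inner inner_add inner_commute power2_eq_square[of c] algebra_simps)
  also have "\<dots> = (norm_L2 M f)\<^sup>2 + 2 * c * (LINT x|M. f x \<bullet> g x) + c\<^sup>2 * (norm_L2 M g)\<^sup>2"
    using assms by (simp add: norm_L2_sq L2_integrable L2_inner)
  finally show ?thesis .
qed

lemma norm_L2_sq_weak_grad_lincomb:
  assumes \<Omega>: "open \<Omega>" and u: "u \<in> H10 \<Omega>" and v: "v \<in> H10 \<Omega>"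
  shows "(norm_L2 (lebesgue_on \<Omega>) (weak_grad \<Omega> (\<lambda>x. u x + c * v x)))\<^sup>2 =
    (norm_L2 (lebesgue_on \<Omega>) (weak_grad \<Omega> u))\<^sup>2
        + 2 * c * (LINT x|lebesgue_on \<Omega>. weak_grad \<Omega> u x \<bullet> weak_grad \<Omega> v x)
      + c\<^sup>2 * (norm_L2 (lebesgue_on \<Omega>) (weak_grad \<Omega> v))\<^sup>2"
proof -
  note L = weak_grad_L2[OF \<Omega> u] weak_grad_L2[OF \<Omega> v] weak_grad_L2[OF \<Omega> H10_lincomb(1)[OF \<Omega> u v]]
  have "norm_L2 (lebesgue_on \<Omega>) (weak_grad \<Omega> (\<lambda>x. u x + c * v x)) =
      norm_L2 (lebesgue_on \<Omega>) (\<lambda>x. weak_grad \<Omega> u x + c *\<^sub>R weak_grad \<Omega> v x)"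
    by (rule norm_L2_cong_AE[OF H10_lincomb(2)[OF \<Omega> u v] L2D[OF L(3)] L2D[OF L2_add[OF L(1) L2_scaleR[OF L(2)]]]])
  then show ?thesis using norm_L2_sq_lincomb[OF L(1,2)] by simp
qed

lemma H10_scale:
  assumes \<Omega>: "open \<Omega>" and u: "u \<in> H10 \<Omega>"
  shows "(\<lambda>x. c * u x) \<in> H10 \<Omega>"
    "(norm_L2 (lebesgue_on \<Omega>) (weak_grad \<Omega> (\<lambda>x. c * u x)))\<^sup>2
        = c\<^sup>2 * (norm_L2 (lebesgue_on \<Omega>) (weak_grad \<Omega> u))\<^sup>2"
proof -
  have eq: "(\<lambda>x. u x + (c - 1) * u x) = (\<lambda>x. c * u x)" by (simp add: algebra_simps)
  show "(\<lambda>x. c * u x) \<in> H10 \<Omega>" using H10_lincomb(1)[OF \<Omega> u u, of "c - 1"] unfolding eq .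
  have "(LINT x|lebesgue_on \<Omega>. weak_grad \<Omega> u x \<bullet> weak_grad \<Omega> u x) = (norm_L2 (lebesgue_on \<Omega>) (weak_grad \<Omega> u))\<^sup>2"
    by (simp add: norm_L2_sq power2_norm_eq_inner)
  then show "(norm_L2 (lebesgue_on \<Omega>) (weak_grad \<Omega> (\<lambda>x. c * u x)))\<^sup>2
    = c\<^sup>2 * (norm_L2 (lebesgue_on \<Omega>) (weak_grad \<Omega> u))\<^sup>2"
    using norm_L2_sq_weak_grad_lincomb[OF \<Omega> u u, of "c - 1"] unfolding eq
    by (simp add: power2_eq_square algebra_simps)
qed

lemma H10_sobolev:
  fixes u :: "'a::euclidean_space \<Rightarrow> real"
  assumes \<Omega>: "open \<Omega>" and u: "u \<in> H10 \<Omega>" and p: "2 \<le> p" "ereal p < critical_exponent DIM('a)"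
  shows "integrable (lebesgue_on \<Omega>) (\<lambda>x. \<bar>u x\<bar> powr p)"
proof -
  obtain v g where W: "H10_graph \<Omega> v g" and ae: "AE x in lebesgue_on \<Omega>. v x = u x"
    using H10_imp_graph[OF \<Omega> u] by blast
  show ?thesis
  proof (rule integrable_cong_AE_imp[OF integrable_lebesgue_on_lborel[OF \<Omega> sobolev_embedding[OF W p]]])
    show "(\<lambda>x. \<bar>u x\<bar> powr p) \<in> borel_measurable (lebesgue_on \<Omega>)" using L2D[OF H10_L2[OF u]] by measurable
    show "AE x in lebesgue_on \<Omega>. \<bar>v x\<bar> powr p = \<bar>u x\<bar> powr p" using ae by eventually_elim simp
  qed
qed

lemma H10_abs:
  assumes \<Omega>: "open \<Omega>" and u: "u \<in> H10 \<Omega>"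
  shows "(\<lambda>x. \<bar>u x\<bar>) \<in> H10 \<Omega>"
    "norm_L2 (lebesgue_on \<Omega>) (weak_grad \<Omega> (\<lambda>x. \<bar>u x\<bar>)) \<le> norm_L2 (lebesgue_on \<Omega>) (weak_grad \<Omega> u)"
proof -
  obtain v g where W: "H10_graph \<Omega> v g" and ae: "AE x in lebesgue_on \<Omega>. v x = u x"
    using H10_imp_graph[OF \<Omega> u] by blast
  obtain h where h: "H10_graph \<Omega> (\<lambda>x. \<bar>v x\<bar>) h" "norm_L2 lborel h \<le> norm_L2 lborel g"
    using H10_graph_abs[OF W] by blast
  have ae': "AE x in lebesgue_on \<Omega>. \<bar>v x\<bar> = \<bar>u x\<bar>" using ae by eventually_elim simp
  show "(\<lambda>x. \<bar>u x\<bar>) \<in> H10 \<Omega>" by (rule H10_of_graph(1)[OF \<Omega> h(1) ae'])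
  show "norm_L2 (lebesgue_on \<Omega>) (weak_grad \<Omega> (\<lambda>x. \<bar>u x\<bar>)) \<le> norm_L2 (lebesgue_on \<Omega>) (weak_grad \<Omega> u)"
    using H10_of_graph(5)[OF \<Omega> h(1) ae'] h(2) H10_of_graph(5)[OF \<Omega> W ae] by simp
qed

lemma H10_bounded_subsequence:
  fixes u :: "nat \<Rightarrow> 'a::euclidean_space \<Rightarrow> real"
  assumes \<Omega>: "open \<Omega>" "bounded \<Omega>" and u: "\<And>n. u n \<in> H10 \<Omega>"
    and K: "\<And>n. norm_L2 (lebesgue_on \<Omega>) (u n) \<le> K" "\<And>n. norm_L2 (lebesgue_on \<Omega>) (weak_grad \<Omega> (u n)) \<le> K"
  obtains r v a where "strict_mono (r :: nat \<Rightarrow> nat)" "v \<in> H10 \<Omega>"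
    "(\<lambda>n. norm_L2 (lebesgue_on \<Omega>) (\<lambda>x. u (r n) x - v x)) \<longlonglongrightarrow> 0"
    "AE x in lebesgue_on \<Omega>. (\<lambda>n. u (r n) x) \<longlonglongrightarrow> v x"
    "(\<lambda>n. norm_L2 (lebesgue_on \<Omega>) (weak_grad \<Omega> (u (r n)))) \<longlonglongrightarrow> a"
    "norm_L2 (lebesgue_on \<Omega>) (weak_grad \<Omega> v) \<le> a"
proof -
  let ?M = "lebesgue_on \<Omega>"
  have "\<exists>v g. H10_graph \<Omega> v g \<and> (AE x in ?M. v x = u n x)" for n
    using H10_imp_graph[OF \<Omega>(1) u[of n]] by metis
  then obtain w g where W: "\<And>n. H10_graph \<Omega> (w n) (g n)" and ae: "\<And>n. AE x in ?M. w n x = u n x" by metis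
  note eq = H10_of_graph(4,5)[OF \<Omega>(1) W ae]
  obtain r1 v where r1: "strict_mono (r1 :: nat \<Rightarrow> nat)" and v: "v \<in> L2 lborel"
    and lim1: "(\<lambda>n. norm_L2 lborel (\<lambda>x. w (r1 n) x - v x)) \<longlonglongrightarrow> 0"
    by (rule rellich_compactness[OF \<Omega> W K[unfolded eq]]) (rule that)
  have "bounded (range (\<lambda>n. norm_L2 lborel (g (r1 n))))"
    by (rule boundedI[of _ K]) (use K(2) in \<open>auto simp: eq norm_L2_nonneg\<close>)
  from bounded_imp_convergent_subsequence[OF this] obtain a r2 where r2: "strict_mono r2"
    and lim2: "((\<lambda>n. norm_L2 lborel (g (r1 n))) \<circ> r2) \<longlonglongrightarrow> a" by blast
  have lim3: "(\<lambda>n. norm_L2 lborel (\<lambda>x. w (r1 (r2 n)) x - v x)) \<longlonglongrightarrow> 0"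
    using LIMSEQ_subseq_LIMSEQ[OF lim1 r2] by (simp add: o_def)
  obtain r3 where r3: "strict_mono (r3 :: nat \<Rightarrow> nat)"
    and ae3: "AE x in lborel. (\<lambda>n. w (r1 (r2 (r3 n))) x) \<longlonglongrightarrow> v x"
    using norm_L2_AE_subseq[OF H10_graph_L2(1)[OF W] v lim3] by blast
  define r where "r n = r1 (r2 (r3 n))" for n
  have r: "strict_mono r" using r1 r2 r3 by (simp add: r_def[abs_def] strict_mono_def)
  have L3: "(\<lambda>n. norm_L2 lborel (\<lambda>x. w (r n) x - v x)) \<longlonglongrightarrow> 0"
    using LIMSEQ_subseq_LIMSEQ[OF lim3 r3] by (simp add: o_def r_def)
  have La: "(\<lambda>n. norm_L2 lborel (g (r n))) \<longlonglongrightarrow> a"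
    using LIMSEQ_subseq_LIMSEQ[OF lim2 r3] by (simp add: o_def r_def)
  obtain h where h: "H10_graph \<Omega> v h" "norm_L2 lborel h \<le> a"
    using H10_graph_weak_limit[OF W v L3 _ La] by blast
  have aev: "AE x in ?M. v x = v x" by simp
  note H = H10_of_graph[OF \<Omega>(1) h(1) aev]
  show thesis
  proof (rule that[OF r H(1)])
    have "norm_L2 ?M (\<lambda>x. u (r n) x - v x) = norm_L2 lborel (\<lambda>x. w (r n) x - v x)" for n
    proof -
      have W': "H10_graph \<Omega> (\<lambda>x. w (r n) x - v x) (\<lambda>x. g (r n) x - h x)"
        using H10_graph_lincomb[OF W h(1), of "r n" "-1"] by simp
      have z: "AE x in lborel. x \<notin> \<Omega> \<longrightarrow> w (r n) x - v x = 0"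
        using H10_graph_zero_outside[OF W'] by eventually_elim simp
      have "norm_L2 ?M (\<lambda>x. u (r n) x - v x) = norm_L2 ?M (\<lambda>x. w (r n) x - v x)"
      proof (rule norm_L2_cong_AE)
        show "AE x in ?M. u (r n) x - v x = w (r n) x - v x" using ae[of "r n"] by eventually_elim simp
        show "(\<lambda>x. u (r n) x - v x) \<in> borel_measurable ?M" by (intro L2D L2_diff H10_L2 u H)
        show "(\<lambda>x. w (r n) x - v x) \<in> borel_measurable ?M"
          by (intro borel_measurable_lebesgue_on H10_graph_measurable[OF W'])
      qed
      also have "\<dots> = norm_L2 lborel (\<lambda>x. w (r n) x - v x)"
        by (rule norm_L2_lebesgue_on_eq[OF \<Omega>(1) H10_graph_L2(1)[OF W'] z])
      finally show ?thesis .
    qed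
    then show "(\<lambda>n. norm_L2 ?M (\<lambda>x. u (r n) x - v x)) \<longlonglongrightarrow> 0" using L3 by simp
    have "AE x in ?M. (\<lambda>n. w (r n) x) \<longlonglongrightarrow> v x"
      unfolding AE_lebesgue_on_iff[OF \<Omega>(1)] using ae3 by eventually_elim (simp add: r_def)
    moreover have "AE x in ?M. \<forall>n. w n x = u n x" unfolding AE_all_countable using ae by blast
    ultimately show "AE x in ?M. (\<lambda>n. u (r n) x) \<longlonglongrightarrow> v x" by eventually_elim simp
    show "(\<lambda>n. norm_L2 ?M (weak_grad \<Omega> (u (r n)))) \<longlonglongrightarrow> a" unfolding eq by (rule La)
    show "norm_L2 ?M (weak_grad \<Omega> v) \<le> a" using H(5) h(2) by simp
  qed
qed

lemma norm_L2_eq_0_iff: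
  assumes "f \<in> L2 M" shows "norm_L2 M f = 0 \<longleftrightarrow> (AE x in M. f x = 0)"
  using integral_nonneg_eq_0_iff_AE[OF L2_integrable[OF assms]] by (simp add: norm_L2_def)

lemma ae_zero_iff_l2: "u \<in> H10 \<Omega> \<Longrightarrow> ae_zero \<Omega> u \<longleftrightarrow> norm_L2 (lebesgue_on \<Omega>) u = 0"
  by (simp add: ae_zero_def norm_L2_eq_0_iff[OF H10_L2])

lemma H10_nontrivial:
  assumes \<Omega>: "open \<Omega>" "\<Omega> \<noteq> {}"
  obtains u where "u \<in> H10 \<Omega>" "norm_L2 (lebesgue_on \<Omega>) u = 1"
proof -
  obtain x where x: "x \<in> \<Omega>" using \<Omega> by blast
  obtain a b where ab: "cbox a b \<subseteq> \<Omega>" "x \<in> box a b"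
    using open_contains_cbox[OF \<Omega>(1) x] by metis
  define \<phi> where "\<phi> = box_bump a b 1"
  have \<phi>: "\<phi> \<in> test_funs \<Omega>" unfolding \<phi>_def by (rule box_bump_test_fun) (use ab in auto)
  have H: "\<phi> \<in> H10 \<Omega>" by (rule H10_of_graph(1)[OF \<Omega>(1) H10_graph_test_fun[OF \<phi>]]) simp
  have "norm_L2 (lebesgue_on \<Omega>) \<phi> \<noteq> 0"
  proof
    assume "norm_L2 (lebesgue_on \<Omega>) \<phi> = 0"
    then have "AE y in lborel. y \<in> \<Omega> \<longrightarrow> \<phi> y = 0"
      using norm_L2_eq_0_iff[OF H10_L2[OF H]] AE_lebesgue_on_iff[OF \<Omega>(1)] by simp
    then have "AE y in lborel. y \<notin> box a b"
    proof eventually_elim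
      case (elim y)
      then show ?case using box_bump_pos[of 1 y a b] ab(1) box_subset_cbox[of a b] by (auto simp: \<phi>_def)
    qed
    then have "emeasure lborel (box a b) = 0"
      by (subst (asm) AE_iff_measurable[of "box a b"]) auto
    moreover have "a \<bullet> i < b \<bullet> i" if "i \<in> Basis" for i using ab(2) that by (force simp: mem_box)
    moreover from this have "(\<Prod>i\<in>Basis. (b - a) \<bullet> i) > 0"
      by (intro prod_pos) (simp add: inner_diff_left)
    ultimately show False
      by (auto simp: emeasure_lborel_box_eq less_imp_le ennreal_eq_0_iff split: if_splits)
  qed
  then have pos: "norm_L2 (lebesgue_on \<Omega>) \<phi> > 0" using norm_L2_nonneg[of "lebesgue_on \<Omega>" \<phi>] by simp
  define c where "c = inverse (norm_L2 (lebesgue_on \<Omega>) \<phi>)"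
  have "norm_L2 (lebesgue_on \<Omega>) (\<lambda>x. c * \<phi> x) = 1"
    using norm_L2_scaleR[of "lebesgue_on \<Omega>" c \<phi>] pos by (simp add: c_def)
  then show thesis using that[OF H10_scale(1)[OF \<Omega>(1) H]] by blast
qed

lemma linear_coefficient_zero:
  fixes A B :: real
  assumes "\<And>t. 0 \<le> 2 * t * A + t\<^sup>2 * B"
  shows "A = 0"
proof (rule ccontr)
  assume A: "A \<noteq> 0"
  define t where "t = - A / (\<bar>B\<bar> + 1)"
  have "t\<^sup>2 * B \<le> t\<^sup>2 * (\<bar>B\<bar> + 1)" by (intro mult_left_mono) auto
  also have "\<dots> = - t * A" unfolding t_def by (simp add: power2_eq_square divide_simps)
  finally have "0 \<le> t * A" using assms[of t] by simp
  moreover have "t * A < 0"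
  proof -
    have "t * A = - (A\<^sup>2 / (\<bar>B\<bar> + 1))" by (simp add: t_def power2_eq_square)
    moreover have "A\<^sup>2 / (\<bar>B\<bar> + 1) > 0" using A by (intro divide_pos_pos) auto
    ultimately show ?thesis by simp
  qed
  ultimately show False by simp
qed

text \<open>
  The Rayleigh quotient has a minimiser by compactness, and its first variation is the eigenvalue equation.
  Every eigenvalue is the Rayleigh quotient of its eigenfunctions, so the minimum is the least one.
\<close>

lemma first_eigenfunction_exists:
  assumes \<Omega>: "open \<Omega>" "bounded \<Omega>" "\<Omega> \<noteq> {}"
  obtains w where "w \<in> H10 \<Omega>" "norm_L2 (lebesgue_on \<Omega>) w = 1"
    "(norm_L2 (lebesgue_on \<Omega>) (weak_grad \<Omega> w))\<^sup>2 = first_eigenvalue \<Omega>"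
proof -
  let ?M = "lebesgue_on \<Omega>"
  define S where "S = {(norm_L2 ?M (weak_grad \<Omega> u))\<^sup>2 | u. u \<in> H10 \<Omega> \<and> norm_L2 ?M u = 1}"
  obtain u0 where u0: "u0 \<in> H10 \<Omega>" "norm_L2 ?M u0 = 1" using H10_nontrivial[OF \<Omega>(1,3)] by blast
  have ne: "S \<noteq> {}" using u0 by (auto simp: S_def)
  have bdd: "bdd_below S" by (rule bdd_belowI[of _ 0]) (auto simp: S_def)
  define \<mu> where "\<mu> = Inf S"
  have \<mu>_le: "\<mu> * (norm_L2 ?M u)\<^sup>2 \<le> (norm_L2 ?M (weak_grad \<Omega> u))\<^sup>2" if u: "u \<in> H10 \<Omega>" for u
  proof (cases "norm_L2 ?M u = 0")
    case False
    define c where "c = inverse (norm_L2 ?M u)"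
    have "norm_L2 ?M (\<lambda>x. c * u x) = 1"
      using norm_L2_scaleR[of ?M c u] False norm_L2_nonneg[of ?M u] by (simp add: c_def)
    then have "c\<^sup>2 * (norm_L2 ?M (weak_grad \<Omega> u))\<^sup>2 \<in> S"
      unfolding S_def H10_scale(2)[OF \<Omega>(1) u, symmetric] using H10_scale(1)[OF \<Omega>(1) u] by blast
    then have "\<mu> \<le> c\<^sup>2 * (norm_L2 ?M (weak_grad \<Omega> u))\<^sup>2" unfolding \<mu>_def by (rule cInf_lower[OF _ bdd])
    then show ?thesis using False by (simp add: c_def field_simps)
  qed simp
  have "\<exists>u. u \<in> H10 \<Omega> \<and> norm_L2 ?M u = 1 \<and> (norm_L2 ?M (weak_grad \<Omega> u))\<^sup>2 < \<mu> + inverse (real (Suc n))" for n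
  proof -
    have "\<exists>y\<in>S. y < \<mu> + inverse (real (Suc n))"
      unfolding \<mu>_def by (intro cInf_lessD[OF ne]) simp
    then show ?thesis by (auto simp: S_def)
  qed
  then obtain u where u: "\<And>n. u n \<in> H10 \<Omega>" "\<And>n. norm_L2 ?M (u n) = 1"
    "\<And>n. (norm_L2 ?M (weak_grad \<Omega> (u n)))\<^sup>2 < \<mu> + inverse (real (Suc n))" by metis
  have "norm_L2 ?M (weak_grad \<Omega> (u n)) \<le> max 1 (sqrt (\<mu> + 1))" for n
  proof -
    have "inverse (real (Suc n)) \<le> 1" by (simp add: inverse_le_1_iff)
    then have "(norm_L2 ?M (weak_grad \<Omega> (u n)))\<^sup>2 \<le> \<mu> + 1" using u(3)[of n] by linarith
    then show ?thesis by (intro max.coboundedI2 real_le_rsqrt)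
  qed
  note bounds = this
  have "norm_L2 ?M (u n) \<le> max 1 (sqrt (\<mu> + 1))" for n using u(2) by simp
  note bounds = this bounds
  obtain r w a where r: "strict_mono (r :: nat \<Rightarrow> nat)" and w: "w \<in> H10 \<Omega>"
    and lim: "(\<lambda>n. norm_L2 ?M (\<lambda>x. u (r n) x - w x)) \<longlonglongrightarrow> 0"
    and lima: "(\<lambda>n. norm_L2 ?M (weak_grad \<Omega> (u (r n)))) \<longlonglongrightarrow> a" and le: "norm_L2 ?M (weak_grad \<Omega> w) \<le> a"
    by (rule H10_bounded_subsequence[OF \<Omega>(1,2) u(1) bounds]) (rule that)
  have "(\<lambda>n. norm_L2 ?M (u (r n))) \<longlonglongrightarrow> norm_L2 ?M w"
    by (rule norm_L2_tendsto[OF H10_L2[OF u(1)] H10_L2[OF w] lim])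
  then have w1: "norm_L2 ?M w = 1" by (simp add: u(2) LIMSEQ_const_iff)
  have "a\<^sup>2 \<le> \<mu> + 0"
  proof (rule LIMSEQ_le)
    show "(\<lambda>n. (norm_L2 ?M (weak_grad \<Omega> (u (r n))))\<^sup>2) \<longlonglongrightarrow> a\<^sup>2" by (intro tendsto_power lima)
    show "(\<lambda>n. \<mu> + inverse (real (Suc (r n)))) \<longlonglongrightarrow> \<mu> + 0"
      by (intro tendsto_add tendsto_const LIMSEQ_subseq_LIMSEQ[OF LIMSEQ_inverse_real_of_nat r, unfolded o_def])
  qed (use u(3) in \<open>auto intro: less_imp_le\<close>)
  moreover have "(norm_L2 ?M (weak_grad \<Omega> w))\<^sup>2 \<le> a\<^sup>2" by (intro power_mono le norm_L2_nonneg)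
  ultimately have w\<mu>: "(norm_L2 ?M (weak_grad \<Omega> w))\<^sup>2 = \<mu>" using \<mu>_le[OF w] w1 by simp
  have EL: "(LINT x|?M. weak_grad \<Omega> w x \<bullet> weak_grad \<Omega> \<phi> x) = (LINT x|?M. \<mu> * w x * \<phi> x)" if \<phi>: "\<phi> \<in> H10 \<Omega>" for \<phi>
  proof -
    define A where "A = (LINT x|?M. weak_grad \<Omega> w x \<bullet> weak_grad \<Omega> \<phi> x) - \<mu> * (LINT x|?M. w x \<bullet> \<phi> x)"
    define B where "B = (norm_L2 ?M (weak_grad \<Omega> \<phi>))\<^sup>2 - \<mu> * (norm_L2 ?M \<phi>)\<^sup>2"
    have "A = 0"
    proof (rule linear_coefficient_zero)
      fix t :: real
      have "\<mu> * (norm_L2 ?M (\<lambda>x. w x + t * \<phi> x))\<^sup>2 \<le> (norm_L2 ?M (weak_grad \<Omega> (\<lambda>x. w x + t * \<phi> x)))\<^sup>2"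
        by (rule \<mu>_le[OF H10_lincomb(1)[OF \<Omega>(1) w \<phi>]])
      then show "0 \<le> 2 * t * A + t\<^sup>2 * B"
        unfolding norm_L2_sq_weak_grad_lincomb[OF \<Omega>(1) w \<phi>]
        using norm_L2_sq_lincomb[OF H10_L2[OF w] H10_L2[OF \<phi>], of t] w\<mu> w1
        by (simp add: A_def B_def algebra_simps)
    qed
    then show ?thesis by (simp add: A_def mult.assoc)
  qed
  have "dirichlet_eigenvalue \<Omega> \<mu>"
    unfolding dirichlet_eigenvalue_def using w EL w1 ae_zero_iff_l2[OF w] by auto
  moreover have "\<mu> \<le> \<nu>" if \<nu>: "dirichlet_eigenvalue \<Omega> \<nu>" for \<nu>
  proof -
    obtain y where y: "y \<in> H10 \<Omega>" "\<not> ae_zero \<Omega> y"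
      and e: "(LINT x|?M. weak_grad \<Omega> y x \<bullet> weak_grad \<Omega> y x) = (LINT x|?M. \<nu> * y x * y x)"
      using \<nu> unfolding dirichlet_eigenvalue_def by blast
    have "(norm_L2 ?M (weak_grad \<Omega> y))\<^sup>2 = \<nu> * (norm_L2 ?M y)\<^sup>2"
      using e unfolding norm_L2_sq power2_norm_eq_inner by (simp add: mult.assoc)
    moreover have "(norm_L2 ?M y)\<^sup>2 > 0" using y by (simp add: ae_zero_iff_l2)
    ultimately show "\<mu> \<le> \<nu>" using \<mu>_le[OF y(1)] by simp
  qed
  ultimately have "first_eigenvalue \<Omega> = \<mu>"
    unfolding first_eigenvalue_def by (intro Least_equality)
  then show thesis using that[OF w w1] w\<mu> by simp
qed

section \<open>Minimisers of the energy\<close>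

text \<open>
  The integrand of \<open>J_energy\<close> without its gradient terms.
\<close>

definition potential :: "real \<Rightarrow> real \<Rightarrow> real \<Rightarrow> real \<Rightarrow> real \<Rightarrow> real \<Rightarrow> real" where
  "potential p lam1 lam2 \<beta> a b = - (lam1 / 2) * a\<^sup>2 - (lam2 / 2) * b\<^sup>2
     + 1 / p * (\<bar>a\<bar> powr p + \<bar>b\<bar> powr p) - 2 * \<beta> / p * (\<bar>a\<bar> powr (p / 2) * \<bar>b\<bar> powr (p / 2))"

lemma powr_half_sq: "(\<bar>a\<bar> powr (p / 2))\<^sup>2 = \<bar>a\<bar> powr p" for a :: real
  by (simp add: power2_eq_square powr_add[symmetric])

lemma powr_half_product_le:
  "2 * (\<bar>a\<bar> powr (p / 2) * \<bar>b\<bar> powr (p / 2)) \<le> \<bar>a\<bar> powr p + \<bar>b\<bar> powr p" for a b :: real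
  using sum_squares_bound[of "\<bar>a\<bar> powr (p / 2)" "\<bar>b\<bar> powr (p / 2)"] by (simp add: powr_half_sq mult.assoc)

text \<open>
  For \<open>\<beta> \<ge> 0\<close> the coupling is absorbed by \<open>2 x y \<le> x\<^sup>2 + y\<^sup>2\<close>; for \<open>\<beta> < 0\<close> it contributes with a positive sign.
\<close>

lemma coupled_power_lower_bound:
  fixes a b :: real
  shows "min 1 (1 - \<beta>) * (\<bar>a\<bar> powr p + \<bar>b\<bar> powr p) \<le>
    \<bar>a\<bar> powr p + \<bar>b\<bar> powr p - 2 * \<beta> * (\<bar>a\<bar> powr (p / 2) * \<bar>b\<bar> powr (p / 2))"
proof (cases "\<beta> \<ge> 0")
  case True
  have "\<beta> * (2 * (\<bar>a\<bar> powr (p / 2) * \<bar>b\<bar> powr (p / 2))) \<le> \<beta> * (\<bar>a\<bar> powr p + \<bar>b\<bar> powr p)"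
    by (rule mult_left_mono[OF powr_half_product_le True])
  then show ?thesis using True by (simp add: min_def algebra_simps)
next
  case False
  have "\<beta> * (\<bar>a\<bar> powr (p / 2) * \<bar>b\<bar> powr (p / 2)) \<le> 0"
    using False by (intro mult_nonpos_nonneg) auto
  then show ?thesis using False by (simp add: min_def)
qed

text \<open>
  Below the threshold \<open>R\<close>, where \<open>k R\<^sup>p\<^sup>-\<^sup>2 = A\<close>, the square is bounded; above it the power dominates.
\<close>

lemma square_le_powr:
  fixes A k p :: real
  assumes "2 < p" "k > 0" "A \<ge> 0"
  obtains C where "C \<ge> 0" "\<And>a. A * a\<^sup>2 \<le> k * \<bar>a\<bar> powr p + C"
proof -
  define R where "R = (A / k) powr (1 / (p - 2))"
  have R: "R powr (p - 2) = A / k" using assms by (cases "A = 0") (auto simp: R_def powr_powr)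
  show thesis
  proof (rule that[of "A * R\<^sup>2"])
    show "A * R\<^sup>2 \<ge> 0" using assms by simp
    fix a :: real
    show "A * a\<^sup>2 \<le> k * \<bar>a\<bar> powr p + A * R\<^sup>2"
    proof (cases "\<bar>a\<bar> \<le> R")
      case True
      have "\<bar>a\<bar>\<^sup>2 \<le> R\<^sup>2" by (intro power_mono True) simp
      then have "A * a\<^sup>2 \<le> A * R\<^sup>2" using assms by (intro mult_left_mono) auto
      then show ?thesis using assms by (simp add: add_increasing)
    next
      case False
      have "A / k \<le> \<bar>a\<bar> powr (p - 2)" unfolding R[symmetric]
        using False assms by (intro powr_mono2) (auto simp: R_def)
      then have "A \<le> k * \<bar>a\<bar> powr (p - 2)" using assms by (simp add: field_simps)
      then have "A * a\<^sup>2 \<le> (k * \<bar>a\<bar> powr (p - 2)) * a\<^sup>2" by (intro mult_right_mono) auto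
      also have "\<dots> = k * (\<bar>a\<bar> powr (p - 2) * \<bar>a\<bar> powr 2)" by simp
      also have "\<dots> = k * \<bar>a\<bar> powr p" unfolding powr_add[symmetric] by simp
      finally show ?thesis using assms by (simp add: add_increasing2)
    qed
  qed
qed

lemma potential_coercive:
  fixes p :: real
  assumes "2 < p" "\<beta> < 1"
  obtains C where "C \<ge> 0" "\<And>a b. a\<^sup>2 + b\<^sup>2 \<le> potential p lam1 lam2 \<beta> a b + C"
proof -
  define A where "A = 1 + \<bar>lam1\<bar> + \<bar>lam2\<bar>"
  obtain C where C: "C \<ge> 0" "\<And>a. A * a\<^sup>2 \<le> (min 1 (1 - \<beta>) / p) * \<bar>a\<bar> powr p + C"
    using square_le_powr[of p "min 1 (1 - \<beta>) / p" A] assms by (auto simp: A_def)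
  show thesis
  proof (rule that[of "2 * C"])
    fix a b :: real
    have "(1 / p) * (min 1 (1 - \<beta>) * (\<bar>a\<bar> powr p + \<bar>b\<bar> powr p)) \<le>
      (1 / p) * (\<bar>a\<bar> powr p + \<bar>b\<bar> powr p - 2 * \<beta> * (\<bar>a\<bar> powr (p / 2) * \<bar>b\<bar> powr (p / 2)))"
      using assms by (intro mult_left_mono coupled_power_lower_bound) auto
    then have 1: "(min 1 (1 - \<beta>) / p) * \<bar>a\<bar> powr p + (min 1 (1 - \<beta>) / p) * \<bar>b\<bar> powr p \<le>
      1 / p * (\<bar>a\<bar> powr p + \<bar>b\<bar> powr p) - 2 * \<beta> / p * (\<bar>a\<bar> powr (p / 2) * \<bar>b\<bar> powr (p / 2))"
      by (simp add: algebra_simps)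
    have c1: "(1 + lam1 / 2) * a\<^sup>2 \<le> A * a\<^sup>2" unfolding A_def by (intro mult_right_mono) auto
    have c2: "(1 + lam2 / 2) * b\<^sup>2 \<le> A * b\<^sup>2" unfolding A_def by (intro mult_right_mono) auto
    show "a\<^sup>2 + b\<^sup>2 \<le> potential p lam1 lam2 \<beta> a b + 2 * C"
      using 1 c1 c2 C(2)[of a] C(2)[of b] unfolding potential_def by (simp add: algebra_simps)
  qed (use C in simp)
qed

lemma powr_abs_has_derivative:
  fixes a q :: real
  assumes "q > 1"
  shows "((\<lambda>s. \<bar>s\<bar> powr q) has_real_derivative q * (\<bar>a\<bar> powr (q - 2) * a)) (at a)"
proof (cases a "0::real" rule: linorder_cases)
  case greater
  have "((\<lambda>s. s powr q) has_real_derivative q * (\<bar>a\<bar> powr (q - 2) * a)) (at a)"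
    using greater by (auto intro!: derivative_eq_intros simp: powr_diff power2_eq_square field_simps)
  then show ?thesis
    by (rule DERIV_cong_ev[THEN iffD1, OF refl _ refl, rotated])
       (use greater in \<open>auto simp: eventually_nhds_metric dist_real_def intro!: exI[of _ a]\<close>)
next
  case less
  have "((\<lambda>s. (- s) powr q) has_real_derivative q * (\<bar>a\<bar> powr (q - 2) * a)) (at a)"
    using less by (auto intro!: derivative_eq_intros simp: powr_diff power2_eq_square field_simps)
  then show ?thesis
    by (rule DERIV_cong_ev[THEN iffD1, OF refl _ refl, rotated])
       (use less in \<open>auto simp: eventually_nhds_metric dist_real_def intro!: exI[of _ "- a"]\<close>)
next
  case equal
  have "((\<lambda>h. \<bar>h\<bar> powr (q - 1)) \<longlongrightarrow> 0) (at 0)"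
  proof -
    have "((\<lambda>h::real. \<bar>h\<bar> powr (q - 1)) \<longlongrightarrow> \<bar>0\<bar> powr (q - 1)) (at 0)"
      by (intro tendsto_powr' tendsto_rabs tendsto_ident_at tendsto_const) (use assms in auto)
    then show ?thesis by simp
  qed
  then have "((\<lambda>h. \<bar>h\<bar> powr q / h) \<longlongrightarrow> 0) (at 0)"
  proof (rule Lim_null_comparison[rotated])
    show "\<forall>\<^sub>F h in at 0. norm (\<bar>h\<bar> powr q / h) \<le> \<bar>h\<bar> powr (q - 1)"
      by (auto simp: eventually_at_filter powr_diff abs_divide)
  qed
  then show ?thesis using equal by (simp add: DERIV_def)
qed

definition potential_deriv :: "real \<Rightarrow> real \<Rightarrow> real \<Rightarrow> real \<Rightarrow> real \<Rightarrow> real" where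
  "potential_deriv p lam \<beta> a b = - lam * a + \<bar>a\<bar> powr (p - 2) * a
     - \<beta> * (\<bar>a\<bar> powr (p / 2 - 2) * a) * \<bar>b\<bar> powr (p / 2)"

lemma potential_has_derivative:
  assumes "2 < p"
  shows "((\<lambda>s. potential p lam1 lam2 \<beta> s b) has_real_derivative potential_deriv p lam1 \<beta> a b) (at a)"
proof -
  have d: "((\<lambda>s. s\<^sup>2) has_real_derivative 2 * a) (at a)" by (auto intro!: derivative_eq_intros)
  note dp = powr_abs_has_derivative[of p a] and dh = powr_abs_has_derivative[of "p / 2" a]
  have "((\<lambda>s. potential p lam1 lam2 \<beta> s b) has_real_derivative
      (- (lam1 / 2) * (2 * a) - 0 + 1 / p * (p * (\<bar>a\<bar> powr (p - 2) * a) + 0)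
        - 2 * \<beta> / p * ((p / 2 * (\<bar>a\<bar> powr (p / 2 - 2) * a)) * \<bar>b\<bar> powr (p / 2)))) (at a)"
    unfolding potential_def using assms
    by (intro DERIV_diff DERIV_add DERIV_cmult DERIV_cmult_right DERIV_const d dp dh) auto
  then show ?thesis using assms by (simp add: potential_deriv_def algebra_simps)
qed

lemma potential_deriv_bound:
  assumes p: "2 < p" and m: "m \<ge> 1" "\<bar>s\<bar> \<le> m" "\<bar>b\<bar> \<le> m"
  shows "\<bar>potential_deriv p lam \<beta> s b\<bar> \<le> (\<bar>lam\<bar> + 1 + \<bar>\<beta>\<bar>) * m powr (p - 1)"
proof -
  have e: "\<bar>\<bar>s\<bar> powr (q - 2) * s\<bar> = \<bar>s\<bar> powr (q - 1)" for q
  proof (cases "s = 0")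
    case False
    then have "\<bar>s\<bar> powr (q - 1) = \<bar>s\<bar> powr (q - 2) * \<bar>s\<bar> powr 1" unfolding powr_add[symmetric] by simp
    then show ?thesis by (simp add: abs_mult)
  qed simp
  have 1: "\<bar>s\<bar> \<le> m powr (p - 1)"
  proof -
    have "m powr 1 \<le> m powr (p - 1)" using p m by (intro powr_mono) auto
    then show ?thesis using m by simp
  qed
  have 2: "\<bar>s\<bar> powr (p - 1) \<le> m powr (p - 1)" using p m by (intro powr_mono2) auto
  have 3: "\<bar>s\<bar> powr (p / 2 - 1) * \<bar>b\<bar> powr (p / 2) \<le> m powr (p - 1)"
  proof -
    have "\<bar>s\<bar> powr (p / 2 - 1) * \<bar>b\<bar> powr (p / 2) \<le> m powr (p / 2 - 1) * m powr (p / 2)"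
      using p m by (intro mult_mono powr_mono2) auto
    also have "\<dots> = m powr (p - 1)" unfolding powr_add[symmetric] by simp
    finally show ?thesis .
  qed
  have "\<bar>potential_deriv p lam \<beta> s b\<bar> \<le> \<bar>lam * s\<bar> + \<bar>\<bar>s\<bar> powr (p - 2) * s\<bar> + \<bar>\<beta> * (\<bar>s\<bar> powr (p / 2
    - 2) * s) * \<bar>b\<bar> powr (p / 2)\<bar>"
    unfolding potential_deriv_def by linarith
  also have "\<dots> = \<bar>lam\<bar> * \<bar>s\<bar> + \<bar>s\<bar> powr (p - 1) + \<bar>\<beta>\<bar> * (\<bar>s\<bar> powr (p / 2 - 1) * \<bar>b\<bar> powr (p / 2))"
    using e[of p] e[of "p / 2"] by (simp add: abs_mult)
  also have "\<dots> \<le> \<bar>lam\<bar> * m powr (p - 1) + m powr (p - 1) + \<bar>\<beta>\<bar> * m powr (p - 1)"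
    by (intro add_mono mult_left_mono 1 2 3) auto
  finally show ?thesis by (simp add: algebra_simps)
qed

lemma sum_powr_le:
  fixes a b c d :: real
  assumes "a \<ge> 0" "b \<ge> 0" "c \<ge> 0" "d \<ge> 0" "p > 0"
  shows "(a + b + c + d) powr p \<le> 4 powr p * (a powr p + b powr p + c powr p + d powr p)"
proof -
  define m where "m = max (max a b) (max c d)"
  have "(a + b + c + d) powr p \<le> (4 * m) powr p" using assms by (intro powr_mono2) (auto simp: m_def)
  also have "\<dots> = 4 powr p * m powr p" using assms by (simp add: powr_mult m_def)
  also have "m powr p \<le> a powr p + b powr p + c powr p + d powr p"
  proof -
    have "m = a \<or> m = b \<or> m = c \<or> m = d" by (auto simp: m_def max_def)
    then show ?thesis by (auto simp: add_increasing add_increasing2)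
  qed
  finally show ?thesis by (simp add: mult_left_mono)
qed

locale dirichlet_system =
  fixes \<Omega> :: "'a::euclidean_space set" and p :: real
  assumes open_\<Omega>: "open \<Omega>" and bounded_\<Omega>: "bounded \<Omega>"
    and p_gt_2: "2 < p" and p_subcritical: "ereal p < critical_exponent DIM('a)"
begin

abbreviation "M \<equiv> lebesgue_on \<Omega>"

definition energy :: "('a \<Rightarrow> real) \<Rightarrow> real" where
  "energy u = (norm_L2 M (weak_grad \<Omega> u))\<^sup>2"

sublocale finite_measure M
proof
  have "emeasure lebesgue \<Omega> < \<infinity>"
    using emeasure_bounded_finite[OF bounded_\<Omega>] open_\<Omega> by simp
  then show "emeasure M (space M) \<noteq> \<infinity>"
    using open_\<Omega> by (subst emeasure_restrict_space) auto
qed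

lemma H10_measurable [measurable_dest]: "u \<in> H10 \<Omega> \<Longrightarrow> u \<in> borel_measurable M"
  by (rule L2D[OF H10_L2])

lemma integrable_powr: "u \<in> H10 \<Omega> \<Longrightarrow> integrable M (\<lambda>x. \<bar>u x\<bar> powr p)"
  using H10_sobolev[OF open_\<Omega>] p_gt_2 p_subcritical by simp

lemma integrable_sq: "u \<in> H10 \<Omega> \<Longrightarrow> integrable M (\<lambda>x. (u x)\<^sup>2)"
  using L2_integrable[OF H10_L2] by simp

lemma integrable_coupling:
  assumes "u \<in> H10 \<Omega>" "v \<in> H10 \<Omega>"
  shows "integrable M (\<lambda>x. \<bar>u x\<bar> powr (p / 2) * \<bar>v x\<bar> powr (p / 2))"
proof (rule Bochner_Integration.integrable_bound)
  show "integrable M (\<lambda>x. \<bar>u x\<bar> powr p + \<bar>v x\<bar> powr p)" using integrable_powr assms by simp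
  show "AE x in M. norm (\<bar>u x\<bar> powr (p / 2) * \<bar>v x\<bar> powr (p / 2)) \<le> norm (\<bar>u x\<bar> powr p + \<bar>v x\<bar> powr p)"
  proof (intro AE_I2)
    fix x
    have "0 \<le> \<bar>u x\<bar> powr (p / 2) * \<bar>v x\<bar> powr (p / 2)" by simp
    then have "\<bar>u x\<bar> powr (p / 2) * \<bar>v x\<bar> powr (p / 2) \<le> \<bar>u x\<bar> powr p + \<bar>v x\<bar> powr p"
      using powr_half_product_le[of "u x" p "v x"] by linarith
    then show "norm (\<bar>u x\<bar> powr (p / 2) * \<bar>v x\<bar> powr (p / 2)) \<le> norm (\<bar>u x\<bar> powr p + \<bar>v x\<bar> powr p)"
      by simp
  qed
qed (use assms in measurable)

lemma integrable_potential:
  assumes "u \<in> H10 \<Omega>" "v \<in> H10 \<Omega>"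
  shows "integrable M (\<lambda>x. potential p lam1 lam2 \<beta> (u x) (v x))"
  unfolding potential_def
  using integrable_sq[OF assms(1)] integrable_sq[OF assms(2)] integrable_powr[OF assms(1)]
    integrable_powr[OF assms(2)] integrable_coupling[OF assms]
  by simp

lemma quad_part_eq:
  assumes "u \<in> H10 \<Omega>" "v \<in> H10 \<Omega>"
  shows "quad_part \<Omega> lam1 lam2 u v = energy u - lam1 * (norm_L2 M u)\<^sup>2 + energy v - lam2 * (norm_L2 M v)\<^sup>2"
  unfolding quad_part_def energy_def norm_L2_sq
  using integrable_sq[OF assms(1)] integrable_sq[OF assms(2)]
    L2_integrable[OF weak_grad_L2[OF open_\<Omega> assms(1)]] L2_integrable[OF weak_grad_L2[OF open_\<Omega> assms(2)]]
  by simp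

lemma power_part_eq:
  assumes "u \<in> H10 \<Omega>" "v \<in> H10 \<Omega>"
  shows "power_part \<Omega> p u v = (LINT x|M. \<bar>u x\<bar> powr p) + (LINT x|M. \<bar>v x\<bar> powr p)"
  unfolding power_part_def using assms by (simp add: integrable_powr)

lemma J_energy_eq_potential:
  assumes "u \<in> H10 \<Omega>" "v \<in> H10 \<Omega>"
  shows "J_energy \<Omega> p lam1 lam2 \<beta> u v =
    1 / 2 * energy u + 1 / 2 * energy v + (LINT x|M. potential p lam1 lam2 \<beta> (u x) (v x))"
  unfolding J_energy_def quad_part_eq[OF assms] power_part_eq[OF assms] coupling_part_def potential_def norm_L2_sq
  using integrable_sq[OF assms(1)] integrable_sq[OF assms(2)] integrable_powr[OF assms(1)]
    integrable_powr[OF assms(2)] integrable_coupling[OF assms]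
  by (simp add: algebra_simps)

lemma J_energy_swap:
  assumes "u \<in> H10 \<Omega>" "v \<in> H10 \<Omega>"
  shows "J_energy \<Omega> p lam1 lam2 \<beta> u v = J_energy \<Omega> p lam2 lam1 \<beta> v u"
  unfolding J_energy_def quad_part_eq[OF assms] quad_part_eq[OF assms(2,1)] power_part_eq[OF assms]
    power_part_eq[OF assms(2,1)] coupling_part_def
  by (simp add: mult.commute algebra_simps)

lemma J_energy_coercive:
  assumes "\<beta> < 1"
  obtains B where "\<And>u v. u \<in> H10 \<Omega> \<Longrightarrow> v \<in> H10 \<Omega> \<Longrightarrow>
    1 / 2 * energy u + 1 / 2 * energy v + (norm_L2 M u)\<^sup>2 + (norm_L2 M v)\<^sup>2 \<le> J_energy \<Omega> p lam1 lam2 \<beta> u v + B"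
proof -
  obtain C where C: "C \<ge> 0" "\<And>a b. a\<^sup>2 + b\<^sup>2 \<le> potential p lam1 lam2 \<beta> a b + C"
    using potential_coercive[OF p_gt_2 assms] by metis
  show thesis
  proof (rule that)
    fix u v assume uv: "u \<in> H10 \<Omega>" "v \<in> H10 \<Omega>"
    have "(norm_L2 M u)\<^sup>2 + (norm_L2 M v)\<^sup>2 = (LINT x|M. (u x)\<^sup>2 + (v x)\<^sup>2)"
      using integrable_sq uv by (simp add: norm_L2_sq)
    also have "\<dots> \<le> (LINT x|M. potential p lam1 lam2 \<beta> (u x) (v x) + C)"
      using integrable_sq uv integrable_potential[OF uv] C(2) by (intro integral_mono) auto
    also have "\<dots> = (LINT x|M. potential p lam1 lam2 \<beta> (u x) (v x)) + (LINT x|M. C)"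
      using integrable_potential[OF uv] by simp
    finally show "1 / 2 * energy u + 1 / 2 * energy v + (norm_L2 M u)\<^sup>2 + (norm_L2 M v)\<^sup>2 \<le>
        J_energy \<Omega> p lam1 lam2 \<beta> u v + (LINT x|M. C)"
      unfolding J_energy_eq_potential[OF uv] by linarith
  qed
qed

text \<open>
  The direct method. Fatou's lemma applies to the potential because a constant makes it non-negative and \<open>\<Omega>\<close>
  has finite measure.
\<close>

lemma minimiser_exists:
  assumes \<beta>: "\<beta> < 1"
  obtains u v where "u \<in> H10 \<Omega>" "v \<in> H10 \<Omega>"
    "\<And>u' v'. u' \<in> H10 \<Omega> \<Longrightarrow> v' \<in> H10 \<Omega> \<Longrightarrow>
      J_energy \<Omega> p lam1 lam2 \<beta> u v \<le> J_energy \<Omega> p lam1 lam2 \<beta> u' v'"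
proof -
  let ?J = "J_energy \<Omega> p lam1 lam2 \<beta>" and ?F = "potential p lam1 lam2 \<beta>"
  obtain B where B: "\<And>u v. u \<in> H10 \<Omega> \<Longrightarrow> v \<in> H10 \<Omega> \<Longrightarrow>
    1 / 2 * energy u + 1 / 2 * energy v + (norm_L2 M u)\<^sup>2 + (norm_L2 M v)\<^sup>2 \<le> ?J u v + B"
    using J_energy_coercive[OF \<beta>] by blast
  obtain C where C: "C \<ge> 0" "\<And>a b. a\<^sup>2 + b\<^sup>2 \<le> ?F a b + C"
    using potential_coercive[OF p_gt_2 \<beta>] by metis
  have FC: "?F a b + C \<ge> 0" for a b using C(2)[of a b] sum_power2_ge_zero[of a b] by linarith
  have e0: "energy u \<ge> 0" for u by (simp add: energy_def)
  define S where "S = {?J u v | u v. u \<in> H10 \<Omega> \<and> v \<in> H10 \<Omega>}"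
  have bdd: "bdd_below S"
  proof (rule bdd_belowI[of _ "- B"])
    fix y assume "y \<in> S"
    then obtain u v where uv: "u \<in> H10 \<Omega>" "v \<in> H10 \<Omega>" "y = ?J u v" by (auto simp: S_def)
    show "- B \<le> y" using B[OF uv(1,2)] e0[of u] e0[of v] uv(3) sum_power2_ge_zero[of "norm_L2 M u"
        "norm_L2 M v"] by linarith
  qed
  have zero: "(\<lambda>x. 0) \<in> H10 \<Omega>"
  proof (rule H10_of_graph(1)[OF open_\<Omega> H10_graph_test_fun])
    show "(\<lambda>x. 0) \<in> test_funs \<Omega>" by (rule test_funI[of _ "{}"]) (auto simp: Cdiff_const)
  qed simp
  then have ne: "S \<noteq> {}" by (auto simp: S_def)
  define m where "m = Inf S"
  have m_le: "m \<le> ?J u v" if "u \<in> H10 \<Omega>" "v \<in> H10 \<Omega>" for u v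
    unfolding m_def by (rule cInf_lower[OF _ bdd]) (use that in \<open>auto simp: S_def\<close>)
  have "\<exists>u v. u \<in> H10 \<Omega> \<and> v \<in> H10 \<Omega> \<and> ?J u v < m + inverse (real (Suc n))" for n
  proof -
    have "\<exists>y\<in>S. y < m + inverse (real (Suc n))" unfolding m_def by (intro cInf_lessD[OF ne]) simp
    then show ?thesis by (auto simp: S_def)
  qed
  then obtain u v where u: "\<And>n. u n \<in> H10 \<Omega>" and v: "\<And>n. v n \<in> H10 \<Omega>"
    and Jn: "\<And>n. ?J (u n) (v n) < m + inverse (real (Suc n))" by metis
  define K where "K = sqrt (2 * (m + 1 + B))"
  have bounds: "norm_L2 M (u n) \<le> K" "norm_L2 M (weak_grad \<Omega> (u n)) \<le> K" "norm_L2 M (v n) \<le> K"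
    "norm_L2 M (weak_grad \<Omega> (v n)) \<le> K" for n
  proof -
    have "inverse (real (Suc n)) \<le> 1" by (simp add: inverse_le_1_iff)
    then have *: "1 / 2 * energy (u n) + 1 / 2 * energy (v n) + (norm_L2 M (u n))\<^sup>2 + (norm_L2 M (v n))\<^sup>2
        \<le> m + 1 + B"
      using B[OF u[of n] v[of n]] Jn[of n] by linarith
    have n: "0 \<le> (norm_L2 M (u n))\<^sup>2" "0 \<le> (norm_L2 M (v n))\<^sup>2" by simp_all
    have half: "s \<le> 2 * t" if "1 / 2 * x + 1 / 2 * y + z + w \<le> t" "s = x \<or> s = y \<or> s = z \<or> s = w"
      "0 \<le> x" "0 \<le> y" "0 \<le> z" "0 \<le> w" for s t x y z w :: real
      using that by auto
    note sq = half[OF * _ e0 e0 n, unfolded energy_def]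
    show "norm_L2 M (u n) \<le> K" unfolding K_def by (rule real_le_rsqrt, rule sq) simp
    show "norm_L2 M (weak_grad \<Omega> (u n)) \<le> K" unfolding K_def by (rule real_le_rsqrt, rule sq) simp
    show "norm_L2 M (v n) \<le> K" unfolding K_def by (rule real_le_rsqrt, rule sq) simp
    show "norm_L2 M (weak_grad \<Omega> (v n)) \<le> K" unfolding K_def by (rule real_le_rsqrt, rule sq) simp
  qed
  obtain r1 u\<^sub>0 a where r1: "strict_mono (r1 :: nat \<Rightarrow> nat)" and u0: "u\<^sub>0 \<in> H10 \<Omega>"
    and "(\<lambda>n. norm_L2 M (\<lambda>x. u (r1 n) x - u\<^sub>0 x)) \<longlonglongrightarrow> 0"
    and uae: "AE x in M. (\<lambda>n. u (r1 n) x) \<longlonglongrightarrow> u\<^sub>0 x"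
    and ua: "(\<lambda>n. norm_L2 M (weak_grad \<Omega> (u (r1 n)))) \<longlonglongrightarrow> a" "norm_L2 M (weak_grad \<Omega> u\<^sub>0) \<le> a"
    by (rule H10_bounded_subsequence[OF open_\<Omega> bounded_\<Omega> u bounds(1,2)]) (rule that)
  obtain r2 v\<^sub>0 b where r2: "strict_mono (r2 :: nat \<Rightarrow> nat)" and v0: "v\<^sub>0 \<in> H10 \<Omega>"
    and "(\<lambda>n. norm_L2 M (\<lambda>x. v (r1 (r2 n)) x - v\<^sub>0 x)) \<longlonglongrightarrow> 0"
    and vae: "AE x in M. (\<lambda>n. v (r1 (r2 n)) x) \<longlonglongrightarrow> v\<^sub>0 x"
    and vb: "(\<lambda>n. norm_L2 M (weak_grad \<Omega> (v (r1 (r2 n))))) \<longlonglongrightarrow> b" "norm_L2 M (weak_grad \<Omega> v\<^sub>0) \<le> b"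
    by (rule H10_bounded_subsequence[OF open_\<Omega> bounded_\<Omega> v bounds(3,4)]) (rule that)
  define r where "r n = r1 (r2 n)" for n
  have r: "strict_mono r" using r1 r2 by (simp add: r_def[abs_def] strict_mono_def)
  have limJ: "(\<lambda>n. ?J (u (r n)) (v (r n))) \<longlonglongrightarrow> m"
  proof (rule tendsto_sandwich[OF _ _ tendsto_const])
    show "\<forall>\<^sub>F n in sequentially. m \<le> ?J (u (r n)) (v (r n))" by (intro always_eventually allI m_le u v)
    show "\<forall>\<^sub>F n in sequentially. ?J (u (r n)) (v (r n)) \<le> m + inverse (real (Suc (r n)))"
      using Jn by (intro always_eventually allI less_imp_le)
    have "(\<lambda>n. m + inverse (real (Suc (r n)))) \<longlonglongrightarrow> m + 0"
      by (intro tendsto_add tendsto_const LIMSEQ_subseq_LIMSEQ[OF LIMSEQ_inverse_real_of_nat r, unfolded o_def])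
    then show "(\<lambda>n. m + inverse (real (Suc (r n)))) \<longlonglongrightarrow> m" by simp
  qed
  have lima: "(\<lambda>n. energy (u (r n))) \<longlonglongrightarrow> a\<^sup>2" unfolding energy_def r_def
    using LIMSEQ_subseq_LIMSEQ[OF ua(1) r2] by (intro tendsto_power) (simp add: o_def)
  have limb: "(\<lambda>n. energy (v (r n))) \<longlonglongrightarrow> b\<^sup>2" unfolding energy_def r_def by (intro tendsto_power vb)
  define c where "c = (LINT x|M. C)"
  have intFC: "integrable M (\<lambda>x. ?F (f x) (g x) + C)" "(LINT x|M. ?F (f x) (g x) + C)
    = (LINT x|M. ?F (f x) (g x)) + c"
    if "f \<in> H10 \<Omega>" "g \<in> H10 \<Omega>" for f g
    using integrable_potential[OF that] by (simp_all add: c_def)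
  have limF: "(\<lambda>n. LINT x|M. ?F (u (r n) x) (v (r n) x) + C) \<longlonglongrightarrow> m - 1/2 * a\<^sup>2 - 1/2 * b\<^sup>2 + c"
  proof -
    have "(\<lambda>n. ?J (u (r n)) (v (r n)) - 1/2 * energy (u (r n)) - 1/2 * energy (v (r n)) + c)
        \<longlonglongrightarrow> m - 1/2 * a\<^sup>2 - 1/2 * b\<^sup>2 + c"
      by (intro tendsto_intros limJ lima limb)
    moreover have "?J (u (r n)) (v (r n)) - 1/2 * energy (u (r n)) - 1/2 * energy (v (r n)) + c
        = (LINT x|M. ?F (u (r n) x) (v (r n) x) + C)" for n
      unfolding J_energy_eq_potential[OF u v] intFC(2)[OF u v] by simp
    ultimately show ?thesis by simp
  qed
  have nn: "(\<integral>\<^sup>+x. ennreal (?F (f x) (g x) + C) \<partial>M) = ennreal (LINT x|M. ?F (f x) (g x) + C)"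
    if "f \<in> H10 \<Omega>" "g \<in> H10 \<Omega>" for f g
    by (rule nn_integral_eq_integral[OF intFC(1)[OF that]]) (use FC in auto)
  note um = H10_measurable[OF u] and vm = H10_measurable[OF v]
  have "AE x in M. ennreal (?F (u\<^sub>0 x) (v\<^sub>0 x) + C) = liminf (\<lambda>n. ennreal (?F (u (r n) x) (v (r n) x) + C))"
    using uae vae
  proof eventually_elim
    case (elim x)
    have "(\<lambda>n. u (r n) x) \<longlonglongrightarrow> u\<^sub>0 x" using LIMSEQ_subseq_LIMSEQ[OF elim(1) r2] by (simp add: r_def o_def)
    moreover have "(\<lambda>n. v (r n) x) \<longlonglongrightarrow> v\<^sub>0 x" using elim(2) by (simp add: r_def)
    ultimately have "(\<lambda>n. ennreal (?F (u (r n) x) (v (r n) x) + C)) \<longlonglongrightarrow> ennreal (?F (u\<^sub>0 x) (v\<^sub>0 x) + C)"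
      unfolding potential_def using p_gt_2
      by (intro tendsto_ennrealI tendsto_intros tendsto_powr') auto
    from lim_imp_Liminf[OF _ this] show ?case by simp
  qed
  then have "(\<integral>\<^sup>+x. ennreal (?F (u\<^sub>0 x) (v\<^sub>0 x) + C) \<partial>M)
    = (\<integral>\<^sup>+x. liminf (\<lambda>n. ennreal (?F (u (r n) x) (v (r n) x) + C)) \<partial>M)"
    by (rule nn_integral_cong_AE)
  also have "\<dots> \<le> liminf (\<lambda>n. \<integral>\<^sup>+x. ennreal (?F (u (r n) x) (v (r n) x) + C) \<partial>M)"
    unfolding potential_def by (rule nn_integral_liminf) (use um vm in measurable)
  also have "\<dots> = ennreal (m - 1/2 * a\<^sup>2 - 1/2 * b\<^sup>2 + c)"
    unfolding nn[OF u v] by (intro lim_imp_Liminf tendsto_ennrealI limF) simp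
  finally have "ennreal (LINT x|M. ?F (u\<^sub>0 x) (v\<^sub>0 x) + C) \<le> ennreal (m - 1/2 * a\<^sup>2 - 1/2 * b\<^sup>2 + c)"
    unfolding nn[OF u0 v0] .
  moreover have "0 \<le> m - 1/2 * a\<^sup>2 - 1/2 * b\<^sup>2 + c"
    by (rule LIMSEQ_le_const[OF limF]) (use FC in \<open>auto intro!: integral_nonneg_AE\<close>)
  ultimately have "(LINT x|M. ?F (u\<^sub>0 x) (v\<^sub>0 x) + C) \<le> m - 1/2 * a\<^sup>2 - 1/2 * b\<^sup>2 + c"
    by (simp add: ennreal_le_iff)
  then have "(LINT x|M. ?F (u\<^sub>0 x) (v\<^sub>0 x)) \<le> m - 1/2 * a\<^sup>2 - 1/2 * b\<^sup>2"
    unfolding intFC(2)[OF u0 v0] by simp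
  moreover have "energy u\<^sub>0 \<le> a\<^sup>2" "energy v\<^sub>0 \<le> b\<^sup>2"
    unfolding energy_def by (intro power_mono ua vb norm_L2_nonneg)+
  ultimately have "?J u\<^sub>0 v\<^sub>0 \<le> m" unfolding J_energy_eq_potential[OF u0 v0] by simp
  then show thesis using that[OF u0 v0] m_le by (meson order_trans)
qed

section \<open>Euler-Lagrange equations and ground states\<close>

text \<open>
  By the mean value theorem the difference quotients are bounded by a multiple of \<open>m\<^sup>p\<close> with
  \<open>m = 1 + \<bar>u\<bar> + \<bar>\<phi>\<bar> + \<bar>v\<bar>\<close>, which is integrable by the Sobolev embedding.
\<close>

lemma potential_first_variation:
  assumes u: "u \<in> H10 \<Omega>" and v: "v \<in> H10 \<Omega>" and \<phi>: "\<phi> \<in> H10 \<Omega>"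
  shows "(\<lambda>n. LINT x|M. real (Suc n) *
      (potential p lam1 lam2 \<beta> (u x + inverse (real (Suc n)) * \<phi> x) (v x)
        - potential p lam1 lam2 \<beta> (u x) (v x)))
    \<longlonglongrightarrow> (LINT x|M. potential_deriv p lam1 \<beta> (u x) (v x) * \<phi> x)"
proof -
  let ?F = "potential p lam1 lam2 \<beta>" and ?D = "potential_deriv p lam1 \<beta>"
  define c where "c = (\<bar>lam1\<bar> + 1 + \<bar>\<beta>\<bar>) * 4 powr p"
  have c: "c \<ge> 0" by (simp add: c_def)
  note [measurable] = H10_measurable[OF u] H10_measurable[OF v] H10_measurable[OF \<phi>]
  show ?thesis
  proof (rule integral_dominated_convergence
      [where w = "\<lambda>x. c * (1 + \<bar>u x\<bar> powr p + \<bar>\<phi> x\<bar> powr p + \<bar>v x\<bar> powr p)"])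
    show "(\<lambda>x. ?D (u x) (v x) * \<phi> x) \<in> borel_measurable M"
      unfolding potential_deriv_def by measurable
    show "(\<lambda>x. real (Suc n) * (?F (u x + inverse (real (Suc n)) * \<phi> x) (v x) - ?F (u x) (v x)))
        \<in> borel_measurable M" for n
      unfolding potential_def by measurable
    show "integrable M (\<lambda>x. c * (1 + \<bar>u x\<bar> powr p + \<bar>\<phi> x\<bar> powr p + \<bar>v x\<bar> powr p))"
      using integrable_powr[OF u] integrable_powr[OF v] integrable_powr[OF \<phi>] by simp
    show "AE x in M. (\<lambda>n. real (Suc n) * (?F (u x + inverse (real (Suc n)) * \<phi> x) (v x) - ?F (u x) (v x)))
        \<longlonglongrightarrow> ?D (u x) (v x) * \<phi> x"
    proof (intro AE_I2)
      fix x
      have "((\<lambda>t. ?F (u x + t * \<phi> x) (v x)) has_real_derivative ?D (u x + 0 * \<phi> x) (v x) * \<phi> x) (at 0)"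
        by (rule DERIV_chain2[where g = "\<lambda>t. u x + t * \<phi> x", OF potential_has_derivative[OF p_gt_2]])
           (auto intro!: derivative_eq_intros)
      then have "((\<lambda>h. (?F (u x + h * \<phi> x) (v x) - ?F (u x) (v x)) / h) \<longlongrightarrow> ?D (u x) (v x) * \<phi> x) (at 0)"
        by (simp add: DERIV_def)
      moreover have "filterlim (\<lambda>n. inverse (real (Suc n))) (at 0) sequentially"
        using LIMSEQ_inverse_real_of_nat by (simp add: filterlim_at)
      ultimately have "(\<lambda>n. (?F (u x + inverse (real (Suc n)) * \<phi> x) (v x)
        - ?F (u x) (v x)) / inverse (real (Suc n)))
          \<longlonglongrightarrow> ?D (u x) (v x) * \<phi> x"
        by (rule filterlim_compose)
      then show "(\<lambda>n. real (Suc n) * (?F (u x + inverse (real (Suc n)) * \<phi> x) (v x) - ?F (u x) (v x)))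
          \<longlonglongrightarrow> ?D (u x) (v x) * \<phi> x"
        by (simp add: divide_inverse mult.commute del: of_nat_Suc)
    qed
    fix n
    show "AE x in M. norm (real (Suc n) * (?F (u x + inverse (real (Suc n)) * \<phi> x) (v x) - ?F (u x) (v x)))
        \<le> c * (1 + \<bar>u x\<bar> powr p + \<bar>\<phi> x\<bar> powr p + \<bar>v x\<bar> powr p)"
    proof (intro AE_I2)
      fix x
      define m where "m = 1 + \<bar>u x\<bar> + \<bar>\<phi> x\<bar> + \<bar>v x\<bar>"
      have m: "m \<ge> 1" "\<bar>u x\<bar> \<le> m" "\<bar>v x\<bar> \<le> m" "\<bar>\<phi> x\<bar> \<le> m" "\<bar>u x\<bar> + \<bar>\<phi> x\<bar> \<le> m" by (auto simp: m_def)
      define t where "t = inverse (real (Suc n))"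
      have t: "0 < t" "t \<le> 1" by (simp_all add: t_def inverse_le_1_iff)
      have tm: "\<bar>u x + t * \<phi> x\<bar> \<le> m"
      proof -
        have "\<bar>t * \<phi> x\<bar> \<le> \<bar>\<phi> x\<bar>" using t by (simp add: abs_mult mult_left_le_one_le)
        then show ?thesis using m(5) by linarith
      qed
      have "norm (?F (u x + t * \<phi> x) (v x) - ?F (u x) (v x))
          \<le> ((\<bar>lam1\<bar> + 1 + \<bar>\<beta>\<bar>) * m powr (p - 1)) * norm ((u x + t * \<phi> x) - u x)"
      proof (rule field_differentiable_bound[where S = "{-m..m}" and f' = "\<lambda>s. ?D s (v x)"])
        show "((\<lambda>s. ?F s (v x)) has_field_derivative ?D z (v x)) (at z within {-m..m})" for z
          by (rule has_field_derivative_at_within[OF potential_has_derivative[OF p_gt_2]])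
        show "norm (?D z (v x)) \<le> (\<bar>lam1\<bar> + 1 + \<bar>\<beta>\<bar>) * m powr (p - 1)" if "z \<in> {-m..m}" for z
          using potential_deriv_bound[OF p_gt_2 m(1) _ m(3), of z] that by (simp add: abs_le_iff)
      qed (use m(2) tm in \<open>auto simp: abs_le_iff\<close>)
      also have "\<dots> = t * ((\<bar>lam1\<bar> + 1 + \<bar>\<beta>\<bar>) * (m powr (p - 1) * \<bar>\<phi> x\<bar>))"
        using t by (simp add: abs_mult)
      also have "\<dots> \<le> t * (c * (1 + \<bar>u x\<bar> powr p + \<bar>\<phi> x\<bar> powr p + \<bar>v x\<bar> powr p))"
      proof (rule mult_left_mono)
        have "m powr (p - 1) * \<bar>\<phi> x\<bar> \<le> m powr (p - 1) * m powr 1"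
          using m by (intro mult_left_mono) auto
        also have "\<dots> = m powr p" unfolding powr_add[symmetric] by simp
        also have "\<dots> \<le> 4 powr p * (1 powr p + \<bar>u x\<bar> powr p + \<bar>\<phi> x\<bar> powr p + \<bar>v x\<bar> powr p)"
          unfolding m_def using p_gt_2 by (intro sum_powr_le) auto
        finally have "m powr (p - 1) * \<bar>\<phi> x\<bar> \<le> 4 powr p * (1 + \<bar>u x\<bar> powr p + \<bar>\<phi> x\<bar> powr p + \<bar>v x\<bar> powr p)"
            by simp
        then have "(\<bar>lam1\<bar> + 1 + \<bar>\<beta>\<bar>) * (m powr (p - 1) * \<bar>\<phi> x\<bar>) \<le>
            (\<bar>lam1\<bar> + 1 + \<bar>\<beta>\<bar>) * (4 powr p * (1 + \<bar>u x\<bar> powr p + \<bar>\<phi> x\<bar> powr p + \<bar>v x\<bar> powr p))"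
          by (intro mult_left_mono) auto
        then show "(\<bar>lam1\<bar> + 1 + \<bar>\<beta>\<bar>) * (m powr (p - 1) * \<bar>\<phi> x\<bar>)
            \<le> c * (1 + \<bar>u x\<bar> powr p + \<bar>\<phi> x\<bar> powr p + \<bar>v x\<bar> powr p)"
          by (simp add: c_def mult.assoc)
      qed (use t in simp)
      finally have "real (Suc n) * norm (?F (u x + t * \<phi> x) (v x) - ?F (u x) (v x))
          \<le> real (Suc n) * (t * (c * (1 + \<bar>u x\<bar> powr p + \<bar>\<phi> x\<bar> powr p + \<bar>v x\<bar> powr p)))"
        by (intro mult_left_mono) auto
      also have "\<dots> = c * (1 + \<bar>u x\<bar> powr p + \<bar>\<phi> x\<bar> powr p + \<bar>v x\<bar> powr p)"
        by (simp add: t_def del: of_nat_Suc)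
      finally show "norm (real (Suc n) * (?F (u x + inverse (real (Suc n)) * \<phi> x) (v x) - ?F (u x) (v x)))
          \<le> c * (1 + \<bar>u x\<bar> powr p + \<bar>\<phi> x\<bar> powr p + \<bar>v x\<bar> powr p)"
        unfolding t_def[symmetric] by (simp add: abs_mult del: of_nat_Suc)
    qed
  qed
qed

text \<open>
  One-sided difference quotients of the energy give an inequality; applied to \<open>\<phi>\<close> and to \<open>- \<phi>\<close> it becomes an
  equation.
\<close>

lemma euler_lagrange:
  assumes u: "u \<in> H10 \<Omega>" and v: "v \<in> H10 \<Omega>"
    and min: "\<And>w. w \<in> H10 \<Omega> \<Longrightarrow> J_energy \<Omega> p lam1 lam2 \<beta> u v \<le> J_energy \<Omega> p lam1 lam2 \<beta> w v"
    and \<phi>: "\<phi> \<in> H10 \<Omega>"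
  shows "(LINT x|M. weak_grad \<Omega> u x \<bullet> weak_grad \<Omega> \<phi> x)
    = - (LINT x|M. potential_deriv p lam1 \<beta> (u x) (v x) * \<phi> x)"
proof -
  let ?F = "potential p lam1 lam2 \<beta>" and ?D = "potential_deriv p lam1 \<beta>"
  have one_sided: "0 \<le> (LINT x|M. weak_grad \<Omega> u x \<bullet> weak_grad \<Omega> \<psi> x) + (LINT x|M. ?D (u x) (v x) * \<psi> x)"
    if \<psi>: "\<psi> \<in> H10 \<Omega>" for \<psi>
  proof -
    define G where "G = (LINT x|M. weak_grad \<Omega> u x \<bullet> weak_grad \<Omega> \<psi> x)"
    define t where "t n = inverse (real (Suc n))" for n
    have t: "t n > 0" "real (Suc n) * t n = 1" for n by (simp_all add: t_def)
    have t0: "t \<longlonglongrightarrow> 0" unfolding t_def[abs_def] by (rule LIMSEQ_inverse_real_of_nat)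
    have "0 \<le> G + t n / 2 * energy \<psi> + (LINT x|M. real (Suc n) * (?F (u x + t n * \<psi> x) (v x)
        - ?F (u x) (v x)))" for n
    proof -
      note w = H10_lincomb(1)[OF open_\<Omega> u \<psi>, of "t n"]
      have "energy (\<lambda>x. u x + t n * \<psi> x) = energy u + 2 * t n * G + (t n)\<^sup>2 * energy \<psi>"
        unfolding energy_def G_def by (rule norm_L2_sq_weak_grad_lincomb[OF open_\<Omega> u \<psi>])
      then have "0 \<le> t n * G + (t n)\<^sup>2 / 2 * energy \<psi> +
          (LINT x|M. ?F (u x + t n * \<psi> x) (v x) - ?F (u x) (v x))"
        using min[OF w] integrable_potential[OF u v, of lam1 lam2 \<beta>] integrable_potential[OF w v, of lam1 lam2 \<beta>]
        unfolding J_energy_eq_potential[OF u v] J_energy_eq_potential[OF w v]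
        by (simp add: add_divide_distrib)
      then have "0 \<le> real (Suc n) * (t n * G + (t n)\<^sup>2 / 2 * energy \<psi> +
          (LINT x|M. ?F (u x + t n * \<psi> x) (v x) - ?F (u x) (v x)))"
        by (intro mult_nonneg_nonneg) auto
      also have "\<dots> = (real (Suc n) * t n) * G + (real (Suc n) * t n) * (t n / 2) * energy \<psi> +
          real (Suc n) * (LINT x|M. ?F (u x + t n * \<psi> x) (v x) - ?F (u x) (v x))"
        by (simp add: distrib_left power2_eq_square mult.assoc del: of_nat_Suc)
      finally show ?thesis unfolding t(2) by (simp del: of_nat_Suc)
    qed
    moreover have "(\<lambda>n. G + t n / 2 * energy \<psi> + (LINT x|M. real (Suc n) * (?F (u x + t n * \<psi> x) (v x)
        - ?F (u x) (v x))))
        \<longlonglongrightarrow> G + 0 / 2 * energy \<psi> + (LINT x|M. ?D (u x) (v x) * \<psi> x)"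
      by (intro tendsto_intros t0 potential_first_variation[OF u v \<psi>, folded t_def]) simp
    ultimately have "0 \<le> G + 0 / 2 * energy \<psi> + (LINT x|M. ?D (u x) (v x) * \<psi> x)"
      by (intro LIMSEQ_le_const) auto
    then show ?thesis by (simp add: G_def)
  qed
  define \<psi> where "\<psi> x = - 1 * \<phi> x" for x
  have \<psi>: "\<psi> \<in> H10 \<Omega>" unfolding \<psi>_def by (rule H10_scale(1)[OF open_\<Omega> \<phi>])
  have "(LINT x|M. weak_grad \<Omega> u x \<bullet> weak_grad \<Omega> \<psi> x) = (LINT x|M. - (weak_grad \<Omega> u x \<bullet> weak_grad \<Omega> \<phi> x))"
  proof (rule integral_cong_AE)
    have eq: "(\<lambda>x. \<phi> x + (- 2) * \<phi> x) = \<psi>" by (auto simp: \<psi>_def)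
    show "AE x in M. weak_grad \<Omega> u x \<bullet> weak_grad \<Omega> \<psi> x = - (weak_grad \<Omega> u x \<bullet> weak_grad \<Omega> \<phi> x)"
      using H10_lincomb(2)[OF open_\<Omega> \<phi> \<phi>, of "- 2"] unfolding eq
      by eventually_elim (simp add: inner_add_right inner_diff_right)
  qed (use L2D[OF weak_grad_L2[OF open_\<Omega> u]] L2D[OF weak_grad_L2[OF open_\<Omega> \<psi>]] L2D[OF weak_grad_L2[OF open_\<Omega> \<phi>]] in measurable)
  then have "0 \<le> - (LINT x|M. weak_grad \<Omega> u x \<bullet> weak_grad \<Omega> \<phi> x) - (LINT x|M. ?D (u x) (v x) * \<phi> x)"
    using one_sided[OF \<psi>] by (simp add: \<psi>_def)
  then show ?thesis using one_sided[OF \<phi>] by linarith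
qed

text \<open>
  The second equation is the first one for the system with exchanged components.
\<close>

lemma minimiser_LS_solution:
  assumes u: "u \<in> H10 \<Omega>" and v: "v \<in> H10 \<Omega>"
    and min: "\<And>u' v'. u' \<in> H10 \<Omega> \<Longrightarrow> v' \<in> H10 \<Omega> \<Longrightarrow>
      J_energy \<Omega> p lam1 lam2 \<beta> u v \<le> J_energy \<Omega> p lam1 lam2 \<beta> u' v'"
  shows "LS_solution \<Omega> p lam1 lam2 \<beta> u v"
  unfolding LS_solution_def
proof (intro conjI ballI u v)
  fix \<phi> assume \<phi>: "\<phi> \<in> H10 \<Omega>"
  have "(LINT x|M. weak_grad \<Omega> u x \<bullet> weak_grad \<Omega> \<phi> x)
    = - (LINT x|M. potential_deriv p lam1 \<beta> (u x) (v x) * \<phi> x)"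
    by (rule euler_lagrange[OF u v min[OF _ v] \<phi>])
  also have "\<dots> = (LINT x|M. - (potential_deriv p lam1 \<beta> (u x) (v x) * \<phi> x))" by simp
  also have "\<dots> = (LINT x|M. (lam1 * u x - \<bar>u x\<bar> powr (p - 2) * u x
          + \<beta> * \<bar>u x\<bar> powr (p / 2 - 2) * u x * \<bar>v x\<bar> powr (p / 2)) * \<phi> x)"
    by (intro Bochner_Integration.integral_cong refl) (simp add: potential_deriv_def algebra_simps)
  finally show "(LINT x|M. weak_grad \<Omega> u x \<bullet> weak_grad \<Omega> \<phi> x) = \<dots>" .
next
  fix \<phi> assume \<phi>: "\<phi> \<in> H10 \<Omega>"
  have "J_energy \<Omega> p lam2 lam1 \<beta> v u \<le> J_energy \<Omega> p lam2 lam1 \<beta> w u" if "w \<in> H10 \<Omega>" for w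
    using min[OF u that] unfolding J_energy_swap[OF u v] J_energy_swap[OF u that] .
  then have "(LINT x|M. weak_grad \<Omega> v x \<bullet> weak_grad \<Omega> \<phi> x)
    = - (LINT x|M. potential_deriv p lam2 \<beta> (v x) (u x) * \<phi> x)"
    by (rule euler_lagrange[OF v u _ \<phi>])
  also have "\<dots> = (LINT x|M. - (potential_deriv p lam2 \<beta> (v x) (u x) * \<phi> x))" by simp
  also have "\<dots> = (LINT x|M. (lam2 * v x - \<bar>v x\<bar> powr (p - 2) * v x
          + \<beta> * \<bar>u x\<bar> powr (p / 2) * \<bar>v x\<bar> powr (p / 2 - 2) * v x) * \<phi> x)"
    by (intro Bochner_Integration.integral_cong refl) (simp add: potential_deriv_def algebra_simps)
  finally show "(LINT x|M. weak_grad \<Omega> v x \<bullet> weak_grad \<Omega> \<phi> x) = \<dots>" .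
qed

lemma J_energy_ray:
  assumes u: "u \<in> H10 \<Omega>" and v: "v \<in> H10 \<Omega>" and t: "t > 0"
  shows "J_energy \<Omega> p lam1 lam2 \<beta> (\<lambda>x. t * u x) (\<lambda>x. t * v x) =
    t\<^sup>2 * (quad_part \<Omega> lam1 lam2 u v / 2) +
    t powr p * ((power_part \<Omega> p u v - 2 * \<beta> * coupling_part \<Omega> p u v) / p)"
proof -
  note tu = H10_scale(1)[OF open_\<Omega> u, of t] and tv = H10_scale(1)[OF open_\<Omega> v, of t]
  have q: "quad_part \<Omega> lam1 lam2 (\<lambda>x. t * u x) (\<lambda>x. t * v x) = t\<^sup>2 * quad_part \<Omega> lam1 lam2 u v"
    unfolding quad_part_eq[OF tu tv] quad_part_eq[OF u v] energy_def H10_scale(2)[OF open_\<Omega> u] H10_scale(2)[OF open_\<Omega> v]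
    using norm_L2_scaleR[of M t u] norm_L2_scaleR[of M t v] by (simp add: power_mult_distrib algebra_simps)
  have P: "power_part \<Omega> p (\<lambda>x. t * u x) (\<lambda>x. t * v x) = t powr p * power_part \<Omega> p u v"
    unfolding power_part_eq[OF tu tv] power_part_eq[OF u v] using t
    by (simp add: abs_mult powr_mult distrib_left)
  have "t powr (p / 2) * t powr (p / 2) = t powr p" unfolding powr_add[symmetric] by simp
  then have "\<bar>t * a\<bar> powr (p / 2) * \<bar>t * b\<bar> powr (p / 2)
    = t powr p * (\<bar>a\<bar> powr (p / 2) * \<bar>b\<bar> powr (p / 2))" for a b
    using t by (simp add: abs_mult powr_mult mult.assoc mult.left_commute)
  then have X: "coupling_part \<Omega> p (\<lambda>x. t * u x) (\<lambda>x. t * v x) = t powr p * coupling_part \<Omega> p u v"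
    unfolding coupling_part_def by simp
  show ?thesis unfolding J_energy_def q P X
    by (simp add: diff_divide_distrib algebra_simps)
qed

lemma ray_critical_point:
  fixes Q R :: real
  assumes "\<And>t. t > 0 \<Longrightarrow> Q / 2 + R / p \<le> t\<^sup>2 * (Q / 2) + t powr p * (R / p)"
  shows "Q + R = 0"
proof -
  have D: "((\<lambda>t. t\<^sup>2 * (Q / 2) + t powr p * (R / p)) has_real_derivative
      (2 * 1 * (Q / 2) + p * 1 powr (p - 1) * (R / p))) (at 1)"
    by (auto intro!: derivative_eq_intros)
  have "2 * 1 * (Q / 2) + p * 1 powr (p - 1) * (R / p) = 0"
    by (rule DERIV_local_min[OF D, of 1]) (use assms in auto)
  then show ?thesis using p_gt_2 by simp
qed

text \<open>
  A minimiser minimises along its own ray, and the derivative of the energy there is the Nehari functional.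
\<close>

lemma minimiser_on_nehari:
  assumes u: "u \<in> H10 \<Omega>" and v: "v \<in> H10 \<Omega>"
    and min: "\<And>u' v'. u' \<in> H10 \<Omega> \<Longrightarrow> v' \<in> H10 \<Omega> \<Longrightarrow>
      J_energy \<Omega> p lam1 lam2 \<beta> u v \<le> J_energy \<Omega> p lam1 lam2 \<beta> u' v'"
    and nz: "\<not> (ae_zero \<Omega> u \<and> ae_zero \<Omega> v)"
  shows "(u, v) \<in> nehari_set \<Omega> p lam1 lam2 \<beta>"
    "ereal (J_energy \<Omega> p lam1 lam2 \<beta> u v) = nehari_level \<Omega> p lam1 lam2 \<beta>"
proof -
  have "quad_part \<Omega> lam1 lam2 u v + (power_part \<Omega> p u v - 2 * \<beta> * coupling_part \<Omega> p u v) = 0"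
  proof (rule ray_critical_point)
    fix t :: real assume t: "t > 0"
    show "quad_part \<Omega> lam1 lam2 u v / 2 + (power_part \<Omega> p u v - 2 * \<beta> * coupling_part \<Omega> p u v) / p \<le>
      t\<^sup>2 * (quad_part \<Omega> lam1 lam2 u v / 2) + t powr p * ((power_part \<Omega> p u v
        - 2 * \<beta> * coupling_part \<Omega> p u v) / p)"
      using min[OF H10_scale(1)[OF open_\<Omega> u, of t] H10_scale(1)[OF open_\<Omega> v, of t]]
      unfolding J_energy_ray[OF u v t] using J_energy_ray[OF u v zero_less_one] by simp
  qed
  then show N: "(u, v) \<in> nehari_set \<Omega> p lam1 lam2 \<beta>" using u v nz by (simp add: nehari_set_def)
  show "ereal (J_energy \<Omega> p lam1 lam2 \<beta> u v) = nehari_level \<Omega> p lam1 lam2 \<beta>"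
    unfolding nehari_level_def
  proof (rule antisym)
    show "ereal (J_energy \<Omega> p lam1 lam2 \<beta> u v)
        \<le> (INF (u, v)\<in>nehari_set \<Omega> p lam1 lam2 \<beta>. ereal (J_energy \<Omega> p lam1 lam2 \<beta> u v))"
      by (rule INF_greatest) (auto simp: nehari_set_def intro!: min)
    show "(INF (u, v)\<in>nehari_set \<Omega> p lam1 lam2 \<beta>. ereal (J_energy \<Omega> p lam1 lam2 \<beta> u v))
        \<le> ereal (J_energy \<Omega> p lam1 lam2 \<beta> u v)"
      by (rule INF_lower2[OF N]) simp
  qed
qed

text \<open>
  The energy of a pair whose other component is zero.
\<close>

definition scalar_energy :: "real \<Rightarrow> ('a \<Rightarrow> real) \<Rightarrow> real" where
  "scalar_energy lam u = 1 / 2 * (energy u - lam * (norm_L2 M u)\<^sup>2) + 1 / p * (LINT x|M. \<bar>u x\<bar> powr p)"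

lemma J_energy_decouple:
  assumes "u \<in> H10 \<Omega>" "v \<in> H10 \<Omega>"
  shows "J_energy \<Omega> p lam1 lam2 \<beta> u v = scalar_energy lam1 u + scalar_energy lam2 v
    - 2 * \<beta> / p * coupling_part \<Omega> p u v"
  unfolding J_energy_def quad_part_eq[OF assms] power_part_eq[OF assms] scalar_energy_def
  by (simp add: algebra_simps)

lemma coupling_part_nonneg: "coupling_part \<Omega> p u v \<ge> 0"
  unfolding coupling_part_def by (intro integral_nonneg_AE) auto

lemma ae_zero_energies:
  assumes u: "u \<in> H10 \<Omega>" and z: "ae_zero \<Omega> u"
  shows "scalar_energy lam u = 0" "coupling_part \<Omega> p u v = 0" "coupling_part \<Omega> p v u = 0"
proof -
  have ae: "AE x in M. u x = 0" using z by (simp add: ae_zero_def)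
  obtain w g where W: "H10_graph \<Omega> w g" using H10_imp_graph[OF open_\<Omega> u] by blast
  have ae': "AE x in M. 0 * w x = u x" using ae by eventually_elim simp
  have "energy u = 0"
    using H10_of_graph(5)[OF open_\<Omega> H10_graph_scale[OF W, of 0] ae'] by (simp add: energy_def norm_L2_def)
  moreover have "norm_L2 M u = 0" using ae_zero_iff_l2[OF u] z by simp
  moreover have "(LINT x|M. \<bar>u x\<bar> powr p) = 0"
    by (rule integral_eq_zero_AE) (use ae in \<open>eventually_elim, simp\<close>)
  ultimately show "scalar_energy lam u = 0" by (simp add: scalar_energy_def)
  show "coupling_part \<Omega> p u v = 0" "coupling_part \<Omega> p v u = 0" unfolding coupling_part_def
    by (rule integral_eq_zero_AE, use ae in \<open>eventually_elim, simp\<close>)+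
qed

text \<open>
  Along multiples of \<open>w\<close> the negative quadratic term dominates for small \<open>t\<close>, because \<open>p > 2\<close>.
\<close>

lemma scalar_energy_negative:
  assumes w: "w \<in> H10 \<Omega>" "norm_L2 M w = 1" "energy w < lam"
  shows "\<exists>u\<in>H10 \<Omega>. scalar_energy lam u < 0"
proof -
  define A where "A = (lam - energy w) / 2"
  define B where "B = 1 / p * (LINT x|M. \<bar>w x\<bar> powr p)"
  have A: "A > 0" using w(3) by (simp add: A_def)
  have B: "B \<ge> 0" using p_gt_2 unfolding B_def by (intro mult_nonneg_nonneg integral_nonneg_AE) auto
  \<comment> \<open>Then \<open>t powr (p - 2) = A / (B + 1)\<close>, and the power term is at most \<open>B / (B + 1)\<close> of the quadratic one.\<close>
  define t where "t = (A / (B + 1)) powr (1 / (p - 2))"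
  have t: "t > 0" using A B by (simp add: t_def)
  have "t powr p = t powr 2 * t powr (p - 2)" unfolding powr_add[symmetric] by simp
  also have "t powr (p - 2) = A / (B + 1)" unfolding t_def powr_powr using p_gt_2 A B by simp
  finally have tp: "t powr p = t\<^sup>2 * (A / (B + 1))" using t by simp
  have "scalar_energy lam (\<lambda>x. t * w x) = - t\<^sup>2 * A + t powr p * B"
    unfolding scalar_energy_def energy_def H10_scale(2)[OF open_\<Omega> w(1)] A_def B_def
    using norm_L2_scaleR[of M t w] w(2) t
        by (simp add: energy_def abs_mult powr_mult power_mult_distrib field_simps)
  also have "\<dots> = - (t\<^sup>2 * A / (B + 1))" unfolding tp using B by (simp add: field_simps)
  also have "\<dots> < 0" using t A B by simp
  finally show ?thesis using H10_scale(1)[OF open_\<Omega> w(1)] by blast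
qed

lemma J_energy_abs_le:
  assumes u: "u \<in> H10 \<Omega>" and v: "v \<in> H10 \<Omega>"
  shows "J_energy \<Omega> p lam1 lam2 \<beta> (\<lambda>x. \<bar>u x\<bar>) (\<lambda>x. \<bar>v x\<bar>) \<le> J_energy \<Omega> p lam1 lam2 \<beta> u v"
proof -
  note a = H10_abs[OF open_\<Omega> u] H10_abs[OF open_\<Omega> v]
  have "energy (\<lambda>x. \<bar>u x\<bar>) \<le> energy u" "energy (\<lambda>x. \<bar>v x\<bar>) \<le> energy v"
    unfolding energy_def by (intro power_mono a norm_L2_nonneg)+
  then show ?thesis
    unfolding J_energy_eq_potential[OF u v] J_energy_eq_potential[OF a(1,3)] by (simp add: potential_def)
qed

lemma ground_states:
  assumes ne: "\<Omega> \<noteq> {}" and lam: "lam2 \<ge> lam1" "lam1 > first_eigenvalue \<Omega>"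
  shows "(\<exists>\<delta>0>0. \<forall>\<beta>\<in>{-\<delta>0<..<1}. \<exists>u v.
            (u, v) \<in> nehari_set \<Omega> p lam1 lam2 \<beta> \<and>
            ereal (J_energy \<Omega> p lam1 lam2 \<beta> u v) = nehari_level \<Omega> p lam1 lam2 \<beta> \<and>
            LS_solution \<Omega> p lam1 lam2 \<beta> u v \<and>
            \<not> ae_zero \<Omega> u \<and> \<not> ae_zero \<Omega> v \<and>
            ae_nonneg \<Omega> u \<and> ae_nonneg \<Omega> v) \<and>
         ((\<lambda>\<beta>. nehari_level \<Omega> p lam1 lam2 \<beta>) \<longlongrightarrow> -\<infinity>) (at_left 1)"
proof -
  let ?J = "J_energy \<Omega> p lam1 lam2" and ?I1 = "scalar_energy lam1" and ?I2 = "scalar_energy lam2"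
  obtain w where w: "w \<in> H10 \<Omega>" "norm_L2 M w = 1" "energy w = first_eigenvalue \<Omega>"
    using first_eigenfunction_exists[OF open_\<Omega> bounded_\<Omega> ne] unfolding energy_def by metis
  \<comment> \<open>For \<open>\<beta> = 0\<close> the energy decouples, so its minimiser minimises both scalar energies at once.\<close>
  obtain U V where U: "U \<in> H10 \<Omega>" and V: "V \<in> H10 \<Omega>"
    and UV: "\<And>u v. u \<in> H10 \<Omega> \<Longrightarrow> v \<in> H10 \<Omega> \<Longrightarrow> ?J 0 U V \<le> ?J 0 u v"
    by (rule minimiser_exists[of 0 lam1 lam2]) (simp, rule that)
  have minU: "?I1 U \<le> ?I1 u" if "u \<in> H10 \<Omega>" for u
    using UV[OF that V] by (simp add: J_energy_decouple[OF U V] J_energy_decouple[OF that V])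
  have minV: "?I2 V \<le> ?I2 v" if "v \<in> H10 \<Omega>" for v
    using UV[OF U that] by (simp add: J_energy_decouple[OF U V] J_energy_decouple[OF U that])
  have "?I1 U < 0" using scalar_energy_negative[OF w(1,2), of lam1] minU lam w(3) by fastforce
  moreover have "?I2 V < 0" using scalar_energy_negative[OF w(1,2), of lam2] minV lam w(3) by fastforce
  ultimately have neg: "min (- ?I1 U) (- ?I2 V) > 0" by simp
  define X where "X = coupling_part \<Omega> p U V"
  have X: "X \<ge> 0" unfolding X_def by (rule coupling_part_nonneg)
  \<comment> \<open>For \<open>\<beta> > - \<delta>\<close> the coupling term raises the energy by less than both \<open>- ?I1 U\<close> and \<open>- ?I2 V\<close>.\<close>
  define \<delta> where "\<delta> = p * min (- ?I1 U) (- ?I2 V) / (2 * (X + 1))"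
  have \<delta>: "\<delta> > 0" unfolding \<delta>_def using neg X p_gt_2 by (intro divide_pos_pos mult_pos_pos) auto
  have below: "?J \<beta> U V < ?I1 U \<and> ?J \<beta> U V < ?I2 V" if "\<beta> > - \<delta>" for \<beta>
  proof -
    have "(- \<beta>) * (2 * X / p) \<le> \<delta> * (2 * X / p)"
      using that X p_gt_2 by (intro mult_right_mono) auto
    then have "- (2 * \<beta> / p * X) \<le> 2 * \<delta> / p * X" by (simp add: mult.commute mult.left_commute)
    also have "\<dots> = min (- ?I1 U) (- ?I2 V) * (X / (X + 1))"
    proof -
      have gen: "2 * (p * m / (2 * y)) / p * X = m * (X / y)" if "y > 0" for m y
        using p_gt_2 that by (simp add: field_simps)
      show ?thesis unfolding \<delta>_def by (rule gen) (use X in simp)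
    qed
    also have "\<dots> < min (- ?I1 U) (- ?I2 V) * 1"
      using neg X by (intro mult_strict_left_mono) auto
    finally have "- (2 * \<beta> / p * X) < min (- ?I1 U) (- ?I2 V)" by simp
    then have "- (2 * \<beta> / p * X) < - ?I1 U" "- (2 * \<beta> / p * X) < - ?I2 V" by simp_all
    then show ?thesis unfolding J_energy_decouple[OF U V] X_def by linarith
  qed
  have vectorial: "\<not> ae_zero \<Omega> u \<and> \<not> ae_zero \<Omega> v"
    if \<beta>: "\<beta> > - \<delta>" and u: "u \<in> H10 \<Omega>" and v: "v \<in> H10 \<Omega>" and le: "?J \<beta> u v \<le> ?J \<beta> U V" for \<beta> u v
  proof (intro conjI notI)
    assume z: "ae_zero \<Omega> u"
    have "?J \<beta> u v = ?I2 v" unfolding J_energy_decouple[OF u v] by (simp add: ae_zero_energies[OF u z])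
    then show False using below[OF \<beta>] minV[OF v] le by linarith
  next
    assume z: "ae_zero \<Omega> v"
    have "?J \<beta> u v = ?I1 u" unfolding J_energy_decouple[OF u v] by (simp add: ae_zero_energies[OF v z])
    then show False using below[OF \<beta>] minU[OF u] le by linarith
  qed
  have main: "\<exists>u v. (u, v) \<in> nehari_set \<Omega> p lam1 lam2 \<beta> \<and>
            ereal (?J \<beta> u v) = nehari_level \<Omega> p lam1 lam2 \<beta> \<and>
            LS_solution \<Omega> p lam1 lam2 \<beta> u v \<and>
            \<not> ae_zero \<Omega> u \<and> \<not> ae_zero \<Omega> v \<and> ae_nonneg \<Omega> u \<and> ae_nonneg \<Omega> v \<and>
            (\<forall>u'\<in>H10 \<Omega>. \<forall>v'\<in>H10 \<Omega>. ?J \<beta> u v \<le> ?J \<beta> u' v')"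
    if \<beta>: "- \<delta> < \<beta>" "\<beta> < 1" for \<beta>
  proof -
    obtain u0 v0 where 0: "u0 \<in> H10 \<Omega>" "v0 \<in> H10 \<Omega>"
      and min0: "\<And>u' v'. u' \<in> H10 \<Omega> \<Longrightarrow> v' \<in> H10 \<Omega> \<Longrightarrow> ?J \<beta> u0 v0 \<le> ?J \<beta> u' v'"
      by (rule minimiser_exists[OF \<beta>(2), of lam1 lam2]) (rule that)
    define u v where "u = (\<lambda>x. \<bar>u0 x\<bar>)" and "v = (\<lambda>x. \<bar>v0 x\<bar>)"
    have u: "u \<in> H10 \<Omega>" and v: "v \<in> H10 \<Omega>" unfolding u_def v_def by (intro H10_abs[OF open_\<Omega>] 0)+
    have min: "?J \<beta> u v \<le> ?J \<beta> u' v'" if "u' \<in> H10 \<Omega>" "v' \<in> H10 \<Omega>" for u' v'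
      using J_energy_abs_le[OF 0] min0[OF that] unfolding u_def v_def by (rule order_trans)
    have nz: "\<not> ae_zero \<Omega> u" "\<not> ae_zero \<Omega> v" using vectorial[OF \<beta>(1) u v min[OF U V]] by auto
    then have nz': "\<not> (ae_zero \<Omega> u \<and> ae_zero \<Omega> v)" by simp
    show ?thesis
    proof (intro exI conjI ballI)
      show "(u, v) \<in> nehari_set \<Omega> p lam1 lam2 \<beta>" by (rule minimiser_on_nehari(1)[OF u v min nz'])
      show "ereal (?J \<beta> u v) = nehari_level \<Omega> p lam1 lam2 \<beta>" by (rule minimiser_on_nehari(2)[OF u v min nz'])
      show "LS_solution \<Omega> p lam1 lam2 \<beta> u v" by (rule minimiser_LS_solution[OF u v min])
      show "ae_nonneg \<Omega> u" "ae_nonneg \<Omega> v" by (simp_all add: ae_nonneg_def u_def v_def)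
    qed (use nz min in auto)
  qed
  have "((\<lambda>\<beta>. nehari_level \<Omega> p lam1 lam2 \<beta>) \<longlongrightarrow> -\<infinity>) (at_left 1)"
    unfolding tendsto_MInfty
  proof
    fix r :: real
    define D where "D = (lam1 + lam2) / 2 - energy w"
    have D: "D > 0" using lam w(3) by (simp add: D_def)
    \<comment> \<open>Large enough that the quadratic part alone is below \<open>r - 1\<close>.\<close>
    define t where "t = sqrt ((\<bar>r\<bar> + 2) / D)"
    have t: "t > 0" "t\<^sup>2 * D = \<bar>r\<bar> + 2" using D by (simp_all add: t_def)
    define P where "P = (LINT x|M. \<bar>w x\<bar> powr p)"
    have Jt: "?J \<beta> (\<lambda>x. t * w x) (\<lambda>x. t * w x) = - (\<bar>r\<bar> + 2) + (1 - \<beta>) * (t powr p * (2 * P / p))" for \<beta>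
    proof -
      have "\<bar>a\<bar> powr (p / 2) * \<bar>a\<bar> powr (p / 2) = \<bar>a\<bar> powr p" for a :: real unfolding powr_add[symmetric]
        by simp
      then have "coupling_part \<Omega> p w w = P" by (simp add: coupling_part_def P_def)
      moreover have "quad_part \<Omega> lam1 lam2 w w / 2 = - D"
        unfolding quad_part_eq[OF w(1,1)] w(2) D_def by (simp add: field_simps)
      moreover have "power_part \<Omega> p w w = 2 * P" unfolding power_part_eq[OF w(1,1)] P_def by simp
      ultimately show ?thesis
        unfolding J_energy_ray[OF w(1,1) t(1)] using t(2) by (simp add: field_simps)
    qed
    have "((\<lambda>\<beta>. (1 - \<beta>) * (t powr p * (2 * P / p))) \<longlongrightarrow> (1 - 1) * (t powr p * (2 * P / p))) (at_left 1)"
      by (intro tendsto_intros)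
    then have "\<forall>\<^sub>F \<beta> in at_left 1. (1 - \<beta>) * (t powr p * (2 * P / p)) < 1"
      by (intro order_tendstoD(2)) auto
    moreover have "\<forall>\<^sub>F \<beta> in at_left (1::real). 0 < \<beta> \<and> \<beta> < 1"
      by (auto simp: eventually_at_left_field intro!: exI[of _ 0])
    ultimately show "\<forall>\<^sub>F \<beta> in at_left 1. nehari_level \<Omega> p lam1 lam2 \<beta> < ereal r"
    proof eventually_elim
      case (elim \<beta>)
      then have "- \<delta> < \<beta>" "\<beta> < 1" using \<delta> by auto
      from main[OF this] obtain u v where lev: "ereal (?J \<beta> u v) = nehari_level \<Omega> p lam1 lam2 \<beta>"
        and min: "\<forall>u'\<in>H10 \<Omega>. \<forall>v'\<in>H10 \<Omega>. ?J \<beta> u v \<le> ?J \<beta> u' v'" by blast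
      have "?J \<beta> u v \<le> ?J \<beta> (\<lambda>x. t * w x) (\<lambda>x. t * w x)"
        using min H10_scale(1)[OF open_\<Omega> w(1), of t] by blast
      also have "\<dots> < r" unfolding Jt using elim by linarith
      finally show ?case unfolding lev[symmetric] by simp
    qed
  qed
  moreover have "\<forall>\<beta>\<in>{-\<delta><..<1}. \<exists>u v.
            (u, v) \<in> nehari_set \<Omega> p lam1 lam2 \<beta> \<and>
            ereal (?J \<beta> u v) = nehari_level \<Omega> p lam1 lam2 \<beta> \<and>
            LS_solution \<Omega> p lam1 lam2 \<beta> u v \<and>
            \<not> ae_zero \<Omega> u \<and> \<not> ae_zero \<Omega> v \<and>
            ae_nonneg \<Omega> u \<and> ae_nonneg \<Omega> v"
    using main by (meson greaterThanLessThan_iff)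
  ultimately show ?thesis using \<delta> by blast
qed

end

theorem theorem1p1:
  fixes \<Omega> :: "'a::euclidean_space set" and p lam1 lam2 :: real
  assumes "DIM('a) \<ge> 2"
    and "domain \<Omega>" and "bounded \<Omega>"
    and "2 < p" and "ereal p < critical_exponent DIM('a)"
    and "lam2 \<ge> lam1" and "lam1 > first_eigenvalue \<Omega>"
  shows "(\<exists>\<delta>0>0. \<forall>\<beta>\<in>{-\<delta>0<..<1}. \<exists>u v.
            (u, v) \<in> nehari_set \<Omega> p lam1 lam2 \<beta> \<and>
            ereal (J_energy \<Omega> p lam1 lam2 \<beta> u v) = nehari_level \<Omega> p lam1 lam2 \<beta> \<and>
            LS_solution \<Omega> p lam1 lam2 \<beta> u v \<and>
            \<not> ae_zero \<Omega> u \<and> \<not> ae_zero \<Omega> v \<and>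
            ae_nonneg \<Omega> u \<and> ae_nonneg \<Omega> v) \<and>
         ((\<lambda>\<beta>. nehari_level \<Omega> p lam1 lam2 \<beta>) \<longlongrightarrow> -\<infinity>) (at_left 1)"
proof -
  interpret dirichlet_system \<Omega> p
    by unfold_locales (use assms in \<open>auto simp: domain_def\<close>)
  show ?thesis using assms by (intro ground_states) (auto simp: domain_def)
qed

end
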